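(* Let $\mathbb{K}$ be an algebraically closed field of characteristic zero. (1) There are two equivalence classes of additive actions on $Q(2,3)$. (2) There is a unique equivalence class of additive actions on $Q(2,4)$.
   Context: $Q(n,k)$ denotes the quadric of dimension $n$ and rank $k$ in the projective space $\mathbb{P}^{n+1}$ over $\mathbb{K}$, i.e. the zero locus of a quadratic form of rank $k$ in $n+2$ variables. $\mathbb{G}_a$ is the additive group of $\mathbb{K}$, and $\mathbb{G}_a^n = \mathbb{G}_a\times\ldots\times\mathbb{G}_a$ ($n$ times). An additive action on an irreducible algebraic variety $X$ of dimension $n$ over $\mathbb{K}$ is a regular action $\mathbb{G}_a^n\times X\to X$ with an open orbit. An additive action of the group $\mathbb{G}_a^n$ on a variety $X$ is equivalent to an additive action of $\mathbb{G}_a^n$ on a variety $Y$ if there is a $\mathbb{G}_a^n$-equivariant isomorphism between $X$ and $Y$.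
   Formalization: Equivalence of additive actions is taken up to an automorphism of the group G_a^n; with strictly G_a^n-equivariant isomorphisms there would be infinitely many classes on both Q(2,3) and Q(2,4). *)

theory Defs
  imports "HOL-Analysis.Analysis" "HOL-Library.Poly_Mapping"
begin

text \<open>
  Classical (point-set) algebraic geometry over an algebraically closed field.
  Polynomials in variables indexed by a finite type are finitely supported
  functions from exponent vectors to coefficients.
\<close>

type_synonym ('i, 'a) mpoly = "('i \<Rightarrow>\<^sub>0 nat) \<Rightarrow>\<^sub>0 'a"

definition mpoly_eval :: "('i::finite, 'a::comm_ring_1) mpoly \<Rightarrow> ('i \<Rightarrow> 'a) \<Rightarrow> 'a" where
  "mpoly_eval p x =
    (\<Sum>m\<in>Poly_Mapping.keys p. Poly_Mapping.lookup p m * (\<Prod>i\<in>UNIV. x i ^ Poly_Mapping.lookup m i))"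

text \<open>Homogeneous of degree \<open>d\<close> in the variables from \<open>V\<close>; the zero polynomial qualifies for every \<open>d\<close>.\<close>

definition homogeneous :: "'i set \<Rightarrow> nat \<Rightarrow> ('i::finite, 'a::comm_ring_1) mpoly \<Rightarrow> bool" where
  "homogeneous V d p \<longleftrightarrow> (\<forall>m\<in>Poly_Mapping.keys p. (\<Sum>i\<in>V. Poly_Mapping.lookup m i) = d)"

text \<open>
  A point of the projective space of \<open>'a ^ 'm\<close>, of dimension \<open>CARD('m) - 1\<close>, is a
  one-dimensional linear subspace, given as a set of vectors.
\<close>

definition line :: "'a::field ^ 'm \<Rightarrow> ('a ^ 'm) set" where
  "line v = vec.span {v}"

definition proj_space :: "('a::field ^ 'm) set set" where
  "proj_space = {line v | v. v \<noteq> 0}"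

definition zariski_open :: "('a::field ^ 'm) set set \<Rightarrow> bool" where
  "zariski_open U \<longleftrightarrow> (\<exists>S :: ('m, 'a) mpoly set.
     (\<forall>p\<in>S. \<exists>d. homogeneous UNIV d p) \<and>
     U = proj_space - {L. \<forall>p\<in>S. \<forall>v\<in>L. mpoly_eval p (($) v) = 0})"

text \<open>
  The Zariski topology of the product of the affine space \<open>'a ^ 'n\<close> with a projective space:
  polynomials in the affine coordinates (\<open>Inl\<close>) and the homogeneous coordinates (\<open>Inr\<close>),
  homogeneous in the latter.
\<close>

definition zariski_open_prod :: "(('a::field ^ 'n) \<times> ('a ^ 'm) set) set \<Rightarrow> bool" where
  "zariski_open_prod U \<longleftrightarrow> (\<exists>S :: ('n + 'm, 'a) mpoly set.
     (\<forall>p\<in>S. \<exists>d. homogeneous (range Inr) d p) \<and>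
     U = UNIV \<times> proj_space -
       {(g, L). \<forall>p\<in>S. \<forall>v\<in>L. mpoly_eval p (case_sum (($) g) (($) v)) = 0})"

text \<open>
  A map into a projective space is regular if locally it is given by polynomials,
  homogeneous of one common degree in the homogeneous coordinates and without common zeros
  on the open set in question.
\<close>

definition regular_map ::
  "('a::field ^ 'm) set set \<Rightarrow> ('a ^ 'l) set set \<Rightarrow> (('a ^ 'm) set \<Rightarrow> ('a ^ 'l) set) \<Rightarrow> bool" where
  "regular_map X Y f \<longleftrightarrow> f ` X \<subseteq> Y \<and>
     (\<forall>x\<in>X. \<exists>U. zariski_open U \<and> x \<in> U \<and>
       (\<exists>(F :: 'l \<Rightarrow> ('m, 'a) mpoly) d. (\<forall>i. homogeneous UNIV d (F i)) \<and>
         (\<forall>v. v \<noteq> 0 \<and> line v \<in> X \<inter> U \<longrightarrow>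
           (let w = (\<chi> i. mpoly_eval (F i) (($) v)) in w \<noteq> 0 \<and> f (line v) = line w))))"

definition regular_map_prod ::
  "('a::field ^ 'm) set set \<Rightarrow> ('a ^ 'l) set set \<Rightarrow>
    ('a ^ 'n \<Rightarrow> ('a ^ 'm) set \<Rightarrow> ('a ^ 'l) set) \<Rightarrow> bool" where
  "regular_map_prod X Y f \<longleftrightarrow> (\<forall>g. f g ` X \<subseteq> Y) \<and>
     (\<forall>g0. \<forall>x\<in>X. \<exists>U. zariski_open_prod U \<and> (g0, x) \<in> U \<and>
       (\<exists>(F :: 'l \<Rightarrow> ('n + 'm, 'a) mpoly) d. (\<forall>i. homogeneous (range Inr) d (F i)) \<and>
         (\<forall>g v. v \<noteq> 0 \<and> line v \<in> X \<and> (g, line v) \<in> U \<longrightarrow>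
           (let w = (\<chi> i. mpoly_eval (F i) (case_sum (($) g) (($) v)))
            in w \<noteq> 0 \<and> f g (line v) = line w))))"

definition regular_iso ::
  "('a::field ^ 'm) set set \<Rightarrow> ('a ^ 'l) set set \<Rightarrow> (('a ^ 'm) set \<Rightarrow> ('a ^ 'l) set) \<Rightarrow> bool" where
  "regular_iso X Y f \<longleftrightarrow>
     bij_betw f X Y \<and> regular_map X Y f \<and> regular_map Y X (inv_into X f)"

text \<open>The vector group \<open>G_a^n\<close> is \<open>'a ^ 'n\<close> under addition; its automorphisms as an algebraic group:\<close>

definition polynomial_map :: "('a::field ^ 'n \<Rightarrow> 'a ^ 'n) \<Rightarrow> bool" where
  "polynomial_map h \<longleftrightarrow>
     (\<exists>P :: 'n \<Rightarrow> ('n, 'a) mpoly. \<forall>x. h x = (\<chi> i. mpoly_eval (P i) (($) x)))"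

definition vector_group_aut :: "('a::field ^ 'n \<Rightarrow> 'a ^ 'n) \<Rightarrow> bool" where
  "vector_group_aut h \<longleftrightarrow>
     bij h \<and> (\<forall>g g'. h (g + g') = h g + h g') \<and> polynomial_map h \<and> polynomial_map (inv h)"

text \<open>
  Intended for irreducible closed \<open>X\<close> of dimension \<open>CARD('n)\<close>. Values of \<open>\<alpha>\<close> outside \<open>X\<close>
  are irrelevant here and for the equivalence below.
\<close>

definition additive_action ::
  "('a::field ^ 'm) set set \<Rightarrow> ('a ^ 'n \<Rightarrow> ('a ^ 'm) set \<Rightarrow> ('a ^ 'm) set) \<Rightarrow> bool" where
  "additive_action X \<alpha> \<longleftrightarrow>
     regular_map_prod X X \<alpha> \<and>
     (\<forall>x\<in>X. \<alpha> 0 x = x) \<and>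
     (\<forall>g h. \<forall>x\<in>X. \<alpha> (g + h) x = \<alpha> g (\<alpha> h x)) \<and>
     (\<exists>x\<in>X. \<exists>U. zariski_open U \<and> range (\<lambda>g. \<alpha> g x) = X \<inter> U)"

text \<open>
  Equivariance is understood up to an automorphism of the acting group, as is usual for additive
  actions. With the identity automorphism only, the translations
  \<open>(x, y) \<mapsto> (x + a s + b t, y + c s + d t)\<close> on the product of two projective lines would
  already form infinitely many classes, since the unordered pair of lines
  \<open>{a s + b t = 0}\<close>, \<open>{c s + d t = 0}\<close> in the group would be an invariant.
\<close>

definition equivalent_actions ::
  "('a::field ^ 'm) set set \<Rightarrow> ('a ^ 'n \<Rightarrow> ('a ^ 'm) set \<Rightarrow> ('a ^ 'm) set) \<Rightarrow>
   ('a ^ 'l) set set \<Rightarrow> ('a ^ 'n \<Rightarrow> ('a ^ 'l) set \<Rightarrow> ('a ^ 'l) set) \<Rightarrow> bool" where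
  "equivalent_actions X \<alpha> Y \<beta> \<longleftrightarrow>
     (\<exists>\<phi> \<psi>. regular_iso X Y \<phi> \<and> vector_group_aut \<psi> \<and>
        (\<forall>g. \<forall>x\<in>X. \<phi> (\<alpha> g x) = \<beta> (\<psi> g) (\<phi> x)))"

definition additive_action_classes ::
  "('a::field ^ 'm) set set \<Rightarrow> ('a ^ 'n \<Rightarrow> ('a ^ 'm) set \<Rightarrow> ('a ^ 'm) set) set set" where
  "additive_action_classes X =
     {\<alpha>. additive_action X \<alpha>} //
     {(\<alpha>, \<beta>). additive_action X \<alpha> \<and> additive_action X \<beta> \<and> equivalent_actions X \<alpha> X \<beta>}"

text \<open>
  In characteristic other than two, quadratic forms correspond to symmetric matrices, and the
  rank of the form is that of the matrix. The quadrics \<open>Q(n, k)\<close> are the members of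
  \<open>quadrics k\<close> for \<open>CARD('m) = n + 2\<close>.
\<close>

definition quadratic_form :: "'a::field ^ 'm ^ 'm \<Rightarrow> 'a ^ 'm \<Rightarrow> 'a" where
  "quadratic_form A v = (\<Sum>i\<in>UNIV. \<Sum>j\<in>UNIV. A $ i $ j * v $ i * v $ j)"

definition quadrics :: "nat \<Rightarrow> ('a::field_char_0 ^ 'm) set set set" where
  "quadrics k = {{L \<in> proj_space. \<forall>v\<in>L. quadratic_form A v = 0} | A.
     transpose A = A \<and> rank A = k}"

end

theory Submission
  imports Defs "HOL-Computational_Algebra.Polynomial_Factorial"
begin

text \<open>
  Let \<open>X\<close> be a quadric surface of rank four or three, and let \<open>\<pi>\<close> parametrise its affine cone: by
  \<open>(x, y) \<mapsto> x \<otimes> y\<close> from pairs of vectors of the plane in rank four, by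
  \<open>(u, v, w) \<mapsto> (u\<^sup>2, u v, v\<^sup>2, w)\<close> in rank three. The parameters live in an affine space, whose
  polynomial ring is factorial, and \<open>\<pi>\<close> vanishes only in codimension at least two, so that a
  polynomial without zeros off \<open>{\<pi> = 0}\<close> is constant.
  
  Additive actions are linear. In the group variables \<open>g\<close> and the parameters \<open>z\<close>, an action
  \<open>\<alpha>\<close> is locally a tuple of polynomials. After division by their greatest common divisor all these
  tuples agree up to a factor, and so a single tuple \<open>G(g, z)\<close> represents \<open>\<alpha>\<close> everywhere. Since
  \<open>\<alpha>\<close> is the identity at \<open>g = 0\<close>, \<open>G(0, z)\<close> is a constant multiple of \<open>\<pi> z\<close>. Rescaling \<open>z\<close>
  without moving the line of \<open>\<pi> z\<close> multiplies \<open>G\<close> by a constant, which does not depend on \<open>g\<close> and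
  can be read off at \<open>g = 0\<close>. So \<open>G\<close> has the same weights as \<open>\<pi>\<close>, which makes it linear in
  \<open>\<pi>\<close> (\<open>linear_lift\<close>). Hence \<open>g\<close> acts by a matrix \<open>M(g)\<close> with polynomial entries. The
  matrix \<open>M(g) M(h) M(-g-h)\<close> is a scalar, nowhere zero and polynomial in \<open>(g, h)\<close>, so it is the
  identity: \<open>M\<close> is a homomorphism (\<open>projective_hom_imp_hom\<close>). For the same reason it consists of
  isometries of the bilinear form \<open>b\<close> of the quadric (\<open>isometry\<close>).
  
  Normal forms of the orbits. Let \<open>x\<^sub>0\<close> span a point of the open orbit. Since the orbit is dense, the
  vectors \<open>M(g) x\<^sub>0\<close> span the whole space. By invariance \<open>b(M(g) x\<^sub>0, M(h) x\<^sub>0) = f(g - h)\<close>. Along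
  a one-parameter subgroup the orbit is a polynomial curve of degree at most three, because its
  generator is a nilpotent four by four matrix (\<open>one_parameter_orbit_degree\<close>); as \<open>f\<close> is even and
  \<open>f(0) = 0\<close>, it is a quadratic form in two variables (\<open>orbit_form\<close>). In coordinates \<open>(s, t)\<close> of the
  group, \<open>f\<close> is \<open>s t\<close> or \<open>\<kappa> s\<^sup>2\<close>. The translates of \<open>f\<close> span the functions \<open>g \<mapsto> b(M(g) x\<^sub>0, w)\<close>.
  
  \<^item> In rank four these are all coordinates of the orbit; \<open>\<kappa> s\<^sup>2\<close> would only give three dimensions,
    so \<open>f = s t\<close> and \<open>M(g) x\<^sub>0 = w\<^sub>1 + s w\<^sub>2 + t w\<^sub>3 + s t w\<^sub>4\<close>. The matrix with columns \<open>w\<^sub>i\<close> carries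
    the translations \<open>(1, s, t, s t)\<close> of the product of two projective lines to \<open>\<alpha>\<close>.
  
  \<^item> In rank three they are the coordinates modulo the vertex of the cone; \<open>f = \<kappa> s\<^sup>2\<close>, and
    \<open>M(g) x\<^sub>0 = w\<^sub>1 + s w\<^sub>2 + s\<^sup>2 w\<^sub>3 + (\<epsilon> s\<^sup>3 + t) w\<^sub>4\<close> with \<open>w\<^sub>4\<close> on the
    line of the vertex. Rescaling \<open>s\<close> makes
    \<open>\<epsilon>\<close> zero or one. For \<open>\<epsilon> = 0\<close> a whole line of the cone is fixed pointwise, for \<open>\<epsilon> = 1\<close> only the
    vertex is fixed, and the number of fixed points is the same for equivalent actions.
  
  Finally, a symmetric matrix over an algebraically closed field is determined up to congruence by
  its rank, so that it suffices to consider one quadric of each rank.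
\<close>

section \<open>Polynomial functions\<close>

text \<open>
  Functions on \<open>'i \<Rightarrow> 'a\<close> that are polynomial in the coordinates from \<open>I\<close>. Working with functions
  makes substitution trivial; over an infinite field they carry the same information as polynomials.
\<close>

inductive polyfun :: "'i set \<Rightarrow> (('i \<Rightarrow> 'a::comm_ring_1) \<Rightarrow> 'a) \<Rightarrow> bool" for I where
  const: "polyfun I (\<lambda>z. c)"
| var: "i \<in> I \<Longrightarrow> polyfun I (\<lambda>z. z i)"
| add: "polyfun I f \<Longrightarrow> polyfun I g \<Longrightarrow> polyfun I (\<lambda>z. f z + g z)"
| mult: "polyfun I f \<Longrightarrow> polyfun I g \<Longrightarrow> polyfun I (\<lambda>z. f z * g z)"

lemmas polyfun_intros = polyfun.const polyfun.var polyfun.add polyfun.mult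

lemma polyfun_uminus: "polyfun I f \<Longrightarrow> polyfun I (\<lambda>z. - f z)"
  using polyfun.mult[OF polyfun.const[of I "-1"], of f] by simp

lemma polyfun_diff: "polyfun I f \<Longrightarrow> polyfun I g \<Longrightarrow> polyfun I (\<lambda>z. f z - g z)"
  using polyfun.add[OF _ polyfun_uminus[of I g]] by simp

lemma polyfun_power: "polyfun I f \<Longrightarrow> polyfun I (\<lambda>z. f z ^ n)"
  by (induction n) (auto intro: polyfun_intros)

lemma polyfun_sum: "(\<And>x. x \<in> A \<Longrightarrow> polyfun I (f x)) \<Longrightarrow> polyfun I (\<lambda>z. \<Sum>x\<in>A. f x z)"
  by (induction A rule: infinite_finite_induct) (auto intro: polyfun_intros)

lemma polyfun_prod: "(\<And>x. x \<in> A \<Longrightarrow> polyfun I (f x)) \<Longrightarrow> polyfun I (\<lambda>z. \<Prod>x\<in>A. f x z)"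
  by (induction A rule: infinite_finite_induct) (auto intro: polyfun_intros)

lemma polyfun_subst:
  assumes "polyfun I f" and "\<And>i. i \<in> I \<Longrightarrow> polyfun J (\<lambda>z. s z i)"
  shows "polyfun J (\<lambda>z. f (s z))"
  using assms by induction (auto intro: polyfun_intros)

lemma polyfun_upd:
  assumes "j \<noteq> i \<Longrightarrow> polyfun I (\<lambda>z. s z j)" and "polyfun I c"
  shows "polyfun I (\<lambda>z. ((s z)(i := c z)) j)"
  using assms by (cases "j = i") auto

lemma polyfun_mono: "polyfun I f \<Longrightarrow> I \<subseteq> J \<Longrightarrow> polyfun J f"
  by (induction rule: polyfun.induct) (auto intro: polyfun_intros)

lemma polyfun_cong_point: "polyfun I f \<Longrightarrow> (\<And>i. i \<in> I \<Longrightarrow> z i = z' i) \<Longrightarrow> f z = f z'"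
  by (induction rule: polyfun.induct) auto

lemma polyfun_mpoly_eval:
  assumes "\<And>i. polyfun I (\<lambda>z. s z i)"
  shows "polyfun I (\<lambda>z. mpoly_eval p (s z))"
  unfolding mpoly_eval_def
  by (intro polyfun_sum polyfun_intros polyfun_prod polyfun_power assms)

lemma polyfun_matrix_vector:
  "(\<And>j. polyfun I (\<lambda>z. v z $ j)) \<Longrightarrow> polyfun I (\<lambda>z. (B *v v z) $ i)"
  by (simp add: matrix_vector_mult_def) (intro polyfun_sum polyfun_intros)

lemma polyfun_along_curve:
  assumes "polyfun I f" and "\<And>i. i \<in> I \<Longrightarrow> \<exists>p. \<forall>t. s t i = poly p t"
  shows "\<exists>p. \<forall>t. f (s t) = poly p t"
  using assms
proof induction
  case (const c)
  then show ?case by (intro exI[of _ "[:c:]"]) simp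
next
  case (add f g)
  then show ?case by (metis poly_add)
next
  case (mult f g)
  then show ?case by (metis poly_mult)
qed auto

text \<open>
  Polynomial functions have no zero divisors: on the line through \<open>a\<close> and \<open>b\<close> both factors are
  polynomials in one variable.
\<close>

lemma polyfun_domain:
  fixes f g :: "('i \<Rightarrow> 'a::field_char_0) \<Rightarrow> 'a"
  assumes f: "polyfun I f" and g: "polyfun I g" and fg: "\<And>z. f z * g z = 0"
    and a: "f a \<noteq> 0"
  shows "g b = 0"
proof -
  define s where "s t i = a i + t * (b i - a i)" for t i
  have s: "\<exists>p. \<forall>t. s t i = poly p t" for i
    by (intro exI[of _ "[:a i, b i - a i:]"]) (simp add: s_def)
  obtain p where p: "\<And>t. f (s t) = poly p t"
    using polyfun_along_curve[OF f, of s, OF s] by blast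
  obtain q where q: "\<And>t. g (s t) = poly q t"
    using polyfun_along_curve[OF g, of s, OF s] by blast
  have "poly (p * q) t = 0" for t
    using fg[of "s t"] by (simp add: p q)
  then have "p * q = 0"
    using poly_all_0_iff_0 by blast
  moreover have "p \<noteq> 0"
    using a p[of 0] by (auto simp: s_def[abs_def])
  ultimately have "q = 0" by simp
  then have "g (s 1) = 0" by (simp add: q)
  then show ?thesis by (simp add: s_def[abs_def])
qed

lemma polyfun_mult_nonzero:
  fixes f g :: "('i \<Rightarrow> 'a::field_char_0) \<Rightarrow> 'a"
  assumes "polyfun I f" "polyfun I g" "f a \<noteq> 0" "g b \<noteq> 0"
  shows "\<exists>z. f z * g z \<noteq> 0"
  using polyfun_domain[of I f g a b] assms by blast

text \<open>
  Only the line in the direction of coordinate \<open>i\<close> has to avoid the zeros of \<open>f\<close>. This is what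
  allows to move around a closed set of codimension two.
\<close>

lemma polyfun_nonvanishing_const:
  fixes f :: "('i \<Rightarrow> 'a::alg_closed_field) \<Rightarrow> 'a"
  assumes f: "polyfun I f" and nz: "\<And>c. f (z(i := c)) \<noteq> 0"
  shows "f (z(i := c)) = f z"
proof -
  have "\<exists>p. \<forall>t. (z(i := t)) j = poly p t" for j
    by (cases "j = i") (auto intro: exI[of _ "[:0, 1:]"] exI[of _ "[:z j:]"])
  then obtain p where p: "\<And>t. f (z(i := t)) = poly p t"
    using polyfun_along_curve[OF f, of "\<lambda>t. z(i := t)"] by blast
  then have "degree p = 0"
    using nz alg_closed_imp_poly_has_root[of p] by (metis gr0I)
  then obtain k where "p = [:k:]"
    by (metis degree_eq_zeroE)
  then show ?thesis
    using p[of c] p[of "z i"] by simp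
qed

lemma polyfun_nonvanishing_everywhere_const:
  fixes f :: "('i \<Rightarrow> 'a::alg_closed_field) \<Rightarrow> 'a"
  assumes f: "polyfun I f" and nz: "\<And>z. f z \<noteq> 0"
  shows "f a = f b"
proof -
  define s where "s t i = a i + t * (b i - a i)" for t i
  have s: "\<exists>p. \<forall>t. s t i = poly p t" for i
    by (intro exI[of _ "[:a i, b i - a i:]"]) (simp add: s_def)
  obtain p where p: "\<And>t. f (s t) = poly p t"
    using polyfun_along_curve[OF f, of s, OF s] by blast
  then have "degree p = 0"
    using nz alg_closed_imp_poly_has_root[of p] by (metis gr0I)
  then obtain k where "p = [:k:]"
    by (metis degree_eq_zeroE)
  then have "f (s 0) = f (s 1)" by (simp add: p)
  then show ?thesis by (simp add: s_def[abs_def])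
qed

lemma poly_eq_if_eq_nonzero:
  fixes p q :: "'a::field_char_0 poly"
  assumes "\<And>t. t \<noteq> 0 \<Longrightarrow> poly p t = poly q t"
  shows "p = q"
proof -
  have "poly ([:0, 1:] * (p - q)) t = 0" for t
    using assms[of t] by (cases "t = 0") auto
  then have "[:0, 1:] * (p - q) = 0"
    using poly_all_0_iff_0 by blast
  then show ?thesis by simp
qed

section \<open>Common divisors of polynomial functions\<close>

text \<open>
  Iterated polynomial rings are factorial for the type classes as soon as their coefficients are a
  field with normalisation and gcd. An arbitrary field becomes one in a copy of its type, where
  every nonzero element is normalised to one.
\<close>

typedef 'a scalar = "UNIV :: 'a set" ..

setup_lifting type_definition_scalar

instantiation scalar :: (field) field
begin
lift_definition zero_scalar :: "'a scalar" is 0 .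
lift_definition one_scalar :: "'a scalar" is 1 .
lift_definition plus_scalar :: "'a scalar \<Rightarrow> 'a scalar \<Rightarrow> 'a scalar" is "(+)" .
lift_definition minus_scalar :: "'a scalar \<Rightarrow> 'a scalar \<Rightarrow> 'a scalar" is "(-)" .
lift_definition uminus_scalar :: "'a scalar \<Rightarrow> 'a scalar" is "uminus" .
lift_definition times_scalar :: "'a scalar \<Rightarrow> 'a scalar \<Rightarrow> 'a scalar" is "(*)" .
lift_definition divide_scalar :: "'a scalar \<Rightarrow> 'a scalar \<Rightarrow> 'a scalar" is "(/)" .
lift_definition inverse_scalar :: "'a scalar \<Rightarrow> 'a scalar" is "inverse" .
instance
  by standard (transfer; simp add: algebra_simps divide_inverse)+
end

instantiation scalar ::
  (field) "{unique_euclidean_ring, normalization_euclidean_semiring, normalization_semidom_multiplicative}"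
begin
definition "normalize_scalar (x :: 'a scalar) = (if x = 0 then 0 else 1 :: 'a scalar)"
definition "unit_factor_scalar (x :: 'a scalar) = x"
definition "modulo_scalar (x :: 'a scalar) (y :: 'a scalar) = (if y = 0 then x else 0)"
definition "euclidean_size_scalar (x :: 'a scalar) = (if x = 0 then 0 else 1 :: nat)"
definition "division_segment_scalar (x :: 'a scalar) = (1 :: 'a scalar)"
instance
  by standard
    (simp_all add: normalize_scalar_def unit_factor_scalar_def modulo_scalar_def
      euclidean_size_scalar_def division_segment_scalar_def
      dvd_field_iff field_split_simps split: if_splits)
end

instantiation scalar :: (field) euclidean_ring_gcd
begin
definition gcd_scalar :: "'a scalar \<Rightarrow> 'a scalar \<Rightarrow> 'a scalar" where
  "gcd_scalar = Euclidean_Algorithm.gcd"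
definition lcm_scalar :: "'a scalar \<Rightarrow> 'a scalar \<Rightarrow> 'a scalar" where
  "lcm_scalar = Euclidean_Algorithm.lcm"
definition Gcd_scalar :: "'a scalar set \<Rightarrow> 'a scalar" where
  "Gcd_scalar = Euclidean_Algorithm.Gcd"
definition Lcm_scalar :: "'a scalar set \<Rightarrow> 'a scalar" where
  "Lcm_scalar = Euclidean_Algorithm.Lcm"
instance by standard (simp_all add: gcd_scalar_def lcm_scalar_def Gcd_scalar_def Lcm_scalar_def)
end

instance scalar :: (field) field_gcd ..

text \<open>
  The ring \<open>'r\<close> is isomorphic, by \<open>e\<close>, to the polynomial functions in the first \<open>n\<close> coordinates.
\<close>

definition polyfun_model :: "nat \<Rightarrow> ('r::comm_ring_1 \<Rightarrow> (nat \<Rightarrow> 'a::comm_ring_1) \<Rightarrow> 'a) \<Rightarrow> bool" where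
  "polyfun_model n e \<longleftrightarrow>
     (\<forall>p q z. e (p + q) z = e p z + e q z) \<and>
     (\<forall>p q z. e (p * q) z = e p z * e q z) \<and>
     (\<forall>p. (\<forall>z. e p z = 0) \<longrightarrow> p = 0) \<and>
     (\<forall>p. polyfun {..<n} (e p)) \<and>
     (\<forall>f. polyfun {..<n} f \<longrightarrow> (\<exists>p. e p = f))"

lemma polyfun_model_scalar: "polyfun_model 0 (\<lambda>p z. Rep_scalar p)"
proof -
  have "\<exists>c. (f :: (nat \<Rightarrow> 'a) \<Rightarrow> 'a) = (\<lambda>z. c)" if "polyfun {} f" for f
    using that by induction auto
  moreover have "(\<lambda>z. Rep_scalar (Abs_scalar c)) = (\<lambda>z. c)" for c :: 'a
    by (simp add: Abs_scalar_inverse)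
  ultimately show ?thesis
    unfolding polyfun_model_def
    by (auto simp: plus_scalar.rep_eq times_scalar.rep_eq intro: polyfun_intros)
      (metis Rep_scalar_inject zero_scalar.rep_eq)
qed

text \<open>
  One more variable: the polynomial ring over a model for \<open>n\<close> variables is a model for \<open>Suc n\<close>.
  Injectivity holds because a nonzero polynomial over an infinite field has a nonzero value.
\<close>

lemma polyfun_model_poly:
  fixes e :: "'r::idom \<Rightarrow> (nat \<Rightarrow> 'a::field_char_0) \<Rightarrow> 'a"
  assumes "polyfun_model n e"
  shows "polyfun_model (Suc n) (\<lambda>p z. poly (map_poly (\<lambda>c. e c z) p) (z n))"
proof -
  have e_add: "e (p + q) z = e p z + e q z" and e_mult: "e (p * q) z = e p z * e q z"
    and e_inj: "(\<And>z. e p z = 0) \<Longrightarrow> p = 0" and e_poly: "polyfun {..<n} (e p)"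
    and e_surj: "polyfun {..<n} f \<Longrightarrow> \<exists>p. e p = f" for p q z f
    using assms unfolding polyfun_model_def by blast+
  have e0 [simp]: "e 0 z = 0" for z
    using e_add[of 0 0 z] by simp
  define E where "E p z = poly (map_poly (\<lambda>c. e c z) p) (z n)" for p z
  have E0 [simp]: "E 0 z = 0" for z
    by (simp add: E_def)
  have E_pCons [simp]: "E (pCons a p) z = e a z + z n * E p z" for a p z
    by (cases "a = 0 \<and> p = 0") (auto simp: E_def map_poly_pCons)
  have E_add: "E (p + q) z = E p z + E q z" for p q z
  proof (induction p arbitrary: q)
    case (pCons a p)
    then show ?case
      by (cases q) (simp add: e_add algebra_simps)
  qed simp
  have E_smult: "E (smult a p) z = e a z * E p z" for a p z
    by (induction p) (simp_all add: e_mult algebra_simps)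
  have E_mult: "E (p * q) z = E p z * E q z" for p q z
    by (induction p) (simp_all add: E_add E_smult algebra_simps)
  have E_inj: "p = 0" if E: "\<And>z. E p z = 0" for p
  proof (rule poly_eqI)
    fix i
    have "e (coeff p i) z = 0" for z
    proof -
      have "poly (map_poly (\<lambda>c. e c z) p) t = 0" for t
      proof -
        have "e c (z(n := t)) = e c z" for c
          by (rule polyfun_cong_point[OF e_poly]) auto
        then show ?thesis
          using E[of "z(n := t)"] by (simp add: E_def)
      qed
      then have "map_poly (\<lambda>c. e c z) p = 0"
        using poly_all_0_iff_0 by blast
      then have "coeff (map_poly (\<lambda>c. e c z) p) i = 0" by simp
      then show ?thesis by (simp add: coeff_map_poly)
    qed
    then show "coeff p i = coeff 0 i"
      using e_inj by simp
  qed
  have E_poly: "polyfun {..<Suc n} (E p)" for p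
  proof (induction p)
    case 0
    then show ?case using polyfun.const[of _ 0] by (simp add: E_def)
  next
    case (pCons a p)
    have "polyfun {..<Suc n} (\<lambda>z. e a z + z n * E p z)"
      using pCons by (intro polyfun_intros polyfun_mono[OF e_poly]) auto
    moreover have "(\<lambda>z. e a z + z n * E p z) = E (pCons a p)" by (rule ext) simp
    ultimately show ?case by simp
  qed
  have E_surj: "\<exists>p. E p = f" if "polyfun {..<Suc n} f" for f
    using that
  proof induction
    case (const c)
    obtain p where "e p = (\<lambda>z. c)" using e_surj polyfun.const by blast
    then have "E [:p:] = (\<lambda>z. c)" by (intro ext) simp
    then show ?case by blast
  next
    case (var i)
    obtain p1 where p1: "e p1 = (\<lambda>z. 1)" using e_surj polyfun.const by blast
    show ?case
    proof (cases "i = n")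
      case True
      then have "E [:0, p1:] = (\<lambda>z. z i)" by (intro ext) (simp add: p1)
      then show ?thesis by blast
    next
      case False
      then obtain p where "e p = (\<lambda>z. z i)" using e_surj[of "\<lambda>z. z i"] polyfun.var[of i "{..<n}"] var by auto
      then have "E [:p:] = (\<lambda>z. z i)" by (intro ext) simp
      then show ?thesis by blast
    qed
  next
    case (add f g)
    then obtain p q where "E p = f" "E q = g" by blast
    then have "E (p + q) = (\<lambda>z. f z + g z)" by (intro ext) (simp add: E_add)
    then show ?case by blast
  next
    case (mult f g)
    then obtain p q where "E p = f" "E q = g" by blast
    then have "E (p * q) = (\<lambda>z. f z * g z)" by (intro ext) (simp add: E_mult)
    then show ?case by blast
  qed
  show ?thesis
    unfolding polyfun_model_def E_def[symmetric]
    using E_add E_mult E_inj E_poly E_surj by (auto simp: E_def)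
qed

text \<open>
  In a factorial ring the tuple \<open>F\<close> has a primitive part \<open>G\<close>, and every tuple that is proportional
  to \<open>F\<close> over the field of fractions is a multiple of \<open>G\<close> already over the ring.
\<close>

lemma polyfun_model_primitive_part:
  fixes e :: "'r::{factorial_ring_gcd,semiring_gcd_mult_normalize} \<Rightarrow> (nat \<Rightarrow> 'a::field_char_0) \<Rightarrow> 'a"
    and F :: "'k::finite \<Rightarrow> (nat \<Rightarrow> 'a) \<Rightarrow> 'a"
  assumes e: "polyfun_model n e" and F: "\<And>i. polyfun {..<n} (F i)" and nz: "F i0 z0 \<noteq> 0"
  obtains G h where "\<And>i. polyfun {..<n} (G i)" "polyfun {..<n} h" "\<And>i z. F i z = h z * G i z"
    "\<And>F'. (\<And>i. polyfun {..<n} (F' i)) \<Longrightarrow> (\<And>i j z. F i z * F' j z = F j z * F' i z) \<Longrightarrow>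
       \<exists>h'. polyfun {..<n} h' \<and> (\<forall>i z. F' i z = h' z * G i z)"
proof -
  have e_add: "e (p + q) z = e p z + e q z" and e_mult: "e (p * q) z = e p z * e q z"
    and e_inj: "(\<And>z. e p z = 0) \<Longrightarrow> p = 0" and e_poly: "polyfun {..<n} (e p)"
    and e_surj: "polyfun {..<n} f \<Longrightarrow> \<exists>p. e p = f" for p q z f
    using e unfolding polyfun_model_def by blast+
  have e_eq: "p = q" if "\<And>z. e p z = e q z" for p q
  proof -
    have "e (p - q) z = 0" for z
      using e_add[of "p - q" q z] that by simp
    then show ?thesis using e_inj[of "p - q"] by simp
  qed
  obtain P where P: "\<And>i. e (P i) = F i"
    using e_surj[OF F] by metis
  define d where "d = Gcd (range P)"
  have "P i0 \<noteq> 0"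
    using nz P[of i0] e_add[of 0 0 z0] by auto
  then have d0: "d \<noteq> 0"
    by (auto simp: d_def Gcd_0_iff)
  have "d dvd P i" for i
    by (auto simp: d_def intro: Gcd_dvd)
  then obtain R where R: "\<And>i. P i = d * R i"
    unfolding dvd_def by metis
  show ?thesis
  proof (rule that[of "\<lambda>i. e (R i)" "e d"])
    show "F i z = e d z * e (R i) z" for i z
      by (simp add: P[symmetric] R e_mult)
    fix F' :: "'k \<Rightarrow> (nat \<Rightarrow> 'a) \<Rightarrow> 'a"
    assume F': "\<And>i. polyfun {..<n} (F' i)" and par: "\<And>i j z. F i z * F' j z = F j z * F' i z"
    obtain P' where P': "\<And>i. e (P' i) = F' i"
      using e_surj[OF F'] by metis
    have "P i * P' j = P j * P' i" for i j
      by (rule e_eq) (simp add: e_mult P P' par)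
    then have RP: "R i * P' j = R j * P' i" for i j
      using d0 by (simp add: R mult.assoc)
    \<comment> \<open>\<open>R i0\<close> divides \<open>R j * P' i0\<close> for every \<open>j\<close>, hence also their gcd, which is \<open>P' i0\<close> because
      the \<open>R j\<close> are coprime. The factor \<open>d\<close> replaces the \<open>R j\<close> by the \<open>P j\<close>, whose gcd is \<open>d\<close>.\<close>
    have "d * R i0 dvd P' i0 * P j" for j
    proof -
      have "R i0 dvd R j * P' i0"
        using RP[of i0 j] by (metis dvd_triv_left)
      then have "d * R i0 dvd d * (R j * P' i0)"
        by (rule mult_dvd_mono[OF dvd_refl])
      then show ?thesis
        by (simp add: R mult.commute mult.left_commute)
    qed
    then have "d * R i0 dvd Gcd ((*) (P' i0) ` range P)"
      by (intro Gcd_greatest) auto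
    then have "d * R i0 dvd normalize (P' i0 * d)"
      by (simp add: Gcd_mult d_def)
    then have "d * R i0 dvd d * P' i0"
      by (simp add: mult.commute)
    then have "R i0 dvd P' i0"
      using d0 by simp
    then obtain c where c: "P' i0 = R i0 * c" ..
    have "R i0 \<noteq> 0" using \<open>P i0 \<noteq> 0\<close> R by auto
    have "P' j = c * R j" for j
    proof -
      have "R i0 * P' j = R i0 * (c * R j)"
        using RP[of i0 j] by (simp add: c ac_simps)
      then show ?thesis using \<open>R i0 \<noteq> 0\<close> by simp
    qed
    then have "\<forall>i z. F' i z = e c z * e (R i) z"
      by (simp add: P'[symmetric] e_mult)
    then show "\<exists>h'. polyfun {..<n} h' \<and> (\<forall>i z. F' i z = h' z * e (R i) z)"
      using e_poly by blast
  qed (auto intro: e_poly)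
qed

text \<open>
  Six variables are enough for two group parameters and up to four parameters of a cone.
\<close>

lemma polyfun_primitive_part:
  fixes F :: "'k::finite \<Rightarrow> (nat \<Rightarrow> 'a::field_char_0) \<Rightarrow> 'a"
  assumes "\<And>i. polyfun {..<6} (F i)" and "F i0 z0 \<noteq> 0"
  obtains G h where "\<And>i. polyfun {..<6} (G i)" "polyfun {..<6} h" "\<And>i z. F i z = h z * G i z"
    "\<And>F'. (\<And>i. polyfun {..<6} (F' i)) \<Longrightarrow> (\<And>i j z. F i z * F' j z = F j z * F' i z) \<Longrightarrow>
       \<exists>h'. polyfun {..<6} h' \<and> (\<forall>i z. F' i z = h' z * G i z)"
proof -
  obtain e :: "'a scalar poly poly poly poly poly poly \<Rightarrow> (nat \<Rightarrow> 'a) \<Rightarrow> 'a" where e: "polyfun_model 6 e"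
    using polyfun_model_poly[OF polyfun_model_poly[OF polyfun_model_poly[OF
      polyfun_model_poly[OF polyfun_model_poly[OF polyfun_model_poly[OF
      polyfun_model_scalar[where 'a = 'a]]]]]]]
    by (auto simp: numeral_eq_Suc)
  show ?thesis
  proof (rule polyfun_model_primitive_part[where F = F, OF e assms], goal_cases)
    case (1 G h)
    show ?thesis by (rule that[of G h]) (use 1 in blast)+
  qed
qed

section \<open>Homogeneous functions of low degree\<close>

text \<open>
  The terms up to weight two of a polynomial function in which two variables have weight one and a
  third has weight two. A polynomial of weighted degree one or two is determined by them.
\<close>

lemma weighted_expansion:
  fixes f :: "('i \<Rightarrow> 'a::field) \<Rightarrow> 'a"
  assumes "polyfun I f" and dist: "i \<noteq> j" "i \<noteq> k" "j \<noteq> k"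
  shows "\<exists>P c a b p q r d. \<forall>x y w.
    (\<forall>t. f (z(i := t * x, j := t * y, k := t\<^sup>2 * w)) = poly (P x y w) t) \<and>
    coeff (P x y w) 0 = c \<and> coeff (P x y w) 1 = a * x + b * y \<and>
    coeff (P x y w) 2 = p * x\<^sup>2 + q * x * y + r * y\<^sup>2 + d * w"
  using assms(1)
proof induction
  case (const e)
  show ?case
    by (rule exI[of _ "\<lambda>x y w. [:e:]"], rule exI[of _ e], (rule exI[of _ 0])+)
      (simp add: numeral_2_eq_2)
next
  case (var l)
  show ?case
  proof -
    consider "l = i" | "l = j" | "l = k" | "l \<notin> {i, j, k}" by blast
    then show ?thesis
    proof cases
      case 1
      show ?thesis
        by (rule exI[of _ "\<lambda>x y w. [:0, x:]"], rule exI[of _ 0], rule exI[of _ 1], (rule exI[of _ 0])+)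
          (use 1 dist in \<open>simp add: numeral_2_eq_2\<close>)
    next
      case 2
      show ?thesis
        by (rule exI[of _ "\<lambda>x y w. [:0, y:]"], rule exI[of _ 0], rule exI[of _ 0], rule exI[of _ 1], (rule exI[of _ 0])+)
          (use 2 dist in \<open>simp add: numeral_2_eq_2\<close>)
    next
      case 3
      show ?thesis
        by (rule exI[of _ "\<lambda>x y w. [:0, 0, w:]"], rule exI[of _ 0], rule exI[of _ 0], rule exI[of _ 0],
            rule exI[of _ 0], rule exI[of _ 0], rule exI[of _ 0], rule exI[of _ 1])
          (use 3 dist in \<open>simp add: numeral_2_eq_2\<close>)
    next
      case 4
      show ?thesis
        by (rule exI[of _ "\<lambda>x y w. [:z l:]"], rule exI[of _ "z l"], (rule exI[of _ 0])+)
          (use 4 in \<open>simp add: numeral_2_eq_2\<close>)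
    qed
  qed
next
  case (add f g)
  from add.IH obtain P c a b p q r d where 1: "\<And>x y w.
    (\<forall>t. f (z(i := t * x, j := t * y, k := t\<^sup>2 * w)) = poly (P x y w) t) \<and>
    coeff (P x y w) 0 = c \<and> coeff (P x y w) 1 = a * x + b * y \<and>
    coeff (P x y w) 2 = p * x\<^sup>2 + q * x * y + r * y\<^sup>2 + d * w" by blast
  from add.IH obtain P' c' a' b' p' q' r' d' where 2: "\<And>x y w.
    (\<forall>t. g (z(i := t * x, j := t * y, k := t\<^sup>2 * w)) = poly (P' x y w) t) \<and>
    coeff (P' x y w) 0 = c' \<and> coeff (P' x y w) 1 = a' * x + b' * y \<and>
    coeff (P' x y w) 2 = p' * x\<^sup>2 + q' * x * y + r' * y\<^sup>2 + d' * w" by blast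
  note R = 1[THEN conjunct1, rule_format, symmetric] 1[THEN conjunct2, THEN conjunct1]
    1[THEN conjunct2, THEN conjunct2, THEN conjunct1] 1[THEN conjunct2, THEN conjunct2, THEN conjunct2]
    2[THEN conjunct1, rule_format, symmetric] 2[THEN conjunct2, THEN conjunct1]
    2[THEN conjunct2, THEN conjunct2, THEN conjunct1] 2[THEN conjunct2, THEN conjunct2, THEN conjunct2]
  show ?case
    by (rule exI[of _ "\<lambda>x y w. P x y w + P' x y w"], rule exI[of _ "c + c'"],
        rule exI[of _ "a + a'"], rule exI[of _ "b + b'"], rule exI[of _ "p + p'"],
        rule exI[of _ "q + q'"], rule exI[of _ "r + r'"], rule exI[of _ "d + d'"])
      (simp add: R[unfolded One_nat_def] fun_upd_def algebra_simps)
next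
  case (mult f g)
  from mult.IH obtain P c a b p q r d where 1: "\<And>x y w.
    (\<forall>t. f (z(i := t * x, j := t * y, k := t\<^sup>2 * w)) = poly (P x y w) t) \<and>
    coeff (P x y w) 0 = c \<and> coeff (P x y w) 1 = a * x + b * y \<and>
    coeff (P x y w) 2 = p * x\<^sup>2 + q * x * y + r * y\<^sup>2 + d * w" by blast
  from mult.IH obtain P' c' a' b' p' q' r' d' where 2: "\<And>x y w.
    (\<forall>t. g (z(i := t * x, j := t * y, k := t\<^sup>2 * w)) = poly (P' x y w) t) \<and>
    coeff (P' x y w) 0 = c' \<and> coeff (P' x y w) 1 = a' * x + b' * y \<and>
    coeff (P' x y w) 2 = p' * x\<^sup>2 + q' * x * y + r' * y\<^sup>2 + d' * w" by blast
  have cm: "coeff (A * B) 0 = coeff A 0 * coeff B 0"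
    "coeff (A * B) 1 = coeff A 0 * coeff B 1 + coeff A 1 * coeff B 0"
    "coeff (A * B) 2 = coeff A 0 * coeff B 2 + coeff A 1 * coeff B 1 + coeff A 2 * coeff B 0"
    for A B :: "'a poly"
    by (simp_all add: coeff_mult numeral_2_eq_2)
  note R = 1[THEN conjunct1, rule_format, symmetric] 1[THEN conjunct2, THEN conjunct1]
    1[THEN conjunct2, THEN conjunct2, THEN conjunct1] 1[THEN conjunct2, THEN conjunct2, THEN conjunct2]
    2[THEN conjunct1, rule_format, symmetric] 2[THEN conjunct2, THEN conjunct1]
    2[THEN conjunct2, THEN conjunct2, THEN conjunct1] 2[THEN conjunct2, THEN conjunct2, THEN conjunct2]
  show ?case
    by (rule exI[of _ "\<lambda>x y w. P x y w * P' x y w"], rule exI[of _ "c * c'"],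
        rule exI[of _ "c * a' + a * c'"], rule exI[of _ "c * b' + b * c'"],
        rule exI[of _ "c * p' + a * a' + p * c'"],
        rule exI[of _ "c * q' + a * b' + b * a' + q * c'"],
        rule exI[of _ "c * r' + b * b' + r * c'"], rule exI[of _ "c * d' + d * c'"])
      (simp add: cm[unfolded One_nat_def] R[unfolded One_nat_def] fun_upd_def algebra_simps power2_eq_square)
qed

lemma weighted_homogeneous_degree_two:
  fixes f :: "('i \<Rightarrow> 'a::field_char_0) \<Rightarrow> 'a"
  assumes f: "polyfun I f" and dist: "i \<noteq> j" "i \<noteq> k" "j \<noteq> k"
    and hom: "\<And>t x y w. t \<noteq> 0 \<Longrightarrow> f (z(i := t * x, j := t * y, k := t\<^sup>2 * w)) = t\<^sup>2 * f (z(i := x, j := y, k := w))"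
  shows "\<exists>p q r d. \<forall>x y w. f (z(i := x, j := y, k := w)) = p * x\<^sup>2 + q * x * y + r * y\<^sup>2 + d * w"
proof -
  obtain P c a b p q r d where 1: "\<And>x y w.
    (\<forall>t. f (z(i := t * x, j := t * y, k := t\<^sup>2 * w)) = poly (P x y w) t) \<and>
    coeff (P x y w) 0 = c \<and> coeff (P x y w) 1 = a * x + b * y \<and>
    coeff (P x y w) 2 = p * x\<^sup>2 + q * x * y + r * y\<^sup>2 + d * w"
    using weighted_expansion[OF f dist, of z] by blast
  have "P x y w = monom (f (z(i := x, j := y, k := w))) 2" for x y w
    by (rule poly_eq_if_eq_nonzero) (simp add: 1[THEN conjunct1, rule_format, symmetric] hom poly_monom)
  then have "f (z(i := x, j := y, k := w)) = coeff (P x y w) 2" for x y w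
    by simp
  then show ?thesis using 1 by metis
qed

lemma homogeneous_degree_one:
  fixes f :: "(nat \<Rightarrow> 'a::field_char_0) \<Rightarrow> 'a"
  assumes f: "polyfun {..<n} f" and dist: "i \<noteq> j" and ij: "i < n" "j < n"
    and hom: "\<And>t x y. t \<noteq> 0 \<Longrightarrow> f (z(i := t * x, j := t * y)) = t * f (z(i := x, j := y))"
  shows "f (z(i := x, j := y)) = x * f (z(i := 1, j := 0)) + y * f (z(i := 0, j := 1))"
proof -
  have drop: "f (u(n := e)) = f u" for u e
    by (rule polyfun_cong_point[OF f]) auto
  obtain P c a b p q r d where 1: "\<And>x y w.
    (\<forall>t. f (z(i := t * x, j := t * y, n := t\<^sup>2 * w)) = poly (P x y w) t) \<and>
    coeff (P x y w) 0 = c \<and> coeff (P x y w) 1 = a * x + b * y \<and>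
    coeff (P x y w) 2 = p * x\<^sup>2 + q * x * y + r * y\<^sup>2 + d * w"
    using weighted_expansion[OF f dist, of n z] ij by blast
  have "P x y 0 = monom (f (z(i := x, j := y))) 1" for x y
    by (rule poly_eq_if_eq_nonzero) (use drop in \<open>simp add: 1[THEN conjunct1, rule_format, symmetric] hom poly_monom\<close>)
  then have "f (z(i := x, j := y)) = coeff (P x y 0) 1" for x y
    by simp
  then have "f (z(i := x, j := y)) = a * x + b * y" for x y
    using 1 by simp
  then show ?thesis by simp
qed

section \<open>Points of projective space and Zariski open sets\<close>

lemma mem_line: "w \<in> line v \<longleftrightarrow> (\<exists>k. w = k *s v)"
  by (auto simp: line_def vec.span_singleton)

lemma line_self: "v \<in> line v"
  unfolding mem_line by (rule exI[of _ 1]) simp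

lemma line_eq_iff: 
  fixes v w :: "'a::field ^ 'm"
  assumes "w \<noteq> 0"
  shows "line v = line w \<longleftrightarrow> (\<exists>k. k \<noteq> 0 \<and> w = k *s v)"
proof
  assume eq: "line v = line w"
  have "w \<in> line w" unfolding mem_line by (rule exI[of _ 1]) simp
  then have "w \<in> line v" using eq by simp
  then obtain k where "w = k *s v" by (auto simp: mem_line)
  moreover have "k \<noteq> 0" using assms calculation by auto
  ultimately show "\<exists>k. k \<noteq> 0 \<and> w = k *s v" by blast
next
  assume "\<exists>k. k \<noteq> 0 \<and> w = k *s v"
  then obtain k where k: "k \<noteq> 0" "w = k *s v" by blast
  have "\<exists>l. j *s v = l *s w" for j
    by (rule exI[of _ "j / k"]) (simp add: k)
  then show "line v = line w"
    by (auto simp: mem_line k)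
qed

lemma line_scale: "k \<noteq> 0 \<Longrightarrow> line (k *s v) = line (v :: 'a::field ^ 'm)"
  by (cases "v = 0") (auto intro!: line_eq_iff[THEN iffD2, symmetric])

lemma line_eq_imp_parallel:
  fixes v w :: "'a::field ^ 'm"
  assumes "line v = line w" "w \<noteq> 0"
  shows "v $ i * w $ j = v $ j * w $ i"
proof -
  obtain k where "w = k *s v" using assms line_eq_iff by blast
  then show ?thesis by simp
qed

lemma left_inverse_ker:
  fixes B :: "'a::field ^ 'n ^ 'n"
  assumes "B' ** B = mat 1"
  shows "B *v v = 0 \<longleftrightarrow> v = 0"
proof
  assume "B *v v = 0"
  then have "B' *v (B *v v) = 0" by simp
  then show "v = 0" by (simp add: matrix_vector_mul_assoc assms)
qed simp

lemma image_line: "(*v) B ` line v = line (B *v (v :: 'a::field ^ 'n))"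
proof -
  have "B *v (k *s v) = k *s (B *v v)" for k
    by (simp add: vector_scalar_commute)
  note scale = this
  show ?thesis
  proof
    show "(*v) B ` line v \<subseteq> line (B *v v)"
      by (auto simp: mem_line scale)
    show "line (B *v v) \<subseteq> (*v) B ` line v"
    proof
      fix u assume "u \<in> line (B *v v)"
      then obtain k where "u = B *v (k *s v)" by (auto simp: mem_line scale)
      then show "u \<in> (*v) B ` line v" by (auto simp: mem_line)
    qed
  qed
qed

text \<open>
  An open set that contains a point contains a principal open neighbourhood of it. The scalar \<open>c\<close>
  occurs because the polynomial is only known to be nonzero at some representative of the point.
\<close>

lemma zariski_open_basis:
  fixes v :: "'a::field_char_0 ^ 'm"
  assumes U: "zariski_open U" and v: "line v \<in> U"
  obtains p c where "c \<noteq> 0" "mpoly_eval p (($) (c *s v)) \<noteq> 0"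
    "\<And>w. w \<noteq> 0 \<Longrightarrow> mpoly_eval p (($) w) \<noteq> 0 \<Longrightarrow> line w \<in> U"
proof -
  obtain S where S: "U = proj_space - {L. \<forall>p\<in>S. \<forall>v\<in>L. mpoly_eval p (($) v) = 0}"
    using U unfolding zariski_open_def by blast
  obtain p u where p: "p \<in> S" "u \<in> line v" "mpoly_eval p (($) u) \<noteq> 0"
    using v S by blast
  then obtain k where k: "u = k *s v" by (auto simp: mem_line)
  have "\<exists>r. \<forall>t. mpoly_eval p (($) (t *s v)) = poly r t"
  proof -
    have "polyfun UNIV (mpoly_eval p)"
      by (rule polyfun_mpoly_eval) (auto intro: polyfun_intros)
    then show ?thesis
      by (rule polyfun_along_curve) (auto intro: exI[of _ "[:0, _:]"])
  qed
  then obtain r where r: "\<And>t. mpoly_eval p (($) (t *s v)) = poly r t" by blast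
  have "r \<noteq> 0" using p(3) k r[of k] by auto
  then obtain c where c: "c \<noteq> 0" "poly r c \<noteq> 0"
    using poly_eq_if_eq_nonzero[of r 0] by auto
  show ?thesis
  proof (rule that[of c p])
    fix w :: "'a ^ 'm" assume w: "w \<noteq> 0" "mpoly_eval p (($) w) \<noteq> 0"
    have "w \<in> line w" unfolding mem_line by (rule exI[of _ 1]) simp
    then show "line w \<in> U"
      using w p(1) unfolding S proj_space_def by auto
  qed (use c r in auto)
qed

text \<open>
  The same for a product with an affine space, proved in the same way.
\<close>

lemma zariski_open_prod_basis:
  fixes g :: "'a::field_char_0 ^ 'n" and v :: "'a ^ 'm"
  assumes U: "zariski_open_prod U" and gx: "(g, line v) \<in> U"
  obtains p where "\<exists>c. c \<noteq> 0 \<and> mpoly_eval p (case_sum (($) g) (($) (c *s v))) \<noteq> 0"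
    "\<And>h w. w \<noteq> 0 \<Longrightarrow> mpoly_eval p (case_sum (($) h) (($) w)) \<noteq> 0 \<Longrightarrow> (h, line w) \<in> U"
proof -
  obtain S where S: "U = UNIV \<times> proj_space -
       {(g, L). \<forall>p\<in>S. \<forall>v\<in>L. mpoly_eval p (case_sum (($) g) (($) v)) = 0}"
    using U unfolding zariski_open_prod_def by blast
  obtain p u where p: "p \<in> S" "u \<in> line v" "mpoly_eval p (case_sum (($) g) (($) u)) \<noteq> 0"
    using gx S by blast
  then obtain k where k: "u = k *s v" by (auto simp: mem_line)
  have "\<exists>r. \<forall>t. mpoly_eval p (case_sum (($) g) (($) (t *s v))) = poly r t"
  proof -
    have "polyfun UNIV (mpoly_eval p)"
      by (rule polyfun_mpoly_eval) (auto intro: polyfun_intros)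
    then show ?thesis
    proof (rule polyfun_along_curve)
      fix i
      show "\<exists>r. \<forall>t. case_sum (($) g) (($) (t *s v)) i = poly r t"
        by (cases i) (auto intro: exI[of _ "[:_:]"] exI[of _ "[:0, _:]"])
    qed
  qed
  then obtain r where r: "\<And>t. mpoly_eval p (case_sum (($) g) (($) (t *s v))) = poly r t" by blast
  have "r \<noteq> 0" using p(3) k r[of k] by auto
  then obtain c where "c \<noteq> 0" "poly r c \<noteq> 0"
    using poly_eq_if_eq_nonzero[of r 0] by auto
  show ?thesis
  proof (rule that[of p])
    show "\<exists>c. c \<noteq> 0 \<and> mpoly_eval p (case_sum (($) g) (($) (c *s v))) \<noteq> 0"
      using \<open>c \<noteq> 0\<close> \<open>poly r c \<noteq> 0\<close> r by auto
    fix h w assume w: "w \<noteq> 0" "mpoly_eval p (case_sum (($) h) (($) w)) \<noteq> 0"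
    have "w \<in> line w" unfolding mem_line by (rule exI[of _ 1]) simp
    then show "(h, line w) \<in> U"
      using w p(1) unfolding S proj_space_def by auto
  qed
qed

section \<open>Lifting actions to matrices\<close>

text \<open>
  A parametrisation \<open>\<pi>\<close> of an affine cone in four-space. The coordinates \<open>0\<close> and \<open>1\<close> are reserved for
  the group; \<open>\<pi>\<close> uses the coordinates from \<open>2\<close> on. Each element \<open>(d, w)\<close> of \<open>scalings\<close> is a
  one-parameter group acting on the coordinates with weights \<open>w\<close>, under which \<open>\<pi>\<close> is homogeneous of
  degree \<open>d\<close>; together they are large enough to make homogeneous functions linear in \<open>\<pi>\<close>.
\<close>

locale param_cone =
  fixes \<pi> :: "(nat \<Rightarrow> 'a::{alg_closed_field, field_char_0}) \<Rightarrow> 'a ^ 4"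
    and scalings :: "(nat \<times> (nat \<Rightarrow> nat)) set"
  assumes param_poly: "polyfun {2..<6} (\<lambda>z. \<pi> z $ i)"
    and nonvanishing_const:
      "\<lbrakk>polyfun {..<6} h; \<And>z. \<pi> z \<noteq> 0 \<Longrightarrow> h z \<noteq> 0\<rbrakk> \<Longrightarrow> \<exists>k. \<forall>z. \<pi> z \<noteq> 0 \<longrightarrow> h z = k"
    and scaling: "(d, w) \<in> scalings \<Longrightarrow> w 0 = 0 \<and> w 1 = 0 \<and> (\<forall>t z. \<pi> (\<lambda>i. t ^ w i * z i) = t ^ d *s \<pi> z)"
    and linear_if_homogeneous:
      "\<lbrakk>polyfun {..<6} f; \<And>d w t z. (d, w) \<in> scalings \<Longrightarrow> t \<noteq> 0 \<Longrightarrow> f (\<lambda>i. t ^ w i * z i) = t ^ d * f z\<rbrakk>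
       \<Longrightarrow> \<exists>m. (\<forall>j. polyfun {0, 1} (m j)) \<and> (\<forall>z. f z = (\<Sum>j\<in>UNIV. m j z * \<pi> z $ j))"
    and spanning: "(\<And>z. (\<Sum>j\<in>UNIV. c j * \<pi> z $ j) = 0) \<Longrightarrow> c j = 0"
    and scale_closed: "\<exists>z'. \<pi> z' = k *s \<pi> z"
begin

lemma param_poly6: "polyfun {..<6} (\<lambda>z. \<pi> z $ i)"
  by (rule polyfun_mono[OF param_poly]) auto

lemma param_cong: "(\<And>i. 2 \<le> i \<Longrightarrow> i < 6 \<Longrightarrow> z i = z' i) \<Longrightarrow> \<pi> z = \<pi> z'"
  unfolding vec_eq_iff by (intro allI polyfun_cong_point[OF param_poly]) simp

lemma param_nonzero: "\<exists>i z. \<pi> z $ i \<noteq> 0"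
proof (rule ccontr)
  assume "\<not> ?thesis"
  then have "(1::'a) = 0"
    using spanning[of "\<lambda>_. 1" 1] by simp
  then show False by simp
qed

lemma param_dense:
  assumes f: "polyfun {..<6} f" and 0: "\<And>z. \<pi> z \<noteq> 0 \<Longrightarrow> f z = 0"
  shows "f z = 0"
proof -
  obtain i a where a: "\<pi> a $ i \<noteq> 0" using param_nonzero by blast
  have "\<pi> z $ i * f z = 0" for z
    using 0[of z] by (cases "\<pi> z = 0") auto
  then show ?thesis
    by (rule polyfun_domain[where a = a, OF param_poly6 f]) (rule a)
qed

text \<open>
  A tuple representing the identity is a constant multiple of \<open>\<pi>\<close>: both are multiples of the
  primitive part of \<open>\<pi>\<close>, by factors without zeros off \<open>{\<pi> = 0}\<close>.
\<close>

lemma parallel_to_param: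
  assumes F: "\<And>i. polyfun {..<6} (F i)"
    and par: "\<And>z i j. \<pi> z \<noteq> 0 \<Longrightarrow> F i z * \<pi> z $ j = F j z * \<pi> z $ i"
    and nz: "\<And>z. \<pi> z \<noteq> 0 \<Longrightarrow> \<exists>i. F i z \<noteq> 0"
  obtains c where "c \<noteq> 0" "\<And>i z. F i z = c * \<pi> z $ i"
proof -
  obtain i0 a where a: "\<pi> a $ i0 \<noteq> 0" using param_nonzero by blast
  obtain G h where h: "polyfun {..<6} h" and G: "\<And>i z. \<pi> z $ i = h z * G i z"
    and univ: "\<And>F'. (\<And>i. polyfun {..<6} (F' i)) \<Longrightarrow>
       (\<And>i j z. \<pi> z $ i * F' j z = \<pi> z $ j * F' i z) \<Longrightarrow>
       \<exists>h'. polyfun {..<6} h' \<and> (\<forall>i z. F' i z = h' z * G i z)"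
    by (rule polyfun_primitive_part[where F = "\<lambda>i z. \<pi> z $ i", OF param_poly6 a]) blast
  have "h z \<noteq> 0" if "\<pi> z \<noteq> 0" for z
    using that G[of z] by (auto simp: vec_eq_iff)
  then obtain k where k: "\<And>z. \<pi> z \<noteq> 0 \<Longrightarrow> h z = k"
    using nonvanishing_const[OF h] by blast
  have "\<pi> z $ i * F j z = \<pi> z $ j * F i z" for i j z
    using par[of z i j] by (cases "\<pi> z = 0") (auto simp: mult.commute)
  then obtain h' where h': "polyfun {..<6} h'" and F': "\<And>i z. F i z = h' z * G i z"
    using univ[of F] F by blast
  have "h' z \<noteq> 0" if "\<pi> z \<noteq> 0" for z
    using nz[OF that] F' by auto
  then obtain k' where k': "\<And>z. \<pi> z \<noteq> 0 \<Longrightarrow> h' z = k'" and h'0: "\<And>z. \<pi> z \<noteq> 0 \<Longrightarrow> h' z \<noteq> 0"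
    using nonvanishing_const[OF h'] by blast
  have "\<pi> a \<noteq> 0" using a by auto
  then have k0: "k \<noteq> 0" "k' \<noteq> 0" using k k' h'0 a G[of a i0] by auto
  have eq: "F i z - k' / k * \<pi> z $ i = 0" for i z
  proof (rule param_dense[of "\<lambda>z. F i z - k' / k * \<pi> z $ i"])
    show "polyfun {..<6} (\<lambda>z. F i z - k' / k * \<pi> z $ i)"
      by (intro polyfun_diff polyfun_intros F param_poly6)
    show "F i z - k' / k * \<pi> z $ i = 0" if "\<pi> z \<noteq> 0" for z
      using k0 by (simp add: F' G k[OF that] k'[OF that])
  qed
  show ?thesis
    by (rule that[of "k' / k"]) (use k0 eq in auto)
qed

text \<open>
  Here \<open>A z\<close> stands for the image of the point \<open>\<pi> z\<close> under the group element with coordinates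
  \<open>z 0\<close> and \<open>z 1\<close>. A family of self-maps of the cone that contains the identity is linear, because
  its degree is constant in the family.
\<close>

lemma linear_lift:
  fixes A :: "(nat \<Rightarrow> 'a) \<Rightarrow> ('a ^ 4) set"
  assumes local_rep: "\<And>z0. \<pi> z0 \<noteq> 0 \<Longrightarrow> \<exists>p F. polyfun {..<6} p \<and> (\<forall>i. polyfun {..<6} (F i)) \<and> p z0 \<noteq> 0 \<and>
      (\<forall>z. \<pi> z \<noteq> 0 \<longrightarrow> p z \<noteq> 0 \<longrightarrow> (\<chi> i. F i z) \<noteq> 0 \<and> A z = line (\<chi> i. F i z))"
    and at_zero: "\<And>z. \<pi> z \<noteq> 0 \<Longrightarrow> z 0 = 0 \<Longrightarrow> z 1 = 0 \<Longrightarrow> A z = line (\<pi> z)"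
    and invariant: "\<And>z z'. \<pi> z \<noteq> 0 \<Longrightarrow> z 0 = z' 0 \<Longrightarrow> z 1 = z' 1 \<Longrightarrow> line (\<pi> z) = line (\<pi> z') \<Longrightarrow> A z = A z'"
  obtains m where "\<And>i j. polyfun {0, 1} (m i j)"
    "\<And>i j z. z 0 = 0 \<Longrightarrow> z 1 = 0 \<Longrightarrow> m i j z = (if i = j then 1 else 0)"
    "\<And>z. \<pi> z \<noteq> 0 \<Longrightarrow> (\<chi> i. \<Sum>j\<in>UNIV. m i j z * \<pi> z $ j) \<noteq> 0 \<and> A z = line (\<chi> i. \<Sum>j\<in>UNIV. m i j z * \<pi> z $ j)"
proof -
  obtain i0 a where a: "\<pi> a $ i0 \<noteq> 0" using param_nonzero by blast
  then have a0: "\<pi> a \<noteq> 0" by auto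
  obtain p0 F0 where p0: "polyfun {..<6} p0" "p0 a \<noteq> 0" and F0: "\<And>i. polyfun {..<6} (F0 i)"
    and rep0: "\<And>z. \<pi> z \<noteq> 0 \<Longrightarrow> p0 z \<noteq> 0 \<Longrightarrow> (\<chi> i. F0 i z) \<noteq> 0 \<and> A z = line (\<chi> i. F0 i z)"
    using local_rep[OF a0] by blast
  obtain k0 where k0: "F0 k0 a \<noteq> 0"
    using rep0[OF a0 p0(2)] by (auto simp: vec_eq_iff)
  obtain G h where G: "\<And>i. polyfun {..<6} (G i)" and h: "polyfun {..<6} h"
    and FG: "\<And>i z. F0 i z = h z * G i z"
    and univ: "\<And>F'. (\<And>i. polyfun {..<6} (F' i)) \<Longrightarrow> (\<And>i j z. F0 i z * F' j z = F0 j z * F' i z) \<Longrightarrow>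
       \<exists>h'. polyfun {..<6} h' \<and> (\<forall>i z. F' i z = h' z * G i z)"
    by (rule polyfun_primitive_part[where F = F0, OF F0 k0]) blast
  have global: "(\<chi> i. G i z1) \<noteq> 0 \<and> A z1 = line (\<chi> i. G i z1)" if z1: "\<pi> z1 \<noteq> 0" for z1
  proof -
    obtain p F where p: "polyfun {..<6} p" "p z1 \<noteq> 0" and F: "\<And>i. polyfun {..<6} (F i)"
      and rep: "\<And>z. \<pi> z \<noteq> 0 \<Longrightarrow> p z \<noteq> 0 \<Longrightarrow> (\<chi> i. F i z) \<noteq> 0 \<and> A z = line (\<chi> i. F i z)"
      using local_rep[OF z1] by blast
    obtain b where b: "p0 b * p b \<noteq> 0"
      using polyfun_mult_nonzero[of "{..<6}" p0 p a z1] p0 p by blast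
    have pp: "polyfun {..<6} (\<lambda>z. p0 z * p z)" by (intro polyfun_intros p0 p)
    \<comment> \<open>Two local representatives are proportional on the intersection of their
      domains, hence everywhere.\<close>
    have "F0 i z * F j z - F0 j z * F i z = 0" for i j z
    proof (rule param_dense[of "\<lambda>z. F0 i z * F j z - F0 j z * F i z"])
      show P: "polyfun {..<6} (\<lambda>z. F0 i z * F j z - F0 j z * F i z)"
        by (intro polyfun_diff polyfun_intros F F0)
      have "\<pi> z $ l * (F0 i z * F j z - F0 j z * F i z) = 0" for z l
      proof -
        have "(p0 z * p z) * (\<pi> z $ l * (F0 i z * F j z - F0 j z * F i z)) = 0" for z
        proof (cases "\<pi> z \<noteq> 0 \<and> p0 z \<noteq> 0 \<and> p z \<noteq> 0")
          case True
          then have "line (\<chi> i. F0 i z) = line (\<chi> i. F i z)" "(\<chi> i. F i z) \<noteq> 0"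
            using rep0[of z] rep[of z] by auto
          from line_eq_imp_parallel[OF this, of i j] show ?thesis by simp
        qed auto
        then show ?thesis
          by (rule polyfun_domain[where a = b and f = "\<lambda>z. p0 z * p z",
                OF pp polyfun.mult[OF param_poly6 P]]) (rule b)
      qed
      then show "F0 i z * F j z - F0 j z * F i z = 0" if "\<pi> z \<noteq> 0" for z
        using that by (auto simp: vec_eq_iff)
    qed
    then obtain h' where h': "\<And>i z. F i z = h' z * G i z"
      using univ[of F] F by (metis eq_iff_diff_eq_0)
    have "(\<chi> i. F i z1) = h' z1 *s (\<chi> i. G i z1)"
      by (simp add: vec_eq_iff h')
    moreover have "(\<chi> i. F i z1) \<noteq> 0 \<and> A z1 = line (\<chi> i. F i z1)"
      using rep[OF z1 p(2)] .
    ultimately show ?thesis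
      by (cases "h' z1 = 0") (auto simp: line_scale)
  qed
  \<comment> \<open>At the neutral element the representative is a constant multiple of the
    parametrisation.\<close>
  have shift: "\<pi> (z(0 := 0, Suc 0 := 0)) = \<pi> z" for z
    by (rule param_cong) auto
  have G_shift: "polyfun {..<6} (\<lambda>z. G i (z(0 := 0, Suc 0 := 0)))" for i
    by (rule polyfun_subst[OF G]) (auto simp del: fun_upd_apply intro!: polyfun_upd intro: polyfun_intros)
  obtain c where c: "c \<noteq> 0" and Gc: "\<And>i z. G i (z(0 := 0, Suc 0 := 0)) = c * \<pi> z $ i"
  proof (rule parallel_to_param[of "\<lambda>i z. G i (z(0 := 0, Suc 0 := 0))"])
    fix z i j assume z: "\<pi> z \<noteq> 0"
    let ?z = "z(0 := 0, Suc 0 := 0)"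
    have 1: "(\<chi> i. G i ?z) \<noteq> 0" "A ?z = line (\<chi> i. G i ?z)" "A ?z = line (\<pi> z)"
      using global[of ?z] at_zero[of ?z] z by (simp_all add: shift)
    have "line (\<pi> z) = line (\<chi> i. G i ?z)" using 1 by simp
    from line_eq_imp_parallel[OF this 1(1), of j i]
    show "G i ?z * \<pi> z $ j = G j ?z * \<pi> z $ i"
      by (simp add: mult.commute)
    show "\<exists>i. G i ?z \<noteq> 0" using 1(1) by (auto simp: vec_eq_iff)
  qed (use G_shift in auto)
  \<comment> \<open>The rescaled tuple represents the same map, so it is a constant multiple of
    the original one. The constant is computed at the neutral element.\<close>
  have hom: "G i (\<lambda>l. t ^ w l * z l) = t ^ d * G i z" if dw: "(d, w) \<in> scalings" and t: "t \<noteq> 0" for d w t i z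
  proof -
    have w: "w 0 = 0" "w (Suc 0) = 0" and sc: "\<And>z. \<pi> (\<lambda>l. t ^ w l * z l) = t ^ d *s \<pi> z"
      using scaling[OF dw] by auto
    let ?s = "\<lambda>z l. t ^ w l * z l"
    have s_poly: "polyfun {..<6} (\<lambda>z. G i (?s z))" for i
      by (rule polyfun_subst[OF G]) (auto intro: polyfun_intros)
    have s_nz: "\<pi> (?s z) \<noteq> 0" if "\<pi> z \<noteq> 0" for z
      using that t by (simp add: sc)
    have A_s: "A z = A (?s z)" if "\<pi> z \<noteq> 0" for z
      by (rule invariant) (use that t in \<open>auto simp: w sc line_scale\<close>)
    have par: "G i z * G j (?s z) = G j z * G i (?s z)" if "\<pi> z \<noteq> 0" for i j z
    proof -
      have "line (\<chi> i. G i z) = line (\<chi> i. G i (?s z))" "(\<chi> i. G i (?s z)) \<noteq> 0"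
        using global[OF that] global[OF s_nz[OF that]] A_s[OF that] by auto
      from line_eq_imp_parallel[OF this, of i j] show ?thesis by simp
    qed
    have "G i z * G j (?s z) - G j z * G i (?s z) = 0" for i j z
      by (rule param_dense[of "\<lambda>z. G i z * G j (?s z) - G j z * G i (?s z)"])
        (auto intro!: polyfun_diff polyfun_intros G s_poly simp: par)
    then have "G i z * G j (?s z) = G j z * G i (?s z)" for i j z
      by simp
    then have "F0 i z * G j (?s z) = F0 j z * G i (?s z)" for i j z
      by (simp add: FG mult.assoc)
    then obtain h' where h'p: "polyfun {..<6} h'" and h': "\<And>i z. G i (?s z) = h' z * G i z"
      using univ[of "\<lambda>i z. G i (?s z)"] s_poly by blast
    have "h' z \<noteq> 0" if "\<pi> z \<noteq> 0" for z
      using global[OF s_nz[OF that]] h' by (auto simp: vec_eq_iff)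
    then obtain k where k: "\<And>z. \<pi> z \<noteq> 0 \<Longrightarrow> h' z = k"
      using nonvanishing_const[OF h'p] by blast
    have "k = t ^ d"
    proof -
      let ?a = "a(0 := 0, Suc 0 := 0)"
      have "?s ?a = (?s a)(0 := 0, Suc 0 := 0)" by (auto simp: w)
      then have "G i0 (?s ?a) = c * (t ^ d * \<pi> a $ i0)"
        by (simp add: Gc sc del: fun_upd_apply)
      moreover have "G i0 (?s ?a) = k * (c * \<pi> a $ i0)"
        using h'[of i0 ?a] k[of ?a] a0 by (simp add: Gc shift)
      ultimately show ?thesis using a c by simp
    qed
    have "G i (?s z) - t ^ d * G i z = 0"
    proof (rule param_dense[of "\<lambda>z. G i (?s z) - t ^ d * G i z"])
      show "polyfun {..<6} (\<lambda>z. G i (?s z) - t ^ d * G i z)"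
        by (intro polyfun_diff polyfun_intros G s_poly)
      show "G i (?s z) - t ^ d * G i z = 0" if "\<pi> z \<noteq> 0" for z
        using k[OF that] by (simp add: h' \<open>k = t ^ d\<close>)
    qed
    then show ?thesis by simp
  qed
  have "\<exists>m. (\<forall>j. polyfun {0, 1} (m j)) \<and> (\<forall>z. G i z = (\<Sum>j\<in>UNIV. m j z * \<pi> z $ j))" for i
    by (rule linear_if_homogeneous[OF G]) (rule hom)
  then obtain m where m: "\<And>i j. polyfun {0, 1} (m i j)" and Gm: "\<And>i z. G i z = (\<Sum>j\<in>UNIV. m i j z * \<pi> z $ j)"
    by metis
  show ?thesis
  proof (rule that[of "\<lambda>i j z. m i j z / c"])
    show "polyfun {0, 1} (\<lambda>z. m i j z / c)" for i j
      using polyfun.mult[OF m polyfun.const[of _ "1 / c"], of i j] by simp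
    show "m i j z / c = (if i = j then 1 else 0)" if z: "z 0 = 0" "z 1 = 0" for i j z
    proof -
      have "m i j z - (if i = j then c else 0) = 0"
      proof (rule spanning[of "\<lambda>j. m i j z - (if i = j then c else 0)"])
        fix u :: "nat \<Rightarrow> 'a"
        let ?u = "u(0 := 0, Suc 0 := 0)"
        have "m i j ?u = m i j z" for j
          by (rule polyfun_cong_point[OF m]) (use z in auto)
        then have "(\<Sum>j\<in>UNIV. m i j z * \<pi> u $ j) = c * \<pi> u $ i"
          using Gm[of i ?u] Gc[of i u] by (simp add: shift)
        moreover have "(\<Sum>j\<in>UNIV. (if i = j then c else 0) * \<pi> u $ j) = c * \<pi> u $ i"
          by (simp add: if_distrib[of "\<lambda>x. x * _"] cong: if_cong)
        ultimately show "(\<Sum>j\<in>UNIV. (m i j z - (if i = j then c else 0)) * \<pi> u $ j) = 0"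
          by (simp add: left_diff_distrib sum_subtractf)
      qed
      then show ?thesis using c by (auto split: if_splits)
    qed
    show "(\<chi> i. \<Sum>j\<in>UNIV. m i j z / c * \<pi> z $ j) \<noteq> 0 \<and> A z = line (\<chi> i. \<Sum>j\<in>UNIV. m i j z / c * \<pi> z $ j)"
      if z: "\<pi> z \<noteq> 0" for z
    proof -
      have "(\<chi> i. \<Sum>j\<in>UNIV. m i j z / c * \<pi> z $ j) = (1 / c) *s (\<chi> i. G i z)"
        by (simp add: vec_eq_iff Gm sum_distrib_left)
      then show ?thesis
        using global[OF z] c by (simp add: line_scale)
    qed
  qed
qed

end

text \<open>
  Coordinates \<open>0\<close> and \<open>1\<close> of a point stand for the two coordinates of the group, as in the
  parametrised cones.
\<close>

definition poly_matrix :: "('a::comm_ring_1 ^ 2 \<Rightarrow> 'a ^ 'n ^ 'm) \<Rightarrow> bool" where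
  "poly_matrix M \<longleftrightarrow> (\<forall>i j. polyfun {0, 1::nat} (\<lambda>z. M (vector [z 0, z 1]) $ i $ j))"

lemma vector_2_eta [simp]: "vector [g $ 1, g $ 2] = (g :: 'a::zero ^ 2)"
  by (simp add: vec_eq_iff forall_2)

lemma poly_matrix_subst:
  assumes "poly_matrix M" and "\<And>k. polyfun I (\<lambda>z. g z $ k)"
  shows "polyfun I (\<lambda>z. M (g z) $ i $ j)"
proof -
  define s where "s z l = (if l = (0::nat) then g z $ 1 else g z $ 2)" for z l
  have "polyfun I (\<lambda>z. s z l)" for l
    by (cases "l = 0") (simp_all add: s_def assms(2))
  then have "polyfun I (\<lambda>z. M (vector [s z 0, s z 1]) $ i $ j)"
    using assms(1) unfolding poly_matrix_def by (blast intro: polyfun_subst[of "{0, 1}" "\<lambda>z. M (vector [z 0, z 1]) $ i $ j" I s])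
  then show ?thesis by (simp add: s_def)
qed

context param_cone
begin

text \<open>
  A projective representation of the vector group is linear: the scalar by which
  \<open>M g ** M h ** M (- g - h)\<close> acts is a polynomial in \<open>g\<close> and \<open>h\<close> without zeros, hence constant.
  Using the inverse element in place of a quotient keeps this scalar polynomial.
\<close>

lemma projective_hom_imp_hom:
  fixes M :: "'a ^ 2 \<Rightarrow> 'a ^ 4 ^ 4"
  assumes M: "poly_matrix M" and M0: "M 0 = mat 1"
    and cone: "\<And>g z. \<pi> z \<noteq> 0 \<Longrightarrow> M g *v \<pi> z \<noteq> 0 \<and> (\<exists>z'. M g *v \<pi> z = \<pi> z')"
    and act: "\<And>g h z. \<pi> z \<noteq> 0 \<Longrightarrow> line (M (g + h) *v \<pi> z) = line (M g *v (M h *v \<pi> z))"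
  shows "M (g + h) = M g ** M h"
proof -
  define N where "N g h = M g ** (M h ** M (- (g + h)))" for g h
  have scalar: "\<exists>c. c \<noteq> 0 \<and> (\<forall>i j. N g h $ i $ j = (if i = j then c else 0))" for g h
  proof -
    have N: "line (\<pi> z) = line (N g h *v \<pi> z) \<and> N g h *v \<pi> z \<noteq> 0" if z: "\<pi> z \<noteq> 0" for z
    proof -
      obtain z' where z': "M (- (g + h)) *v \<pi> z = \<pi> z'" "\<pi> z' \<noteq> 0"
        using cone[OF z] by metis
      obtain z'' where z'': "M h *v \<pi> z' = \<pi> z''" "\<pi> z'' \<noteq> 0"
        using cone[OF z'(2)] by metis
      have Nz: "N g h *v \<pi> z = M g *v (M h *v \<pi> z')"
        unfolding N_def matrix_vector_mul_assoc[symmetric] z'(1) ..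
      then have "line (N g h *v \<pi> z) = line (M g *v (M h *v \<pi> z'))"
        by simp
      also have "\<dots> = line (M (g + h) *v (M (- (g + h)) *v \<pi> z))"
        using act[OF z'(2), of g h] unfolding z'(1) by simp
      also have "\<dots> = line (M (g + h + - (g + h)) *v \<pi> z)"
        using act[OF z, of "g + h" "- (g + h)"] by metis
      also have "\<dots> = line (\<pi> z)"
        by (simp add: M0)
      finally have "line (N g h *v \<pi> z) = line (\<pi> z)" .
      moreover have "N g h *v \<pi> z \<noteq> 0"
        using cone[OF z''(2)] by (simp add: Nz z'')
      ultimately show ?thesis by simp
    qed
    obtain c where c: "c \<noteq> 0" and eq: "\<And>i z. (N g h *v \<pi> z) $ i = c * \<pi> z $ i"
    proof (rule parallel_to_param[of "\<lambda>i z. (N g h *v \<pi> z) $ i"])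
      show "polyfun {..<6} (\<lambda>z. (N g h *v \<pi> z) $ i)" for i
        unfolding matrix_vector_mult_def by (simp, intro polyfun_sum polyfun_intros param_poly6)
      show "(N g h *v \<pi> z) $ i * \<pi> z $ j = (N g h *v \<pi> z) $ j * \<pi> z $ i" if "\<pi> z \<noteq> 0" for z i j
        using line_eq_imp_parallel[of "\<pi> z" "N g h *v \<pi> z" j i] N[OF that] by (simp add: mult.commute)
      show "\<exists>i. (N g h *v \<pi> z) $ i \<noteq> 0" if "\<pi> z \<noteq> 0" for z
        using N[OF that] by (auto simp: vec_eq_iff)
    qed auto
    have "N g h $ i $ j - (if i = j then c else 0) = 0" for i j
    proof (rule spanning[of "\<lambda>j. N g h $ i $ j - (if i = j then c else 0)"])
      fix z
      have "(\<Sum>j\<in>UNIV. N g h $ i $ j * \<pi> z $ j) = c * \<pi> z $ i"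
        using eq[of z i] by (simp add: matrix_vector_mult_def)
      moreover have "(\<Sum>j\<in>UNIV. (if i = j then c else 0) * \<pi> z $ j) = c * \<pi> z $ i"
        by (simp add: if_distrib[of "\<lambda>x. x * _"] cong: if_cong)
      ultimately show "(\<Sum>j\<in>UNIV. (N g h $ i $ j - (if i = j then c else 0)) * \<pi> z $ j) = 0"
        by (simp add: left_diff_distrib sum_subtractf)
    qed
    then show ?thesis using c by (intro exI[of _ c]) simp
  qed
  have N1: "N g h $ 1 $ 1 = 1" for g h
  proof -
    define f where "f z = N (vector [z 0, z 1]) (vector [z 2, z 3]) $ 1 $ 1" for z :: "nat \<Rightarrow> 'a"
    have "polyfun {..<4::nat} (\<lambda>z. (vector [z 0, z 1] :: 'a ^ 2) $ k)"
      "polyfun {..<4::nat} (\<lambda>z. (vector [z 2, z 3] :: 'a ^ 2) $ k)" for k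
      using exhaust_2[of k] by (auto intro!: polyfun.var)
    note v = this
    have v': "polyfun {..<4::nat} (\<lambda>z. (- (vector [z 0, z 1] + vector [z 2, z 3]) :: 'a ^ 2) $ k)" for k
      unfolding vector_uminus_component vector_add_component
      by (intro polyfun_uminus polyfun.add v)
    have "f = (\<lambda>z. \<Sum>k\<in>UNIV. M (vector [z 0, z 1]) $ 1 $ k *
      (\<Sum>l\<in>UNIV. M (vector [z 2, z 3]) $ k $ l * M (- (vector [z 0, z 1] + vector [z 2, z 3])) $ l $ 1))"
      unfolding f_def N_def matrix_matrix_mult_def by (simp only: vec_lambda_beta)
    then have "polyfun {..<4} f"
      using v v' by (auto intro!: polyfun_sum polyfun.mult poly_matrix_subst[OF M])
    moreover have "f z \<noteq> 0" for z
      using scalar unfolding f_def by (metis (full_types))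
    ultimately have "f (\<lambda>i. if i = 0 then g $ 1 else if i = 1 then g $ 2 else if i = 2 then h $ 1 else h $ 2)
       = f (\<lambda>_. 0)"
      by (rule polyfun_nonvanishing_everywhere_const)
    moreover have "vector [0, 0] = (0 :: 'a ^ 2)"
      by (simp add: vec_eq_iff forall_2)
    ultimately show ?thesis
      by (simp add: f_def N_def M0) (simp add: mat_def)
  qed
  have N_one: "N g h = mat 1" for g h
    using scalar[of g h] N1[of g h] by (auto simp: vec_eq_iff mat_def)
  have inv: "M g ** M (- g) = mat 1" for g
    using N_one[of g 0] by (simp add: N_def M0)
  have "M g ** M h = M g ** M h ** (M (- (g + h)) ** M (g + h))"
    using inv[of "- (g + h)"] unfolding minus_minus by (simp only: matrix_mul_rid)
  also have "\<dots> = N g h ** M (g + h)"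
    by (simp add: N_def matrix_mul_assoc)
  finally show ?thesis by (simp add: N_one)
qed

end

context param_cone
begin

text \<open>
  The columns of \<open>P\<close> are a basis in which the cone of \<open>Q\<close> is the image of \<open>\<pi>\<close>.
\<close>

lemma linear_action:
  fixes Q :: "('a ^ 4) set set" and P P' :: "'a ^ 4 ^ 4"
  assumes PP': "P ** P' = mat 1" and P'P: "P' ** P = mat 1"
    and Q: "Q = {line (P *v \<pi> z) | z. \<pi> z \<noteq> 0}"
    and \<alpha>: "additive_action Q (\<alpha> :: 'a ^ 2 \<Rightarrow> _)"
  obtains M where "poly_matrix M" "M 0 = mat 1" "\<And>g h. M (g + h) = M g ** M h"
    "\<And>g z. \<pi> z \<noteq> 0 \<Longrightarrow> M g *v \<pi> z \<noteq> 0 \<and> (\<exists>z'. M g *v \<pi> z = \<pi> z') \<and>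
       \<alpha> g (line (P *v \<pi> z)) = line (P *v (M g *v \<pi> z))"
proof -
  have P'Pv: "P' *v (P *v v) = v" and PP'v: "P *v (P' *v v) = v" for v
    by (simp_all add: matrix_vector_mul_assoc PP' P'P)
  note P0 = left_inverse_ker[OF P'P] and P'0 = left_inverse_ker[OF PP']
  have reg: "regular_map_prod Q Q \<alpha>" and \<alpha>0: "\<And>x. x \<in> Q \<Longrightarrow> \<alpha> 0 x = x"
    and \<alpha>add: "\<And>g h x. x \<in> Q \<Longrightarrow> \<alpha> (g + h) x = \<alpha> g (\<alpha> h x)"
    using \<alpha> by (auto simp: additive_action_def)
  have inQ: "line (P *v \<pi> z) \<in> Q" if "\<pi> z \<noteq> 0" for z
    using that Q by blast
  define gr where "gr z = (vector [z 0, z 1] :: 'a ^ 2)" for z :: "nat \<Rightarrow> 'a"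
  have gr_poly: "polyfun {..<6} (\<lambda>z. gr z $ k)" for k
  proof -
    have "k = 1 \<or> k = 2" by (rule exhaust_2)
    then show ?thesis
      by (elim disjE) (simp_all add: gr_def polyfun.var)
  qed
  define A where "A z = (*v) P' ` \<alpha> (gr z) (line (P *v \<pi> z))" for z
  have pv_poly: "polyfun {..<6} (\<lambda>z. (P *v \<pi> z) $ k)" for k
    by (rule polyfun_matrix_vector) (rule param_poly6)
  have ev_poly: "polyfun {..<6} (\<lambda>z. mpoly_eval p (case_sum (($) (gr z)) (($) (c *s (P *v \<pi> z)))))" for p c
  proof (rule polyfun_mpoly_eval)
    fix i :: "2 + 4"
    show "polyfun {..<6} (\<lambda>z. case_sum (($) (gr z)) (($) (c *s (P *v \<pi> z))) i)"
      by (cases i) (auto intro!: gr_poly polyfun_intros pv_poly)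
  qed
  obtain m where m: "\<And>i j. polyfun {0, 1} (m i j)"
    and m0: "\<And>i j z. z 0 = 0 \<Longrightarrow> z 1 = 0 \<Longrightarrow> m i j z = (if i = j then 1 else 0)"
    and mA: "\<And>z. \<pi> z \<noteq> 0 \<Longrightarrow> (\<chi> i. \<Sum>j\<in>UNIV. m i j z * \<pi> z $ j) \<noteq> 0 \<and>
       A z = line (\<chi> i. \<Sum>j\<in>UNIV. m i j z * \<pi> z $ j)"
  proof (rule linear_lift[of A])
    fix z0 assume z0: "\<pi> z0 \<noteq> 0"
    obtain U F d where U: "zariski_open_prod U" "(gr z0, line (P *v \<pi> z0)) \<in> U"
      and rep: "\<forall>g v. v \<noteq> 0 \<and> line v \<in> Q \<and> (g, line v) \<in> U \<longrightarrow>
         (let w = (\<chi> i. mpoly_eval (F i) (case_sum (($) g) (($) v))) in w \<noteq> 0 \<and> \<alpha> g (line v) = line w)"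
    proof -
      note bspec[OF spec[OF reg[unfolded regular_map_prod_def, THEN conjunct2], of "gr z0"] inQ[OF z0]]
      then show ?thesis
        by (elim exE conjE) (rule that, assumption+)
    qed
    obtain p c where c: "c \<noteq> 0" and p: "mpoly_eval p (case_sum (($) (gr z0)) (($) (c *s (P *v \<pi> z0)))) \<noteq> 0"
      and pU: "\<And>h w. w \<noteq> 0 \<Longrightarrow> mpoly_eval p (case_sum (($) h) (($) w)) \<noteq> 0 \<Longrightarrow> (h, line w) \<in> U"
      by (rule zariski_open_prod_basis[OF U]) blast
    define pz where "pz z = mpoly_eval p (case_sum (($) (gr z)) (($) (c *s (P *v \<pi> z))))" for z
    define Fz where "Fz z = (\<chi> i. mpoly_eval (F i) (case_sum (($) (gr z)) (($) (c *s (P *v \<pi> z)))))" for z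
    have "(\<chi> i. (P' *v Fz z) $ i) \<noteq> 0 \<and> A z = line (\<chi> i. (P' *v Fz z) $ i)" if z: "\<pi> z \<noteq> 0" "pz z \<noteq> 0" for z
    proof -
      have "c *s (P *v \<pi> z) \<noteq> 0" using c z P0 by simp
      moreover have l: "line (c *s (P *v \<pi> z)) = line (P *v \<pi> z)" using c by (rule line_scale)
      ultimately have "Fz z \<noteq> 0 \<and> \<alpha> (gr z) (line (P *v \<pi> z)) = line (Fz z)"
        using rep[rule_format, of "c *s (P *v \<pi> z)" "gr z"] pU[of "c *s (P *v \<pi> z)" "gr z"] inQ[OF z(1)] z(2)
        by (simp add: Let_def Fz_def pz_def)
      then show ?thesis by (simp add: A_def image_line P'0)
    qed
    moreover have "polyfun {..<6} pz" unfolding pz_def by (rule ev_poly)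
    moreover have "polyfun {..<6} (\<lambda>z. (P' *v Fz z) $ i)" for i
      by (rule polyfun_matrix_vector) (simp add: Fz_def ev_poly)
    moreover have "pz z0 \<noteq> 0" using p by (simp add: pz_def)
    ultimately show "\<exists>p F. polyfun {..<6} p \<and> (\<forall>i. polyfun {..<6} (F i)) \<and> p z0 \<noteq> 0 \<and>
      (\<forall>z. \<pi> z \<noteq> 0 \<longrightarrow> p z \<noteq> 0 \<longrightarrow> (\<chi> i. F i z) \<noteq> 0 \<and> A z = line (\<chi> i. F i z))"
      by (intro exI[of _ pz] exI[of _ "\<lambda>i z. (P' *v Fz z) $ i"]) blast
  next
    fix z assume z: "\<pi> z \<noteq> 0" "z 0 = 0" "z 1 = 0"
    then have "gr z = 0" by (simp add: gr_def vec_eq_iff forall_2)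
    then show "A z = line (\<pi> z)"
      using \<alpha>0[OF inQ[OF z(1)]] by (simp add: A_def image_line P'Pv)
  next
    fix z z' assume z: "\<pi> z \<noteq> 0" "z 0 = z' 0" "z 1 = z' 1" "line (\<pi> z) = line (\<pi> z')"
    then have "line (P *v \<pi> z) = line (P *v \<pi> z')"
      by (metis image_line)
    then show "A z = A z'" using z by (simp add: A_def gr_def)
  qed blast
  define M where "M g = (\<chi> i j. m i j (\<lambda>l. if l = 0 then g $ 1 else g $ 2))" for g :: "'a ^ 2"
  have Mm: "M (gr z) $ i $ j = m i j z" for z i j
    unfolding M_def by (simp, rule polyfun_cong_point[OF m]) (auto simp: gr_def)
  have M: "poly_matrix M"
    unfolding poly_matrix_def gr_def[symmetric] Mm using m by blast
  have M0: "M 0 = mat 1"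
    by (simp add: M_def m0 mat_def vec_eq_iff)
  have act1: "M g *v \<pi> z \<noteq> 0 \<and> \<alpha> g (line (P *v \<pi> z)) = line (P *v (M g *v \<pi> z))" if z: "\<pi> z \<noteq> 0" for g z
  proof -
    define z' where "z' = z(0 := g $ 1, Suc 0 := g $ 2)"
    have z': "\<pi> z' = \<pi> z" "gr z' = g"
      by (auto simp: z'_def gr_def intro!: param_cong)
    have "(\<chi> i. \<Sum>j\<in>UNIV. m i j z' * \<pi> z' $ j) = M g *v \<pi> z"
      by (simp add: Mm[of z', symmetric] z' matrix_vector_mult_def)
    then have "M g *v \<pi> z \<noteq> 0" and A: "A z' = line (M g *v \<pi> z)"
      using mA[of z'] z by (simp_all add: z')
    moreover have "(*v) P ` A z' = \<alpha> g (line (P *v \<pi> z))"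
      by (simp add: A_def z' image_image PP'v)
    ultimately show ?thesis by (simp add: A image_line)
  qed
  have act2: "\<exists>z'. M g *v \<pi> z = \<pi> z'" if z: "\<pi> z \<noteq> 0" for g z
  proof -
    have "\<alpha> g (line (P *v \<pi> z)) \<in> Q"
      using reg inQ[OF z] unfolding regular_map_prod_def by blast
    then obtain u where u: "\<pi> u \<noteq> 0" "line (P *v (M g *v \<pi> z)) = line (P *v \<pi> u)"
      unfolding Q using act1[OF z] by auto
    then have "(*v) P' ` line (P *v \<pi> u) = (*v) P' ` line (P *v (M g *v \<pi> z))" by simp
    then have "line (\<pi> u) = line (M g *v \<pi> z)" by (simp add: image_line P'Pv)
    then show ?thesis
      using act1[OF z] scale_closed by (metis line_eq_iff)
  qed
  have "M (g + h) = M g ** M h" for g h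
  proof (rule projective_hom_imp_hom[OF M M0])
    show "M g *v \<pi> z \<noteq> 0 \<and> (\<exists>z'. M g *v \<pi> z = \<pi> z')" if "\<pi> z \<noteq> 0" for g z
      using act1[OF that] act2[OF that] by blast
    fix g h z assume z: "\<pi> z \<noteq> 0"
    obtain z' where z': "M h *v \<pi> z = \<pi> z'" using act2[OF z] by blast
    then have z'0: "\<pi> z' \<noteq> 0" using act1[OF z, of h] by simp
    have "line (P *v (M (g + h) *v \<pi> z)) = \<alpha> (g + h) (line (P *v \<pi> z))"
      using act1[OF z] by simp
    also have "\<dots> = \<alpha> g (line (P *v \<pi> z'))"
      using \<alpha>add[OF inQ[OF z]] act1[OF z, of h] z' by simp
    also have "\<dots> = line (P *v (M g *v (M h *v \<pi> z)))"
      using act1[OF z'0] z' by simp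
    finally have "(*v) P' ` line (P *v (M (g + h) *v \<pi> z)) = (*v) P' ` line (P *v (M g *v (M h *v \<pi> z)))"
      by simp
    then show "line (M (g + h) *v \<pi> z) = line (M g *v (M h *v \<pi> z))"
      by (simp add: image_line P'Pv)
  qed
  then show ?thesis
    using that[OF M M0] act1 act2 by blast
qed

end

section \<open>Spanning sets, bilinear forms and nilpotent matrices\<close>

text \<open>
  Otherwise some linear form is one at a vector outside the span and vanishes on the span.
\<close>

lemma span_UNIV_if_no_annihilator:
  fixes S :: "('a::field ^ 'n) set"
  assumes "\<And>c :: 'a ^ 'n. (\<And>x. x \<in> S \<Longrightarrow> (\<Sum>i\<in>UNIV. c $ i * x $ i) = 0) \<Longrightarrow> c = 0"
  shows "vec.span S = UNIV"
proof (rule ccontr)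
  assume "vec.span S \<noteq> UNIV"
  then obtain v where v: "v \<notin> vec.span S" by blast
  obtain B where B: "B \<subseteq> S" "vec.independent B" "S \<subseteq> vec.span B"
    using vec.maximal_independent_subset by blast
  have vB: "v \<notin> vec.span B"
    using v vec.span_mono[OF B(1)] by blast
  then have "vec.independent (insert v B)"
    using B(2) by (simp add: vec.independent_insert)
  from vec.linear_independent_extend[OF this, of "\<lambda>x. if x = v then 1 else (0 :: 'a ^ 'n)"]
  obtain f :: "'a ^ 'n \<Rightarrow> 'a ^ 'n" where f: "Vector_Spaces.linear (*s) (*s) f" "f v = 1" "\<And>x. x \<in> B \<Longrightarrow> f x = 0"
    using vB vec.span_superset[of B] by (smt (verit) insert_iff subsetD)
  interpret f: Vector_Spaces.linear "(*s)" "(*s)" f by (rule f(1))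
  have fS: "f x = 0" if "x \<in> S" for x
  proof -
    have "x \<in> vec.span B" using that B by blast
    then show ?thesis
      by (rule vec.span_induct) (auto simp: vec.subspace_def f.add f.scale f(3))
  qed
  obtain i0 :: 'n where True by simp
  define c where "c = (\<chi> i. matrix f $ i0 $ i)"
  have fc: "f x $ i0 = (\<Sum>i\<in>UNIV. c $ i * x $ i)" for x
    using matrix_works[OF f(1), of x, symmetric] by (simp add: matrix_vector_mult_def c_def)
  have "c = 0"
    by (rule assms) (simp add: fS flip: fc)
  then have "f v $ i0 = 0" by (simp add: fc)
  then show False using f(2) by simp
qed

lemma matrix_eq_on_span:
  fixes A B :: "'a::field ^ 'n ^ 'm"
  assumes "vec.span S = UNIV" "\<And>x. x \<in> S \<Longrightarrow> A *v x = B *v x"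
  shows "A = B"
  unfolding matrix_eq
proof
  fix x
  have "x \<in> vec.span S" using assms(1) by simp
  then show "A *v x = B *v x"
    by (rule vec.span_induct) (auto simp: vec.subspace_def matrix_vector_right_distrib vector_scalar_commute assms(2))
qed

definition bil :: "'a::comm_ring_1 ^ 'n ^ 'n \<Rightarrow> 'a ^ 'n \<Rightarrow> 'a ^ 'n \<Rightarrow> 'a" where
  "bil A x y = (\<Sum>i\<in>UNIV. x $ i * (A *v y) $ i)"

lemma bil_add_left: "bil A (x + x') y = bil A x y + bil A x' y"
  and bil_add_right: "bil A x (y + y') = bil A x y + bil A x y'"
  and bil_scale_left: "bil A (k *s x) y = k * bil A x y"
  and bil_scale_right: "bil A x (k *s y) = k * bil A x (y :: 'a::field ^ 'n)"
  and bil_diff_left: "bil A (x - x') y = bil A x y - bil A x' y"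
  and bil_zero_left [simp]: "bil A 0 y = 0"
  and bil_zero_right [simp]: "bil A x 0 = 0"
  by (simp_all add: bil_def algebra_simps sum.distrib sum_distrib_left sum_subtractf vector_scalar_commute)

lemma bil_transpose:
  fixes N :: "'a::comm_ring_1 ^ 'n ^ 'n"
  shows "bil (transpose N) x y = bil N y x"
proof -
  have "bil (transpose N) x y = (\<Sum>i\<in>UNIV. \<Sum>j\<in>UNIV. x $ i * (N $ j $ i * y $ j))"
    unfolding bil_def matrix_vector_mult_def transpose_def by (simp add: sum_distrib_left)
  also have "\<dots> = (\<Sum>j\<in>UNIV. \<Sum>i\<in>UNIV. x $ i * (N $ j $ i * y $ j))"
    by (rule sum.swap)
  also have "\<dots> = bil N y x"
    unfolding bil_def matrix_vector_mult_def by (simp add: sum_distrib_left ac_simps)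
  finally show ?thesis .
qed

lemma bil_mult: "bil (A ** B) x y = bil A x (B *v y)"
  by (simp add: bil_def matrix_vector_mul_assoc)

text \<open>
  Changes of basis act on symmetric matrices by congruence.
\<close>

lemma bil_congruence:
  fixes N A :: "'a::comm_ring_1 ^ 'n ^ 'n"
  shows "bil (transpose N ** A ** N) x y = bil A (N *v x) (N *v y)"
proof -
  have "bil (transpose N ** A ** N) x y = bil (transpose N) x (A *v (N *v y))"
    by (simp only: bil_mult)
  also have "\<dots> = bil (mat 1) (A *v (N *v y)) (N *v x)"
    using bil_mult[of "mat 1" N] by (simp add: bil_transpose)
  also have "\<dots> = bil A (N *v x) (N *v y)"
    by (simp add: bil_def mult.commute)
  finally show ?thesis .
qed

lemma bil_sym: "transpose A = A \<Longrightarrow> bil A x y = bil A y x"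
  using bil_transpose[of A x y] by simp

lemma bil_axis: "bil A (axis i 1) (axis j 1) = (A $ i $ j :: 'a::field)"
  by (simp add: bil_def axis_def matrix_vector_mult_def if_distrib[of "\<lambda>x. x * _"] if_distrib[of "\<lambda>x. _ * x"] cong: if_cong)

lemma bil_sum_left:
  fixes A :: "'a::field ^ 'n ^ 'n"
  shows "bil A (\<Sum>i\<in>I. f i) y = (\<Sum>i\<in>I. bil A (f i) y)"
  by (induction I rule: infinite_finite_induct) (simp_all add: bil_add_left)

lemma bil_proportional_on_span:
  fixes A B :: "'a::field ^ 'n ^ 'n"
  assumes S: "vec.span S = UNIV" and eq: "\<And>x y. x \<in> S \<Longrightarrow> y \<in> S \<Longrightarrow> bil A x y = k * bil B x y"
  shows "bil A x y = k * bil B x y"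
proof -
  have 1: "bil A u y = k * bil B u y" if "u \<in> S" for u
  proof -
    have "y \<in> vec.span S" using S by simp
    then show ?thesis
      by (rule vec.span_induct)
        (auto simp: vec.subspace_def bil_add_right bil_scale_right eq[OF that] algebra_simps)
  qed
  have "x \<in> vec.span S" using S by simp
  then show ?thesis
    by (rule vec.span_induct)
      (auto simp: vec.subspace_def bil_add_left bil_scale_left 1 algebra_simps)
qed

lemma quadratic_form_bil: "quadratic_form A v = bil A v (v :: 'a::field ^ 'n)"
  unfolding quadratic_form_def bil_def matrix_vector_mult_def
  by (simp add: sum_distrib_left ac_simps)

lemma linear_relation_exists:
  fixes f :: "nat \<Rightarrow> 'a::field ^ 'n"
  assumes n: "n \<ge> CARD('n)"
  shows "\<exists>c. (\<exists>i\<le>n. c i \<noteq> 0) \<and> (\<Sum>i\<le>n. c i *s f i) = 0"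
proof (cases "inj_on f {..n}")
  case True
  have "\<not> vec.independent (f ` {..n})"
  proof
    assume "vec.independent (f ` {..n})"
    then have "card (f ` {..n}) \<le> vec.dim (UNIV :: ('a ^ 'n) set)"
      by (intro vec.independent_card_le_dim) auto
    then have "card (f ` {..n}) \<le> CARD('n)" unfolding vec_dim_card .
    then show False using n card_image[OF True] by simp
  qed
  then obtain u v where v: "v \<in> f ` {..n}" "u v \<noteq> 0" and s: "(\<Sum>v\<in>f ` {..n}. u v *s v) = 0"
    using vec.dependent_finite[of "f ` {..n}"] by auto
  have "(\<Sum>i\<le>n. u (f i) *s f i) = 0"
    using s by (simp add: sum.reindex[OF True])
  then show ?thesis using v by (intro exI[of _ "u \<circ> f"]) auto
next
  case False
  then obtain i j where ij: "i \<le> n" "j \<le> n" "i \<noteq> j" "f i = f j"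
    by (auto simp: inj_on_def)
  define c where "c = (\<lambda>k. if k = i then 1 else if k = j then - 1 else (0::'a))"
  have "(\<Sum>k\<le>n. c k *s f k) = (\<Sum>k\<in>{i, j}. c k *s f k)"
    by (rule sum.mono_neutral_right) (use ij in \<open>auto simp: c_def\<close>)
  also have "\<dots> = 0" using ij by (simp add: c_def)
  finally show ?thesis using ij by (intro exI[of _ c]) (auto simp: c_def)
qed

text \<open>
  If \<open>k\<close> is the first exponent with \<open>N\<^sup>k v = 0\<close>, then \<open>v, N v, \<dots>\<close> are linearly independent up to
  \<open>N\<^sup>k\<^sup>-\<^sup>1 v\<close>: apply to a relation with first nonzero coefficient \<open>c i\<close> the power that shifts its
  first term to \<open>N\<^sup>k\<^sup>-\<^sup>1 v\<close> and kills all the others.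
\<close>

lemma nilpotent_vector_bound:
  fixes N :: "'a::field ^ 'n ^ 'n"
  assumes "((*v) N ^^ K) v = 0"
  shows "((*v) N ^^ CARD('n)) v = 0"
proof (rule ccontr)
  let ?f = "\<lambda>i. ((*v) N ^^ i) v" and ?n = "CARD('n)"
  assume nz: "?f ?n \<noteq> 0"
  have lin: "((*v) N ^^ i) (\<Sum>j\<in>A. c j *s g j) = (\<Sum>j\<in>A. c j *s ((*v) N ^^ i) (g j))" for i c g and A :: "nat set"
  proof (induction i)
    case (Suc i)
    have "N *v (\<Sum>j\<in>A. h j) = (\<Sum>j\<in>A. N *v h j)" for h :: "nat \<Rightarrow> 'a ^ 'n"
      by (induction A rule: infinite_finite_induct) (auto simp: matrix_vector_right_distrib)
    then show ?case using Suc by (simp add: vector_scalar_commute)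
  qed simp
  have pow0: "((*v) N ^^ i) 0 = 0" for i
    by (induction i) auto
  have zero: "?f (K' + i) = 0" if "?f K' = 0" for K' i
  proof -
    show ?thesis using pow0 that funpow_add[of i K' "(*v) N"] by (simp add: add.commute)
  qed
  define k where "k = (LEAST k. ?f k = 0)"
  have fk: "?f k = 0" unfolding k_def by (rule LeastI[of _ K]) (rule assms)
  have below: "?f i \<noteq> 0" if "i < k" for i
    using that not_less_Least unfolding k_def by blast
  have kn: "?n < k"
  proof (rule ccontr)
    assume "\<not> ?n < k"
    then show False using zero[OF fk, of "?n - k"] nz by simp
  qed
  obtain c where c: "\<exists>i\<le>?n. c i \<noteq> 0" and rel: "(\<Sum>i\<le>?n. c i *s ?f i) = 0"
    using linear_relation_exists[of ?n ?f] by auto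
  define i where "i = (LEAST i. c i \<noteq> 0)"
  have ci: "c i \<noteq> 0" "i \<le> ?n" "\<And>j. j < i \<Longrightarrow> c j = 0"
  proof -
    obtain i' where i': "i' \<le> ?n" "c i' \<noteq> 0" using c by blast
    show "c i \<noteq> 0" unfolding i_def by (rule LeastI[of _ i']) (rule i')
    show "i \<le> ?n" using Least_le[of "\<lambda>i. c i \<noteq> 0" i'] i' unfolding i_def by simp
    show "c j = 0" if "j < i" for j using that not_less_Least unfolding i_def by blast
  qed
  have "0 = ((*v) N ^^ (k - 1 - i)) (\<Sum>j\<le>?n. c j *s ?f j)"
    unfolding rel by (rule pow0[symmetric])
  also have "\<dots> = (\<Sum>j\<le>?n. c j *s ?f (k - 1 - i + j))"
    unfolding lin by (simp add: funpow_add)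
  also have "\<dots> = (\<Sum>j\<in>{i}. c j *s ?f (k - 1 - i + j))"
  proof (rule sum.mono_neutral_right)
    show "\<forall>j\<in>{..?n} - {i}. c j *s ?f (k - 1 - i + j) = 0"
    proof
      fix j assume j: "j \<in> {..?n} - {i}"
      show "c j *s ?f (k - 1 - i + j) = 0"
      proof (cases "j < i")
        case False
        then have "k - 1 - i + j = k + (j - i - 1)" using j ci(2) kn by simp
        then show ?thesis using zero[OF fk] by simp
      qed (simp add: ci(3))
    qed
  qed (use ci in auto)
  also have "\<dots> = c i *s ?f (k - 1)" using ci(2) kn by simp
  finally show False using ci(1) below[of "k - 1"] kn by auto
qed

lemma poly_eqI_UNIV: "(\<And>t. poly p t = poly q t) \<Longrightarrow> p = (q :: 'a::field_char_0 poly)"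
  by (simp add: poly_eq_poly_eq_iff[symmetric] fun_eq_iff)

lemma pderiv_sum: "pderiv (\<Sum>x\<in>A. f x) = (\<Sum>x\<in>A. pderiv (f x))"
  by (induction A rule: infinite_finite_induct) (simp_all add: pderiv_add)

lemma higher_pderiv_eq_0_if: "degree p < k \<Longrightarrow> (pderiv ^^ k) p = (0 :: 'a::field_char_0 poly)"
proof (induction k arbitrary: p)
  case (Suc k)
  show ?case
  proof (cases "degree p = 0")
    case True
    then have "pderiv p = 0" by (simp add: pderiv_eq_0_iff)
    moreover have "(pderiv ^^ k) 0 = (0 :: 'a poly)" by (induction k) auto
    ultimately show ?thesis by (simp add: funpow_Suc_right del: funpow.simps)
  next
    case False
    then have "degree (pderiv p) < k" using Suc.prems by (simp add: degree_pderiv)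
    then show ?thesis using Suc.IH by (simp add: funpow_Suc_right del: funpow.simps)
  qed
qed simp

lemma degree_less_if_higher_pderiv_eq_0:
  "(pderiv ^^ k) p = 0 \<Longrightarrow> p = 0 \<or> degree p < k" for p :: "'a::field_char_0 poly"
proof (induction k arbitrary: p)
  case (Suc k)
  then have "(pderiv ^^ k) (pderiv p) = 0" by (simp add: funpow_Suc_right del: funpow.simps)
  from Suc.IH[OF this] show ?case by (auto simp: degree_pderiv pderiv_eq_0_iff)
qed simp

text \<open>
  The curve \<open>y t = M (t *s g) *v v\<close> satisfies \<open>y' = N y\<close>, where \<open>N\<close> is the derivative of \<open>M (t *s g)\<close>
  at \<open>t = 0\<close>. As \<open>y\<close> is polynomial, high powers of \<open>N\<close> kill it, and then already the power given
  by the dimension does.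
\<close>

lemma one_parameter_orbit_degree:
  fixes M :: "'a::field_char_0 ^ 2 \<Rightarrow> 'a ^ 'n ^ 'n"
  assumes M: "poly_matrix M" and M0: "M 0 = mat 1" and hom: "\<And>g h. M (g + h) = M g ** M h"
  obtains y where "\<And>i. degree (y i) < CARD('n)" "\<And>t i. (M (t *s g) *v v) $ i = poly (y i) t"
proof -
  have "\<exists>p. \<forall>t. M (t *s g) $ i $ j = poly p t" for i j
  proof -
    have "polyfun {0::nat} (\<lambda>z. M (z 0 *s g) $ i $ j)"
      by (rule poly_matrix_subst[OF M]) (auto intro: polyfun_intros)
    then have "\<exists>p. \<forall>t. M ((\<lambda>_. t) (0::nat) *s g) $ i $ j = poly p t"
      by (rule polyfun_along_curve) (auto intro: exI[of _ "[:0, 1:]"])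
    then show ?thesis by simp
  qed
  then obtain m where m: "\<And>i j t. M (t *s g) $ i $ j = poly (m i j) t" by metis
  define y where "y i = (\<Sum>j\<in>UNIV. smult (v $ j) (m i j))" for i
  have y: "(M (t *s g) *v v) $ i = poly (y i) t" for t i
    by (simp add: y_def matrix_vector_mult_def poly_sum m mult.commute)
  define N where "N = (\<chi> i j. poly (pderiv (m i j)) 0)"
  \<comment> \<open>The homomorphism property along the curve, as an identity of polynomials in
    the second parameter; its derivative at zero is the differential equation.\<close>
  have shift: "pcompose (y i) [:t, 1:] = (\<Sum>j\<in>UNIV. smult (poly (y j) t) (m i j))" for i t
  proof (rule poly_eqI_UNIV)
    fix s
    have "poly (pcompose (y i) [:t, 1:]) s = (M (s *s g + t *s g) *v v) $ i"
      by (simp add: poly_pcompose y[symmetric] add.commute vec.scale_left_distrib)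
    also have "\<dots> = (M (s *s g) *v (M (t *s g) *v v)) $ i"
      by (simp add: hom matrix_vector_mul_assoc)
    also have "\<dots> = poly (\<Sum>j\<in>UNIV. smult (poly (y j) t) (m i j)) s"
      by (simp add: matrix_vector_mult_def[of "M (s *s g)"] y m poly_sum mult.commute)
    finally show "poly (pcompose (y i) [:t, 1:]) s = poly (\<Sum>j\<in>UNIV. smult (poly (y j) t) (m i j)) s" .
  qed
  have dy: "pderiv (y i) = (\<Sum>j\<in>UNIV. smult (N $ i $ j) (y j))" for i
  proof (rule poly_eqI_UNIV)
    fix t
    have "poly (pderiv (y i)) t = poly (pderiv (pcompose (y i) [:t, 1:])) 0"
      by (simp add: pderiv_pcompose poly_pcompose pderiv_pCons)
    also have "\<dots> = poly (\<Sum>j\<in>UNIV. smult (N $ i $ j) (y j)) t"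
      unfolding shift by (simp add: pderiv_sum pderiv_smult poly_sum N_def mult.commute)
    finally show "poly (pderiv (y i)) t = poly (\<Sum>j\<in>UNIV. smult (N $ i $ j) (y j)) t" .
  qed
  define Y where "Y t = (\<chi> i. poly (y i) t)" for t
  have pow: "(((*v) N ^^ k) (Y t)) $ i = poly ((pderiv ^^ k) (y i)) t" for k i t
  proof (induction k arbitrary: i)
    case (Suc k)
    have "(pderiv ^^ k) (\<Sum>j\<in>A. smult (a j) (q j)) = (\<Sum>j\<in>A. smult (a j) ((pderiv ^^ k) (q j)))"
      for a :: "'n \<Rightarrow> 'a" and q and A
      by (induction k) (simp_all add: pderiv_sum pderiv_smult)
    then have "(pderiv ^^ Suc k) (y i) = (\<Sum>j\<in>UNIV. smult (N $ i $ j) ((pderiv ^^ k) (y j)))"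
      by (simp add: funpow_Suc_right dy del: funpow.simps)
    then show ?case
      by (simp add: matrix_vector_mult_def[of N "((*v) N ^^ k) (Y t)"] Suc poly_sum)
  qed (simp add: Y_def)
  define K where "K = Suc (Max (range (\<lambda>i. degree (y i))))"
  have "degree (y i) < K" for i
    unfolding K_def by (simp add: less_Suc_eq_le)
  then have "((*v) N ^^ K) (Y t) = 0" for t
    by (simp add: vec_eq_iff pow higher_pderiv_eq_0_if)
  then have "((*v) N ^^ CARD('n)) (Y t) = 0" for t
    by (rule nilpotent_vector_bound)
  then have "(pderiv ^^ CARD('n)) (y i) = 0" for i
    by (intro poly_eqI_UNIV) (simp flip: pow)
  then have "degree (y i) < CARD('n)" for i
    using degree_less_if_higher_pderiv_eq_0[of "CARD('n)" "y i"] by auto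
  then show ?thesis using that y by blast
qed

section \<open>Matrix actions on quadrics\<close>

text \<open>
  A parametrised cone that is the zero set of the quadratic form of the symmetric matrix \<open>A\<close>, where
  \<open>A\<close> is determined by the cone up to a factor. The normalised entry of \<open>A\<close> serves to express this
  factor as a polynomial.
\<close>

locale param_quadric = param_cone \<pi> scalings
  for \<pi> :: "(nat \<Rightarrow> 'a::{alg_closed_field, field_char_0}) \<Rightarrow> 'a ^ 4" and scalings +
  fixes A :: "'a ^ 4 ^ 4"
  assumes sym: "transpose A = A"
    and isotropic_iff: "bil A x x = 0 \<longleftrightarrow> (\<exists>z. x = \<pi> z)"
    and form_unique: "\<lbrakk>transpose C = C; \<And>z. bil C (\<pi> z) (\<pi> z) = 0\<rbrakk> \<Longrightarrow> \<exists>k. \<forall>x y. bil C x y = k * bil A x y"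
    and entry_1: "\<exists>i j. A $ i $ j = 1"
begin

lemma isotropic_param [simp]: "bil A (\<pi> z) (\<pi> z) = 0"
  unfolding isotropic_iff by (rule exI[of _ z]) (rule refl)

lemma isotropicE:
  assumes "bil A x x = 0"
  obtains z where "x = \<pi> z"
  using assms unfolding isotropic_iff by (elim exE)

text \<open>
  Each \<open>M g\<close> preserves the cone and so multiplies the form by a factor \<open>k g\<close>. This factor is a
  polynomial in \<open>g\<close> without zeros, as \<open>k g * k (- g) = 1\<close>.
\<close>

lemma isometry:
  assumes M: "poly_matrix M" and M0: "M 0 = mat 1" and hom: "\<And>g h. M (g + h) = M g ** M h"
    and cone: "\<And>g z. \<pi> z \<noteq> 0 \<Longrightarrow> \<exists>z'. M g *v \<pi> z = \<pi> z'"
  shows "bil A (M g *v x) (M g *v y) = bil A x y"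
proof -
  have "\<exists>k. \<forall>x y. bil (transpose (M g) ** A ** M g) x y = k * bil A x y" for g
  proof (rule form_unique)
    show "transpose (transpose (M g) ** A ** M g) = transpose (M g) ** A ** M g"
      by (simp add: matrix_transpose_mul sym matrix_mul_assoc)
    fix z
    show "bil (transpose (M g) ** A ** M g) (\<pi> z) (\<pi> z) = 0"
      using cone[of z g] by (cases "\<pi> z = 0") (auto simp: bil_congruence)
  qed
  then obtain k where k: "\<And>g x y. bil A (M g *v x) (M g *v y) = k g * bil A x y"
    unfolding bil_congruence by metis
  obtain i j where ij: "A $ i $ j = 1" using entry_1 by blast
  let ?x = "axis i (1::'a) :: 'a ^ 4" and ?y = "axis j (1::'a) :: 'a ^ 4"
  have ke: "k g = bil A (M g *v ?x) (M g *v ?y)" for g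
    using k[of g ?x ?y] by (simp add: bil_axis ij)
  have k_add: "k (g + h) = k g * k h" for g h
    unfolding ke[of "g + h"] hom by (simp add: k bil_axis ij flip: matrix_vector_mul_assoc)
  have k0: "k 0 = 1" by (simp add: ke M0 bil_axis ij)
  define f where "f z = k (vector [z 0, z 1])" for z :: "nat \<Rightarrow> 'a"
  have col: "polyfun {0, 1::nat} (\<lambda>z. (M (vector [z 0, z 1]) *v u) $ l)" for u l
    unfolding matrix_vector_mult_def vec_lambda_beta
    by (intro polyfun_sum polyfun_intros M[unfolded poly_matrix_def, rule_format])
  have "polyfun {0, 1} f"
    unfolding f_def ke bil_def
    by (intro polyfun_sum polyfun.mult polyfun_matrix_vector col)
  moreover have "f z \<noteq> 0" for z
    using k_add[of "vector [z 0, z 1]" "- vector [z 0, z 1]"] k0 by (auto simp: f_def)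
  ultimately have "f (\<lambda>l. if l = 0 then g $ 1 else g $ 2) = f (\<lambda>_. 0)"
    by (rule polyfun_nonvanishing_everywhere_const)
  moreover have "vector [0, 0] = (0 :: 'a ^ 2)"
    by (simp add: vec_eq_iff forall_2)
  ultimately have "k g = 1" by (simp add: f_def k0)
  then show ?thesis by (simp add: k)
qed

text \<open>
  What is used of an additive action later on. Openness of the orbit enters twice: the orbit spans
  the whole space, and it meets every affine line through \<open>x\<^sub>0\<close> that lies in the cone and avoids the
  origin a second time.
\<close>

lemma action_data:
  fixes Q :: "('a ^ 4) set set" and P P' :: "'a ^ 4 ^ 4"
  assumes PP': "P ** P' = mat 1" and P'P: "P' ** P = mat 1"
    and Q: "Q = {line (P *v x) | x. x \<noteq> 0 \<and> bil A x x = 0}"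
    and \<alpha>: "additive_action Q (\<alpha> :: 'a ^ 2 \<Rightarrow> _)"
  obtains M x\<^sub>0 where "poly_matrix M" "M 0 = mat 1" "\<And>g h. M (g + h) = M g ** M h"
    "\<And>g x y. bil A (M g *v x) (M g *v y) = bil A x y"
    "\<And>g x. bil A x x = 0 \<Longrightarrow> x \<noteq> 0 \<Longrightarrow> \<alpha> g (line (P *v x)) = line (P *v (M g *v x))"
    "bil A x\<^sub>0 x\<^sub>0 = 0" "vec.span (range (\<lambda>g. M g *v x\<^sub>0)) = UNIV"
    "\<forall>w. (\<forall>c. x\<^sub>0 + c *s w \<noteq> 0 \<and> bil A (x\<^sub>0 + c *s w) (x\<^sub>0 + c *s w) = 0) \<longrightarrow>
       (\<exists>c g k. c \<noteq> 0 \<and> k \<noteq> 0 \<and> M g *v x\<^sub>0 = k *s (x\<^sub>0 + c *s w))"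
proof -
  have Q': "Q = {line (P *v \<pi> z) | z. \<pi> z \<noteq> 0}"
    unfolding Q isotropic_iff by auto
  obtain M where M: "poly_matrix M" "M 0 = mat 1" "\<And>g h. M (g + h) = M g ** M h"
    and act: "\<And>g z. \<pi> z \<noteq> 0 \<Longrightarrow> M g *v \<pi> z \<noteq> 0 \<and> (\<exists>z'. M g *v \<pi> z = \<pi> z') \<and>
       \<alpha> g (line (P *v \<pi> z)) = line (P *v (M g *v \<pi> z))"
    using linear_action[OF PP' P'P Q' \<alpha>] by blast
  have act': "\<alpha> g (line (P *v x)) = line (P *v (M g *v x))" if x: "bil A x x = 0" "x \<noteq> 0" for g x
  proof -
    obtain z where "x = \<pi> z" using x(1) by (rule isotropicE)
    then show ?thesis using act[of z g] x by (simp only: simp_thms)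
  qed
  have iso: "bil A (M g *v x) (M g *v y) = bil A x y" for g x y
  proof (rule isometry[OF M])
    show "\<exists>z'. M g *v \<pi> z = \<pi> z'" if "\<pi> z \<noteq> 0" for g z
      by (rule conjunct1[OF conjunct2[OF act[OF that]]])
  qed
  have P'Pv: "P' *v (P *v v) = v" and PP'v: "P *v (P' *v v) = v" for v
    by (simp_all add: matrix_vector_mul_assoc PP' P'P)
  have P0: "P *v v \<noteq> 0" if "v \<noteq> 0" for v
    using that left_inverse_ker[OF P'P] by simp
  obtain x U where x: "x \<in> Q" and U: "zariski_open U" and orbit: "range (\<lambda>g. \<alpha> g x) = Q \<inter> U"
    using \<alpha>[unfolded additive_action_def, THEN conjunct2, THEN conjunct2, THEN conjunct2] by (elim bexE exE conjE)
  obtain w0 where w0: "w0 \<noteq> 0" "bil A w0 w0 = 0" "x = line (P *v w0)"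
    using x unfolding Q by blast
  have "\<alpha> 0 x = x"
    using \<alpha>[unfolded additive_action_def, THEN conjunct2, THEN conjunct1] x by (rule bspec)
  moreover have "\<alpha> 0 x \<in> Q \<inter> U" unfolding orbit[symmetric] by (rule rangeI)
  ultimately have "x \<in> U" by simp
  then have lU: "line (P *v w0) \<in> U" using w0 by simp
  obtain p c where c: "c \<noteq> 0" "mpoly_eval p (($) (c *s (P *v w0))) \<noteq> 0"
    and pU: "\<And>w. w \<noteq> 0 \<Longrightarrow> mpoly_eval p (($) w) \<noteq> 0 \<Longrightarrow> line w \<in> U"
    by (rule zariski_open_basis[OF U lU]) (rule that)
  define \<phi> where "\<phi> w = mpoly_eval p (($) (c *s (P *v w)))" for w
  have \<phi>_poly: "polyfun I (\<lambda>z. \<phi> (s z))" if "\<And>j. polyfun (I :: nat set) (\<lambda>z. s z $ j)" for I s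
    unfolding \<phi>_def
    by (rule polyfun_mpoly_eval) (simp, intro polyfun_intros polyfun_matrix_vector that)
  have dense: "\<exists>g k. k \<noteq> 0 \<and> M g *v w0 = k *s w" if w: "w \<noteq> 0" "bil A w w = 0" "\<phi> w \<noteq> 0" for w
  proof -
    have "line (c *s (P *v w)) \<in> U"
      using pU[of "c *s (P *v w)"] w c P0 by (simp add: \<phi>_def)
    then have "line (P *v w) \<in> Q \<inter> U"
      using c w by (auto simp: line_scale Q)
    then have "line (P *v w) \<in> range (\<lambda>g. \<alpha> g x)" unfolding orbit .
    then obtain g where "line (P *v w) = \<alpha> g x" by (rule imageE)
    then have "(*v) P' ` line (P *v w) = (*v) P' ` line (P *v (M g *v w0))"
      using w0 act' by simp
    then have eq: "line w = line (M g *v w0)"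
      by (simp add: image_line P'Pv)
    obtain z0 where "w0 = \<pi> z0" using w0(2) by (rule isotropicE)
    then have "M g *v w0 \<noteq> 0" using act[of z0 g] w0(1) by (simp only: simp_thms)
    then have "\<exists>k. k \<noteq> 0 \<and> M g *v w0 = k *s w" using eq line_eq_iff[of "M g *v w0" w] by simp
    then show ?thesis by (rule exI)
  qed
  obtain z0 where z0: "w0 = \<pi> z0" using w0(2) by (rule isotropicE)
  \<comment> \<open>A linear form that vanishes on the orbit vanishes on an open part of the
    cone, and hence on the cone, as products of nonzero polynomials in the parameters are
    nonzero.\<close>
  have span: "vec.span (range (\<lambda>g. M g *v w0)) = UNIV"
  proof (rule span_UNIV_if_no_annihilator)
    fix d :: "'a ^ 4"
    assume d: "\<And>x. x \<in> range (\<lambda>g. M g *v w0) \<Longrightarrow> (\<Sum>i\<in>UNIV. d $ i * x $ i) = 0"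
    have "(\<Sum>i\<in>UNIV. d $ i * \<pi> z $ i) = 0" for z
    proof (rule polyfun_domain[where f = "\<lambda>z. \<phi> (\<pi> z)" and g = "\<lambda>z. \<Sum>i\<in>UNIV. d $ i * \<pi> z $ i" and a = z0])
      show "polyfun {..<6} (\<lambda>z. \<phi> (\<pi> z))" by (rule \<phi>_poly) (rule param_poly6)
      show "polyfun {..<6} (\<lambda>z. \<Sum>i\<in>UNIV. d $ i * \<pi> z $ i)"
        by (intro polyfun_sum polyfun_intros param_poly6)
      show "\<phi> (\<pi> z0) \<noteq> 0" using c z0 by (simp add: \<phi>_def)
      show "\<phi> (\<pi> z) * (\<Sum>i\<in>UNIV. d $ i * \<pi> z $ i) = 0" for z
      proof (cases "\<pi> z \<noteq> 0 \<and> \<phi> (\<pi> z) \<noteq> 0")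
        case True
        then obtain g k where "k \<noteq> 0" and gk: "M g *v w0 = k *s \<pi> z"
          using dense[of "\<pi> z"] isotropic_param by blast
        have "(\<Sum>i\<in>UNIV. d $ i * (M g *v w0) $ i) = 0" by (rule d) (rule rangeI)
        then have "k * (\<Sum>i\<in>UNIV. d $ i * \<pi> z $ i) = 0"
          unfolding gk by (simp add: sum_distrib_left algebra_simps)
        then show ?thesis using \<open>k \<noteq> 0\<close> by simp
      qed auto
    qed
    then have "d $ j = 0" for j
      using spanning[of "\<lambda>j. d $ j"] by blast
    then show "d = 0" by (simp add: vec_eq_iff)
  qed
  have open_direction: "\<exists>d g k. d \<noteq> 0 \<and> k \<noteq> 0 \<and> M g *v w0 = k *s (w0 + d *s w)"
    if w: "\<forall>d. w0 + d *s w \<noteq> 0 \<and> bil A (w0 + d *s w) (w0 + d *s w) = 0" for w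
  proof -
    have p: "polyfun {0::nat} (\<lambda>z. \<phi> (w0 + z 0 *s w))"
      by (rule \<phi>_poly, unfold vector_add_component vector_smult_component)
        (intro polyfun_intros, simp)
    have "polyfun {0::nat} (\<lambda>z. z 0 :: 'a)" by (rule polyfun.var) simp
    from polyfun_mult_nonzero[OF this p, of "\<lambda>_. 1" "\<lambda>_. 0"]
    have "\<exists>z :: nat \<Rightarrow> 'a. z 0 * \<phi> (w0 + z 0 *s w) \<noteq> 0"
      using c by (simp add: \<phi>_def)
    then obtain d where "d \<noteq> 0" "\<phi> (w0 + d *s w) \<noteq> 0" by auto
    moreover obtain g k where "k \<noteq> 0" "M g *v w0 = k *s (w0 + d *s w)"
      using dense[of "w0 + d *s w"] w calculation by auto
    ultimately show ?thesis by (intro exI[of _ d] exI[of _ g] exI[of _ k]) simp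
  qed
  show ?thesis
    by (rule that[OF M iso act' w0(2) span]) (use open_direction in blast)+
qed

end

section \<open>The quadratic form of an orbit\<close>

text \<open>
  By invariance the pairing of two points of the orbit is a function \<open>f\<close> of their difference in the
  group. On each line through the origin \<open>f\<close> is a polynomial of degree at most three, even and zero
  at the origin, and hence homogeneous of degree two.
\<close>

lemma orbit_form:
  fixes M :: "'a::field_char_0 ^ 2 \<Rightarrow> 'a ^ 4 ^ 4"
  assumes M: "poly_matrix M" and M0: "M 0 = mat 1" and hom: "\<And>g h. M (g + h) = M g ** M h"
    and sym: "transpose A = A" and iso: "\<And>g x y. bil A (M g *v x) (M g *v y) = bil A x y"
    and x\<^sub>0: "bil A x\<^sub>0 x\<^sub>0 = 0"
  obtains p q r where "\<And>g h. bil A (M g *v x\<^sub>0) (M h *v x\<^sub>0) =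
    p * (g $ 1 - h $ 1)\<^sup>2 + q * (g $ 1 - h $ 1) * (g $ 2 - h $ 2) + r * (g $ 2 - h $ 2)\<^sup>2"
proof -
  define f where "f g = bil A (M g *v x\<^sub>0) x\<^sub>0" for g
  have fdiff: "bil A (M g *v x\<^sub>0) (M h *v x\<^sub>0) = f (g - h)" for g h
  proof -
    have "M g *v x\<^sub>0 = M h *v (M (g - h) *v x\<^sub>0)"
      using hom[of h "g - h"] by (simp add: matrix_vector_mul_assoc)
    then show ?thesis by (simp add: iso f_def)
  qed
  have even: "f (- g) = f g" for g
    using fdiff[of 0 g] fdiff[of g 0] by (simp add: M0 bil_sym[OF sym])
  have hom2: "f (t *s g) = t\<^sup>2 * f g" for t g
  proof -
    obtain y where deg: "\<And>i. degree (y i) < CARD(4)" and y: "\<And>t i. (M (t *s g) *v x\<^sub>0) $ i = poly (y i) t"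
      using one_parameter_orbit_degree[OF M M0 hom] by blast
    define R where "R = (\<Sum>i\<in>UNIV. smult ((A *v x\<^sub>0) $ i) (y i))"
    have R: "f (t *s g) = poly R t" for t
      by (simp add: R_def f_def bil_def poly_sum y mult.commute)
    have "degree R \<le> 3"
      unfolding R_def
    proof (rule degree_sum_le)
      fix i :: 4
      have "degree (smult ((A *v x\<^sub>0) $ i) (y i)) \<le> degree (y i)" by (rule degree_smult_le)
      then show "degree (smult ((A *v x\<^sub>0) $ i) (y i)) \<le> 3" using deg[of i] by simp
    qed simp
    have "pcompose R [:0, -1:] = R"
    proof (rule poly_eqI_UNIV)
      fix t
      have "poly R (- t) = f (- (t *s g))" unfolding R[symmetric] by (simp add: vec.scale_minus_left)
      then show "poly (pcompose R [:0, -1:]) t = poly R t"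
        by (simp add: poly_pcompose even R)
    qed
    then have "(-1) ^ n * coeff R n = coeff R n" for n
      by (metis coeff_pcompose_linear)
    from this[of 1] this[of 3] have "coeff R 1 = 0" "coeff R 3 = 0" by simp_all
    moreover have "coeff R 0 = 0"
      using R[of 0] x\<^sub>0 by (simp add: f_def M0 poly_0_coeff_0)
    ultimately have "R = monom (coeff R 2) 2"
    proof (intro poly_eqI)
      fix n :: nat
      consider "n = 0" | "n = 1" | "n = 2" | "n = 3" | "n > 3" by linarith
      then show "coeff R n = coeff (monom (coeff R 2) 2) n"
        by cases (use \<open>coeff R 1 = 0\<close> \<open>coeff R 3 = 0\<close> \<open>coeff R 0 = 0\<close> \<open>degree R \<le> 3\<close> in \<open>auto simp: coeff_eq_0\<close>)
    qed
    then have "f (t *s g) = coeff R 2 * t\<^sup>2" for t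
      unfolding R by (metis poly_monom)
    from this[of t] this[of 1] show ?thesis by (simp add: mult.commute)
  qed
  define f' where "f' z = f (vector [z 0, z 1])" for z :: "nat \<Rightarrow> 'a"
  have "polyfun {0, 1} f'"
    unfolding f'_def f_def bil_def matrix_vector_mult_def[of "M _"] vec_lambda_beta
    by (intro polyfun_sum polyfun.mult polyfun.const M[unfolded poly_matrix_def, rule_format])
  then have "\<exists>p q r d. \<forall>x y w. f' ((\<lambda>_. 0)(0 := x, 1 := y, 2 := w)) = p * x\<^sup>2 + q * x * y + r * y\<^sup>2 + d * w"
  proof (rule weighted_homogeneous_degree_two)
    fix t x y w :: 'a
    have "vector [t * x, t * y] = t *s (vector [x, y] :: 'a ^ 2)"
      by (simp add: vec_eq_iff forall_2)
    then show "f' ((\<lambda>_. 0)(0 := t * x, 1 := t * y, 2 := t\<^sup>2 * w)) = t\<^sup>2 * f' ((\<lambda>_. 0)(0 := x, 1 := y, 2 := w))"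
      using hom2 by (simp add: f'_def)
  qed auto
  then obtain p q r d where "\<And>x y w. f' ((\<lambda>_. 0)(0 := x, 1 := y, 2 := w)) = p * x\<^sup>2 + q * x * y + r * y\<^sup>2 + d * w"
    by blast
  from this[of _ _ 0] have f: "f (vector [x, y]) = p * x\<^sup>2 + q * x * y + r * y\<^sup>2" for x y
    by (simp add: f'_def)
  show ?thesis
  proof (rule that[of p q r])
    fix g h :: "'a ^ 2"
    show "bil A (M g *v x\<^sub>0) (M h *v x\<^sub>0) =
      p * (g $ 1 - h $ 1)\<^sup>2 + q * (g $ 1 - h $ 1) * (g $ 2 - h $ 2) + r * (g $ 2 - h $ 2)\<^sup>2"
      using f[of "(g - h) $ 1" "(g - h) $ 2"] fdiff[of g h]
      unfolding vector_2_eta by simp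
  qed
qed

lemma mat2_mult: "(vector [vector [a, b], vector [c, d]] *v (g :: 'a ^ 2) :: 'a::comm_ring_1 ^ 2) = vector [a * g $ 1 + b * g $ 2, c * g $ 1 + d * g $ 2]"
  by (simp add: vec_eq_iff forall_2 matrix_vector_mult_def sum_2)

lemma mat2_invertible: "a * d - b * c \<noteq> 0 \<Longrightarrow> invertible (vector [vector [a, b], vector [c, d]] :: 'a::field ^ 2 ^ 2)"
  by (simp add: invertible_det_nz det_2)

text \<open>
  A binary quadratic form is a product of two linear forms; they become the new coordinates if they
  are independent, which is the case if the discriminant \<open>e\<^sup>2\<close> is not zero.
\<close>

lemma binary_form_normal_form:
  fixes p q r :: "'a::{alg_closed_field, field_char_0}"
  defines "F \<equiv> \<lambda>g :: 'a ^ 2. p * (g $ 1)\<^sup>2 + q * g $ 1 * g $ 2 + r * (g $ 2)\<^sup>2"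
  obtains T :: "'a ^ 2 ^ 2" where "invertible T" "(\<forall>g. F (T *v g) = g $ 1 * g $ 2) \<or> (\<exists>k. \<forall>g. F (T *v g) = k * (g $ 1)\<^sup>2)"
proof -
  obtain e where e: "e\<^sup>2 = q\<^sup>2 - 4 * p * r"
    using nth_root_exists[of 2 "q\<^sup>2 - 4 * p * r"] by auto
  consider "p = 0" "q = 0" | "p = 0" "q \<noteq> 0" | "p \<noteq> 0" "e = 0" | "p \<noteq> 0" "e \<noteq> 0" by blast
  then show ?thesis
  proof cases
    case 1
    show ?thesis
      by (rule that[of "vector [vector [0, 1], vector [1, 0]]"], rule mat2_invertible)
        (use 1 in \<open>auto simp: F_def mat2_mult\<close>)
  next
    case 2
    show ?thesis
      by (rule that[of "vector [vector [1 / q, - r / q], vector [0, 1]]"], rule mat2_invertible)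
        (use 2 in \<open>auto simp: F_def mat2_mult field_simps power2_eq_square\<close>)
  next
    case 3
    then have r: "r = q\<^sup>2 / (4 * p)" using e by (simp add: field_simps)
    have "F (vector [vector [1, - q / (2 * p)], vector [0, 1]] *v g) = p * (g $ 1)\<^sup>2" for g :: "'a ^ 2"
      using 3 by (simp add: F_def mat2_mult r field_simps power2_eq_square)
    then show ?thesis
      by (intro that[of "vector [vector [1, - q / (2 * p)], vector [0, 1]]"] mat2_invertible) auto
  next
    case 4
    then have r: "r = (q\<^sup>2 - e\<^sup>2) / (4 * p)" using e by (simp add: field_simps)
    let ?T = "vector [vector [(q + e) / (2 * p * e), (e - q) / (2 * e)], vector [- 1 / e, p / e]] :: 'a ^ 2 ^ 2"
    have "F (?T *v g) = g $ 1 * g $ 2" for g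
      using 4 by (simp add: F_def mat2_mult r divide_simps) (simp add: algebra_simps power2_eq_square)
    moreover have "invertible ?T"
      by (rule mat2_invertible) (use 4 in \<open>simp add: divide_simps\<close>)
    ultimately show ?thesis using that by blast
  qed
qed

lemma transform_orbit_form:
  fixes p q r :: "'a::{alg_closed_field, field_char_0}"
  assumes "\<And>g h. bil A (M g *v x\<^sub>0) (M h *v x\<^sub>0) =
    p * (g $ 1 - h $ 1)\<^sup>2 + q * (g $ 1 - h $ 1) * (g $ 2 - h $ 2) + r * (g $ 2 - h $ 2)\<^sup>2"
  obtains T :: "'a ^ 2 ^ 2" where "invertible T"
    "(\<forall>g h. bil A (M (T *v g) *v x\<^sub>0) (M (T *v h) *v x\<^sub>0) = (g $ 1 - h $ 1) * (g $ 2 - h $ 2)) \<or>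
     (\<exists>k. \<forall>g h. bil A (M (T *v g) *v x\<^sub>0) (M (T *v h) *v x\<^sub>0) = k * (g $ 1 - h $ 1)\<^sup>2)"
proof -
  define F where "F g = p * (g $ 1)\<^sup>2 + q * g $ 1 * g $ 2 + r * (g $ 2)\<^sup>2" for g :: "'a ^ 2"
  have F: "bil A (M (T *v g) *v x\<^sub>0) (M (T *v h) *v x\<^sub>0) = F (T *v (g - h))" for T g h
    by (simp add: assms F_def matrix_vector_mult_diff_distrib)
  obtain T :: "'a ^ 2 ^ 2" where T: "invertible T" "(\<forall>g. F (T *v g) = g $ 1 * g $ 2) \<or> (\<exists>k. \<forall>g. F (T *v g) = k * (g $ 1)\<^sup>2)"
    unfolding F_def by (rule binary_form_normal_form[of p q r])
  show ?thesis
    by (rule that[OF T(1)]) (use T(2) in \<open>auto simp: F\<close>)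
qed

text \<open>
  The functions \<open>e g $ i\<close> of \<open>g\<close> span a space that contains all functions \<open>bil A (u g) (u h)\<close>. As the
  vectors \<open>u h\<close> span, it contains \<open>bil A (u g) w\<close> for every \<open>w\<close>.
\<close>

lemma orbit_coordinates:
  fixes u :: "'g \<Rightarrow> 'a::field ^ 'n"
  assumes span: "vec.span (range u) = UNIV"
    and F: "\<And>h. \<exists>a :: 'a ^ 'm. \<forall>g. bil A (u g) (u h) = (\<Sum>i\<in>UNIV. a $ i * e g $ i)"
  shows "\<exists>a :: 'a ^ 'm. \<forall>g. bil A (u g) w = (\<Sum>i\<in>UNIV. a $ i * e g $ i)"
proof -
  have "w \<in> vec.span (range u)" using span by simp
  then show ?thesis
  proof (rule vec.span_induct)
    show "vec.subspace (Collect (\<lambda>w. \<exists>a :: 'a ^ 'm. \<forall>g. bil A (u g) w = (\<Sum>i\<in>UNIV. a $ i * e g $ i)))"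
      unfolding vec.subspace_def mem_Collect_eq
    proof (intro conjI ballI allI, goal_cases)
      case 1
      show ?case by (rule exI[of _ 0]) simp
    next
      case (2 x y)
      then obtain a b :: "'a ^ 'm" where "\<forall>g. bil A (u g) x = (\<Sum>i\<in>UNIV. a $ i * e g $ i)"
        "\<forall>g. bil A (u g) y = (\<Sum>i\<in>UNIV. b $ i * e g $ i)" by auto
      then show ?case
        by (intro CollectI exI[of _ "a + b"]) (simp add: bil_add_right algebra_simps sum.distrib)
    next
      case (3 c x)
      then obtain a :: "'a ^ 'm" where "\<forall>g. bil A (u g) x = (\<Sum>i\<in>UNIV. a $ i * e g $ i)" by auto
      then show ?case
        by (intro CollectI exI[of _ "c *s a"]) (simp add: bil_scale_right sum_distrib_left mult.assoc)
    qed
  qed (use F in auto)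
qed

lemma invertible_if_spanning:
  fixes \<Phi> :: "'a::field ^ 'n ^ 'n"
  assumes "vec.span (range u) = UNIV" and "\<And>g. u g = \<Phi> *v e g"
  shows "invertible \<Phi>"
proof -
  have "\<exists>y. x = \<Phi> *v y" for x
  proof -
    have "x \<in> vec.span (range u)" using assms by simp
    then show ?thesis
    proof (rule vec.span_induct)
      show "vec.subspace (Collect (\<lambda>x. \<exists>y. x = \<Phi> *v y))"
        unfolding vec.subspace_def
        by (auto simp: matrix_vector_right_distrib[symmetric] vector_scalar_commute[symmetric] intro: exI[of _ 0])
    qed (auto simp: assms)
  qed
  then have "surj ((*v) \<Phi>)" by (auto simp: surj_def)
  then have "\<exists>B. \<Phi> ** B = mat 1" by (simp add: matrix_right_invertible_surjective)
  then show ?thesis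
    unfolding invertible_def using matrix_left_right_inverse by blast
qed

text \<open>
  Both sides agree on the spanning set \<open>range e\<close>, where they amount to the translation by \<open>h\<close>.
\<close>

lemma intertwining:
  fixes \<Phi> :: "'a::field ^ 'n ^ 'n"
  assumes span: "vec.span (range e) = UNIV" and S: "\<And>h g. S h *v e g = e (h + g)"
    and hom: "\<And>g h. M (g + h) = M g ** M h" and u: "\<And>g. M (T *v g) *v x\<^sub>0 = \<Phi> *v e g"
  shows "\<Phi> ** S h = M (T *v h) ** \<Phi>"
proof (rule matrix_eq_on_span[OF span])
  fix x assume "x \<in> range e"
  then obtain g where x: "x = e g" by blast
  have "\<Phi> ** S h *v x = M (T *v (h + g)) *v x\<^sub>0"
    by (simp add: x S u flip: matrix_vector_mul_assoc)
  also have "\<dots> = M (T *v h) *v (M (T *v g) *v x\<^sub>0)"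
    by (simp add: matrix_vector_right_distrib hom matrix_vector_mul_assoc)
  also have "\<dots> = M (T *v h) ** \<Phi> *v x"
    by (simp add: u x flip: matrix_vector_mul_assoc)
  finally show "\<Phi> ** S h *v x = M (T *v h) ** \<Phi> *v x" .
qed

lemma span_three_columns_not_UNIV:
  fixes u :: "'g \<Rightarrow> 'a::field ^ 4" and a :: "4 \<Rightarrow> 'a ^ 3"
  assumes "\<And>g i. u g $ i = (\<Sum>k\<in>UNIV. a i $ k * e g $ k)"
  shows "vec.span (range u) \<noteq> UNIV"
proof
  assume span: "vec.span (range u) = UNIV"
  let ?W = "range (\<lambda>k. \<chi> i. a i $ k)"
  have "u g \<in> vec.span ?W" for g
  proof -
    have "u g = (\<Sum>k\<in>UNIV. e g $ k *s (\<chi> i. a i $ k))"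
      by (simp add: vec_eq_iff assms mult.commute)
    also have "\<dots> \<in> vec.span ?W"
      by (intro vec.span_sum vec.span_scale vec.span_base rangeI)
    finally show ?thesis .
  qed
  then have "range u \<subseteq> vec.span ?W" by blast
  then have "vec.span (range u) \<subseteq> vec.span ?W"
    by (rule vec.span_minimal) (rule vec.subspace_span)
  then have "vec.dim (UNIV :: ('a ^ 4) set) \<le> card ?W"
    using span by (intro vec.dim_le_card) auto
  also have "\<dots> \<le> CARD(3)" by (rule card_image_le) simp
  finally show False unfolding vec_dim_card by simp
qed

lemma vector_4 [simp]:
  "(vector [a, b, c, d] :: 'a::zero ^ 4) $ 1 = a"
  "(vector [a, b, c, d] :: 'a::zero ^ 4) $ 2 = b"
  "(vector [a, b, c, d] :: 'a::zero ^ 4) $ 3 = c"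
  "(vector [a, b, c, d] :: 'a::zero ^ 4) $ 4 = d"
  unfolding vector_def by simp_all

section \<open>Rank four\<close>

text \<open>
  The matrix of \<open>2 (x\<^sub>1 x\<^sub>4 - x\<^sub>2 x\<^sub>3)\<close>, whose zeros are the decomposable tensors.
\<close>

definition split_form :: "'a::comm_ring_1 ^ 4 ^ 4" where
  "split_form = vector [vector [0, 0, 0, 1], vector [0, 0, -1, 0], vector [0, -1, 0, 0], vector [1, 0, 0, 0]]"

text \<open>
  The orbit of the point \<open>(1 : 0) \<otimes> (1 : 0)\<close> under the translations of both factors.
\<close>

definition split_orbit :: "'a::comm_ring_1 ^ 2 \<Rightarrow> 'a ^ 4" where
  "split_orbit g = vector [1, g $ 1, g $ 2, g $ 1 * g $ 2]"

text \<open>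
  The translation by \<open>g $ 1\<close> on the second factor of the product of two projective lines and by
  \<open>g $ 2\<close> on the first one.
\<close>

definition split_action :: "'a::comm_ring_1 ^ 2 \<Rightarrow> 'a ^ 4 ^ 4" where
  "split_action g = vector [vector [1, 0, 0, 0], vector [g $ 1, 1, 0, 0], vector [g $ 2, 0, 1, 0],
     vector [g $ 1 * g $ 2, g $ 2, g $ 1, 1]]"

lemma bil_split_form: "bil split_form x y = x $ 1 * y $ 4 - x $ 2 * y $ 3 - x $ 3 * y $ 2 + x $ 4 * y $ 1"
  by (simp add: bil_def split_form_def matrix_vector_mult_def sum_4)

lemma split_form_sym: "transpose split_form = (split_form :: 'a::comm_ring_1 ^ 4 ^ 4)"
  by (simp add: split_form_def transpose_def vec_eq_iff forall_4)

lemma split_action_split_orbit: "split_action h *v split_orbit g = split_orbit (h + g)"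
  by (simp add: split_action_def split_orbit_def vec_eq_iff forall_4 matrix_vector_mult_def sum_4 algebra_simps)

lemma bil_split_orbit: "bil split_form (split_orbit g) (split_orbit h) = (g $ 1 - h $ 1) * (g $ 2 - h $ 2)"
  by (simp add: bil_split_form split_orbit_def algebra_simps)

lemma span_split_orbit: "vec.span (range split_orbit) = (UNIV :: ('a::field ^ 4) set)"
proof (rule span_UNIV_if_no_annihilator)
  fix c :: "'a ^ 4"
  assume 0: "\<And>x. x \<in> range split_orbit \<Longrightarrow> (\<Sum>i\<in>UNIV. c $ i * x $ i) = 0"
  have c: "c $ 1 + c $ 2 * g $ 1 + c $ 3 * g $ 2 + c $ 4 * (g $ 1 * g $ 2) = 0" for g :: "'a ^ 2"
    using 0[OF rangeI, of g] by (simp add: split_orbit_def sum_4)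
  have "c $ 1 = 0" using c[of 0] by simp
  moreover have "c $ 2 = 0" using c[of "vector [1, 0]"] calculation by simp
  moreover have "c $ 3 = 0" using c[of "vector [0, 1]"] calculation by simp
  moreover have "c $ 4 = 0" using c[of "vector [1, 1]"] calculation by simp
  ultimately show "c = 0" by (simp add: vec_eq_iff forall_4)
qed

text \<open>
  The tensor product of the vectors with coordinates \<open>z 2, z 3\<close> and \<open>z 4, z 5\<close>.
\<close>

definition segre :: "(nat \<Rightarrow> 'a::comm_ring_1) \<Rightarrow> 'a ^ 4" where
  "segre z = vector [z 2 * z 4, z 2 * z 5, z 3 * z 4, z 3 * z 5]"

lemma segre_eq_0_iff: "segre (z :: nat \<Rightarrow> 'a::field) = 0 \<longleftrightarrow> (z 2 = 0 \<and> z 3 = 0) \<or> (z 4 = 0 \<and> z 5 = 0)"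
  by (auto simp: segre_def vec_eq_iff forall_4)

lemma all_ones_cong:
  fixes h :: "(nat \<Rightarrow> 'a::comm_ring_1) \<Rightarrow> 'a"
  assumes "polyfun {..<6} h"
  shows "h (z(0 := 1, 1 := 1, 2 := 1, 3 := 1, 4 := 1, 5 := 1)) = h (\<lambda>_. 1)"
  by (rule polyfun_cong_point[OF assms]) (auto simp: less_Suc_eq numeral_eq_Suc)

text \<open>
  A function without zeros where \<open>segre\<close> is nonzero is constant, since every such point can be moved
  to \<open>(1, \<dots>, 1)\<close> by changing one coordinate at a time, along lines on which \<open>segre\<close> has no zeros. The
  two scalings make functions of bidegree \<open>(1, 1)\<close>.
\<close>

interpretation segre_cone: param_cone "segre :: (nat \<Rightarrow> 'a::{alg_closed_field, field_char_0}) \<Rightarrow> _"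
  "{(1, \<lambda>i. if i = 2 \<or> i = 3 then 1 else 0), (1, \<lambda>i. if i = 4 \<or> i = 5 then 1 else 0)}"
proof
  show "polyfun {2..<6} (\<lambda>z. segre z $ i)" for i
    using exhaust_4[of i] by (auto simp: segre_def intro!: polyfun_intros)
next
  fix h :: "(nat \<Rightarrow> 'a) \<Rightarrow> 'a"
  assume h: "polyfun {..<6} h" and nz: "\<And>z. segre z \<noteq> 0 \<Longrightarrow> h z \<noteq> 0"
  have move: "h (z(i := 1)) = h z" if "\<And>c. segre (z(i := c)) \<noteq> 0" for z i
    by (rule polyfun_nonvanishing_const[OF h]) (use that nz in blast)
  have a: "h (z(2 := 1, 3 := 1)) = h z \<and> segre (z(2 := 1, 3 := 1)) \<noteq> 0" if z: "segre z \<noteq> 0" for z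
  proof (cases "z 2 = 0")
    case True
    have "h (z(2 := 1)) = h z"
      by (rule move) (use z True in \<open>auto simp: segre_eq_0_iff\<close>)
    moreover have "h (z(2 := 1, 3 := 1)) = h (z(2 := 1))"
      by (rule move) (use z True in \<open>auto simp: segre_eq_0_iff\<close>)
    ultimately show ?thesis using z by (auto simp: segre_eq_0_iff)
  next
    case False
    have "h (z(3 := 1)) = h z"
      by (rule move) (use z False in \<open>auto simp: segre_eq_0_iff\<close>)
    moreover have "h (z(3 := 1, 2 := 1)) = h (z(3 := 1))"
      by (rule move) (use z False in \<open>auto simp: segre_eq_0_iff\<close>)
    moreover have "z(3 := 1, 2 := 1) = z(2 := 1, 3 := 1)" by auto
    ultimately show ?thesis using z by (auto simp: segre_eq_0_iff)
  qed
  have b: "h (z(4 := 1, 5 := 1)) = h z \<and> segre (z(4 := 1, 5 := 1)) \<noteq> 0" if z: "segre z \<noteq> 0" for z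
  proof (cases "z 4 = 0")
    case True
    have "h (z(4 := 1)) = h z"
      by (rule move) (use z True in \<open>auto simp: segre_eq_0_iff\<close>)
    moreover have "h (z(4 := 1, 5 := 1)) = h (z(4 := 1))"
      by (rule move) (use z True in \<open>auto simp: segre_eq_0_iff\<close>)
    ultimately show ?thesis using z by (auto simp: segre_eq_0_iff)
  next
    case False
    have "h (z(5 := 1)) = h z"
      by (rule move) (use z False in \<open>auto simp: segre_eq_0_iff\<close>)
    moreover have "h (z(5 := 1, 4 := 1)) = h (z(5 := 1))"
      by (rule move) (use z False in \<open>auto simp: segre_eq_0_iff\<close>)
    moreover have "z(5 := 1, 4 := 1) = z(4 := 1, 5 := 1)" by auto
    ultimately show ?thesis using z by (auto simp: segre_eq_0_iff)
  qed
  have "h z = h (\<lambda>_. 1)" if z: "segre z \<noteq> 0" for z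
  proof -
    have 0: "h (z(0 := 1)) = h z" "segre (z(0 := 1)) \<noteq> 0"
      using z by (auto simp: segre_eq_0_iff intro!: move)
    have 1: "h (z(0 := 1, 1 := 1)) = h z" "segre (z(0 := 1, 1 := 1)) \<noteq> 0"
      using move[of "z(0 := 1)" 1] 0 z by (auto simp: segre_eq_0_iff)
    show ?thesis
      using a[OF 1(2)] b[of "z(0 := 1, 1 := 1, 2 := 1, 3 := 1)"] all_ones_cong[OF h, of z] 1 by metis
  qed
  then show "\<exists>k. \<forall>z. segre z \<noteq> 0 \<longrightarrow> h z = k" by blast
next
  fix d w
  assume "(d, w) \<in> {(1, \<lambda>i. if i = 2 \<or> i = 3 then 1 else 0), (1::nat, \<lambda>i. if i = 4 \<or> i = (5::nat) then 1 else (0::nat))}"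
  then show "w 0 = 0 \<and> w 1 = 0 \<and> (\<forall>t z. segre (\<lambda>i. t ^ w i * z i) = t ^ d *s (segre z :: 'a ^ 4))"
    by (auto simp: segre_def vec_eq_iff forall_4)
next
  fix f :: "(nat \<Rightarrow> 'a) \<Rightarrow> 'a"
  assume f: "polyfun {..<6} f"
    and hom: "\<And>d w t z. (d, w) \<in> {(1, \<lambda>i. if i = 2 \<or> i = 3 then 1 else 0), (1, \<lambda>i. if i = 4 \<or> i = 5 then 1 else 0)}
       \<Longrightarrow> t \<noteq> 0 \<Longrightarrow> f (\<lambda>i. t ^ w i * z i) = t ^ d * f z"
  have h1: "f (\<lambda>i. t ^ (if i = 2 \<or> i = 3 then 1 else 0) * z i) = t * f z" if "t \<noteq> 0" for t z
    using hom[of 1 "\<lambda>i. if i = 2 \<or> i = 3 then 1 else 0" t z] that by simp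
  have h2: "f (\<lambda>i. t ^ (if i = 4 \<or> i = 5 then 1 else 0) * z i) = t * f z" if "t \<noteq> 0" for t z
    using hom[of 1 "\<lambda>i. if i = 4 \<or> i = 5 then 1 else 0" t z] that by simp
  have e1: "f z = z 2 * f (z(2 := 1, 3 := 0)) + z 3 * f (z(2 := 0, 3 := 1))" for z
  proof -
    have "f (z(2 := z 2, 3 := z 3)) = z 2 * f (z(2 := 1, 3 := 0)) + z 3 * f (z(2 := 0, 3 := 1))"
    proof (rule homogeneous_degree_one[OF f])
      fix t x y :: 'a assume "t \<noteq> 0"
      moreover have "(\<lambda>i. t ^ (if i = 2 \<or> i = 3 then 1 else 0) * (z(2 := x, 3 := y)) i) = z(2 := t * x, 3 := t * y)"
        by auto
      ultimately show "f (z(2 := t * x, 3 := t * y)) = t * f (z(2 := x, 3 := y))"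
        using h1[of t "z(2 := x, 3 := y)"] by simp
    qed auto
    then show ?thesis by simp
  qed
  have e2: "f z = z 4 * f (z(4 := 1, 5 := 0)) + z 5 * f (z(4 := 0, 5 := 1))" for z
  proof -
    have "f (z(4 := z 4, 5 := z 5)) = z 4 * f (z(4 := 1, 5 := 0)) + z 5 * f (z(4 := 0, 5 := 1))"
    proof (rule homogeneous_degree_one[OF f])
      fix t x y :: 'a assume "t \<noteq> 0"
      moreover have "(\<lambda>i. t ^ (if i = 4 \<or> i = 5 then 1 else 0) * (z(4 := x, 5 := y)) i) = z(4 := t * x, 5 := t * y)"
        by auto
      ultimately show "f (z(4 := t * x, 5 := t * y)) = t * f (z(4 := x, 5 := y))"
        using h2[of t "z(4 := x, 5 := y)"] by simp
    qed auto
    then show ?thesis by simp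
  qed
  define b where "b x y u v z = f (z(2 := x, 3 := y, 4 := u, 5 := v))" for x y u v z
  have bp: "polyfun {0, 1} (b x y u v)" for x y u v
    unfolding b_def
    by (rule polyfun_subst[OF f], intro polyfun_upd)
      (auto simp: less_Suc_eq numeral_eq_Suc intro: polyfun_intros)
  define m where "m j = (if j = 1 then b 1 0 1 0 else if j = 2 then b 1 0 0 1
     else if j = 3 then b 0 1 1 0 else b 0 1 0 1)" for j :: 4
  have "f z = (\<Sum>j\<in>UNIV. m j z * segre z $ j)" for z
    unfolding e1[of z] e2[of "z(2 := 1, 3 := 0)"] e2[of "z(2 := 0, 3 := 1)"]
    by (simp add: sum_4 m_def b_def segre_def algebra_simps)
  moreover have "polyfun {0, 1} (m j)" for j
    using bp by (simp add: m_def)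
  ultimately show "\<exists>m. (\<forall>j. polyfun {0, 1} (m j)) \<and> (\<forall>z. f z = (\<Sum>j\<in>UNIV. m j z * segre z $ j))"
    by blast
next
  fix c :: "4 \<Rightarrow> 'a" and j
  assume c: "\<And>z. (\<Sum>j\<in>UNIV. c j * segre z $ j) = 0"
  have s: "c 1 * (z 2 * z 4) + c 2 * (z 2 * z 5) + c 3 * (z 3 * z 4) + c 4 * (z 3 * z 5) = 0" for z :: "nat \<Rightarrow> 'a"
    using c[of z] by (simp add: sum_4 segre_def)
  have "c 1 = 0" using s[of "\<lambda>i. if i = 2 \<or> i = 4 then 1 else 0"] by simp
  moreover have "c 2 = 0" using s[of "\<lambda>i. if i = 2 \<or> i = 5 then 1 else 0"] by simp
  moreover have "c 3 = 0" using s[of "\<lambda>i. if i = 3 \<or> i = 4 then 1 else 0"] by simp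
  moreover have "c 4 = 0" using s[of "\<lambda>i. if i = 3 \<or> i = 5 then 1 else 0"] by simp
  ultimately show "c j = 0" using exhaust_4[of j] by auto
next
  fix k :: 'a and z
  show "\<exists>z'. segre z' = k *s segre z"
    by (rule exI[of _ "z(2 := k * z 2, 3 := k * z 3)"]) (simp add: segre_def vec_eq_iff forall_4)
qed

text \<open>
  Evaluation at tensors of vectors with entries \<open>0\<close> and \<open>1\<close> determines a symmetric matrix whose form
  vanishes on all decomposable tensors.
\<close>

interpretation segre: param_quadric "segre :: (nat \<Rightarrow> 'a::{alg_closed_field, field_char_0}) \<Rightarrow> _"
  "{(1, \<lambda>i. if i = 2 \<or> i = 3 then 1 else 0), (1, \<lambda>i. if i = 4 \<or> i = 5 then 1 else 0)}" split_form
proof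
  show "transpose split_form = (split_form :: 'a ^ 4 ^ 4)" by (rule split_form_sym)
  show "\<exists>i j. (split_form :: 'a ^ 4 ^ 4) $ i $ j = 1"
    by (rule exI[of _ 1], rule exI[of _ 4]) (simp add: split_form_def)
next
  fix x :: "'a ^ 4"
  have xx: "bil split_form x x = 2 * (x $ 1 * x $ 4 - x $ 2 * x $ 3)"
    by (simp add: bil_split_form algebra_simps)
  define zz where "zz a b c d i = (if i = 2 then a else if i = 3 then b else if i = 4 then c else d)"
    for a b c d :: 'a and i :: nat
  have zz: "segre (zz a b c d) = vector [a * c, a * d, b * c, b * d]" for a b c d
    by (simp add: segre_def zz_def)
  show "bil split_form x x = 0 \<longleftrightarrow> (\<exists>z. x = segre z)"
  proof
    assume "bil split_form x x = 0"
    then have eq: "x $ 1 * x $ 4 = x $ 2 * x $ 3" by (simp add: xx)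
    consider "x $ 1 \<noteq> 0" | "x $ 1 = 0" "x $ 2 = 0" | "x $ 1 = 0" "x $ 3 = 0" using eq by fastforce
    then show "\<exists>z. x = segre z"
    proof cases
      case 1
      then have "x = segre (zz 1 (x $ 3 / x $ 1) (x $ 1) (x $ 2))"
        using eq unfolding zz by (simp add: vec_eq_iff forall_4 field_simps)
      then show ?thesis by (intro exI)
    next
      case 2
      then have "x = segre (zz 0 1 (x $ 3) (x $ 4))"
        unfolding zz by (simp add: vec_eq_iff forall_4)
      then show ?thesis by (intro exI)
    next
      case 3
      then have "x = segre (zz (x $ 2) (x $ 4) 0 1)"
        unfolding zz by (simp add: vec_eq_iff forall_4)
      then show ?thesis by (intro exI)
    qed
  next
    assume "\<exists>z. x = segre z"
    then show "bil split_form x x = 0"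
      by (auto simp: xx segre_def)
  qed
  fix C :: "'a ^ 4 ^ 4"
  assume C: "transpose C = C" and van: "\<And>z. bil C (segre z) (segre z) = 0"
  have s: "C $ i $ j = C $ j $ i" for i j
    using arg_cong[OF C, of "\<lambda>X. X $ j $ i"] by (simp add: transpose_def)
  note s' = s[of 2 1] s[of 3 1] s[of 4 1] s[of 3 2] s[of 4 2] s[of 4 3]
  have E: "bil C (vector [a * c, a * d, b * c, b * d]) (vector [a * c, a * d, b * c, b * d]) = 0" for a b c d
    using van[of "zz a b c d"] by (simp add: zz)
  note E' = E[unfolded bil_def matrix_vector_mult_def sum_4 vec_lambda_beta vector_4]
  have 1: "C $ 1 $ 1 = 0" "C $ 2 $ 2 = 0" "C $ 3 $ 3 = 0" "C $ 4 $ 4 = 0"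
    using E'[where a = 1 and b = 0 and c = 1 and d = 0] E'[where a = 1 and b = 0 and c = 0 and d = 1] E'[where a = 0 and b = 1 and c = 1 and d = 0] E'[where a = 0 and b = 1 and c = 0 and d = 1]
    by simp_all
  have 2: "C $ 1 $ 2 = 0" "C $ 1 $ 3 = 0" "C $ 2 $ 4 = 0" "C $ 3 $ 4 = 0"
    using E'[where a = 1 and b = 0 and c = 1 and d = 1]
      E'[where a = 1 and b = 1 and c = 1 and d = 0]
      E'[where a = 1 and b = 1 and c = 0 and d = 1]
      E'[where a = 0 and b = 1 and c = 1 and d = 1] 1
    by (simp_all add: s' flip: mult_2)
  have "2 * (C $ 1 $ 4 + C $ 2 $ 3) = 0"
    using E'[where a = 1 and b = 1 and c = 1 and d = 1] 1 2 by (simp add: s' algebra_simps)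
  then have 3: "C $ 2 $ 3 = - C $ 1 $ 4" by (simp add: add_eq_0_iff)
  have "bil C x y = C $ 1 $ 4 * bil split_form x y" for x y
    unfolding bil_split_form unfolding bil_def matrix_vector_mult_def sum_4 vec_lambda_beta
    by (simp add: 1 2 3 s' algebra_simps)
  then show "\<exists>k. \<forall>x y. bil C x y = k * bil split_form x y" by blast
qed

text \<open>
  The case \<open>\<kappa> s\<^sup>2\<close> of the quadratic form of the orbit is excluded because the orbit would span at most
  three dimensions. In the other case the coordinates of the orbit are combinations of
  \<open>1, s, t, s t\<close>.
\<close>

lemma split_normal_form:
  fixes M :: "'a::{alg_closed_field, field_char_0} ^ 2 \<Rightarrow> 'a ^ 4 ^ 4"
  assumes M: "poly_matrix M" "M 0 = mat 1" and hom: "\<And>g h. M (g + h) = M g ** M h"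
    and iso: "\<And>g x y. bil split_form (M g *v x) (M g *v y) = bil split_form x y"
    and x\<^sub>0: "bil split_form x\<^sub>0 x\<^sub>0 = 0" and span: "vec.span (range (\<lambda>g. M g *v x\<^sub>0)) = UNIV"
  obtains \<Phi> T where "invertible \<Phi>" "invertible T" "\<And>x y. bil split_form (\<Phi> *v x) (\<Phi> *v y) = bil split_form x y"
    "\<And>h. \<Phi> ** split_action h = M (T *v h) ** \<Phi>"
proof -
  obtain p q r where F0: "\<And>g h. bil split_form (M g *v x\<^sub>0) (M h *v x\<^sub>0) =
    p * (g $ 1 - h $ 1)\<^sup>2 + q * (g $ 1 - h $ 1) * (g $ 2 - h $ 2) + r * (g $ 2 - h $ 2)\<^sup>2"
    by (rule orbit_form[OF M hom split_form_sym iso x\<^sub>0]) blast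
  obtain T :: "'a ^ 2 ^ 2" where T: "invertible T" and
    F: "(\<forall>g h. bil split_form (M (T *v g) *v x\<^sub>0) (M (T *v h) *v x\<^sub>0) = (g $ 1 - h $ 1) * (g $ 2 - h $ 2)) \<or>
     (\<exists>k. \<forall>g h. bil split_form (M (T *v g) *v x\<^sub>0) (M (T *v h) *v x\<^sub>0) = k * (g $ 1 - h $ 1)\<^sup>2)"
    by (rule transform_orbit_form[OF F0])
  define u where "u g = M (T *v g) *v x\<^sub>0" for g
  have "range u = range (\<lambda>g. M g *v x\<^sub>0)"
  proof -
    have "surj ((*v) T)"
      using T by (auto simp: invertible_def matrix_right_invertible_surjective[symmetric])
    then have "range (\<lambda>g. M g *v x\<^sub>0) = (\<lambda>g. M g *v x\<^sub>0) ` range ((*v) T)" by simp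
    then show ?thesis by (simp add: u_def[abs_def] image_image)
  qed
  then have span_u: "vec.span (range u) = UNIV" using span by simp
  have coord: "u g $ 1 = bil split_form (u g) (axis 4 1)" "u g $ 2 = bil split_form (u g) (axis 3 (-1))"
    "u g $ 3 = bil split_form (u g) (axis 2 (-1))" "u g $ 4 = bil split_form (u g) (axis 1 1)" for g
    by (simp_all add: bil_split_form axis_def)
  have coord': "\<exists>w. \<forall>g. u g $ i = bil split_form (u g) w" for i
    using exhaust_4[of i] coord by metis
  show ?thesis
  proof (cases "\<forall>g h. bil split_form (u g) (u h) = (g $ 1 - h $ 1) * (g $ 2 - h $ 2)")
    case True
    have "\<exists>a :: 'a ^ 4. \<forall>g. bil split_form (u g) w = (\<Sum>i\<in>UNIV. a $ i * split_orbit g $ i)" for w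
    proof (rule orbit_coordinates[OF span_u])
      fix h
      show "\<exists>a :: 'a ^ 4. \<forall>g. bil split_form (u g) (u h) = (\<Sum>i\<in>UNIV. a $ i * split_orbit g $ i)"
        by (rule exI[of _ "vector [h $ 1 * h $ 2, - h $ 2, - h $ 1, 1]"])
          (simp add: True sum_4 split_orbit_def algebra_simps)
    qed
    then have "\<exists>a :: 'a ^ 4. \<forall>g. u g $ i = (\<Sum>k\<in>UNIV. a $ k * split_orbit g $ k)" for i
      using coord'[of i] by metis
    then obtain a :: "4 \<Rightarrow> 'a ^ 4" where a: "\<And>i g. u g $ i = (\<Sum>k\<in>UNIV. a i $ k * split_orbit g $ k)"
      by metis
    define \<Phi> where "\<Phi> = (\<chi> i. a i)"
    have \<Phi>: "u g = \<Phi> *v split_orbit g" for g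
      by (simp add: vec_eq_iff a \<Phi>_def matrix_vector_mult_def)
    have inv: "invertible \<Phi>" by (rule invertible_if_spanning[OF span_u \<Phi>])
    have "bil (transpose \<Phi> ** split_form ** \<Phi>) x y = 1 * bil split_form x y" for x y
      by (rule bil_proportional_on_span[OF span_split_orbit])
        (auto simp: bil_congruence bil_split_orbit True simp flip: \<Phi>)
    then have form: "bil split_form (\<Phi> *v x) (\<Phi> *v y) = bil split_form x y" for x y
      by (simp add: bil_congruence)
    have "\<Phi> ** split_action h = M (T *v h) ** \<Phi>" for h
      by (rule intertwining[OF span_split_orbit split_action_split_orbit hom]) (use \<Phi> u_def in auto)
    then show ?thesis using that inv T form by blast
  next
    case False
    then obtain k where k: "\<And>g h. bil split_form (u g) (u h) = k * (g $ 1 - h $ 1)\<^sup>2"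
      using F unfolding u_def by blast
    have "\<exists>a :: 'a ^ 3. \<forall>g. bil split_form (u g) w = (\<Sum>i\<in>UNIV. a $ i * (vector [1, g $ 1, (g $ 1)\<^sup>2] :: 'a ^ 3) $ i)" for w
    proof (rule orbit_coordinates[OF span_u])
      fix h
      show "\<exists>a :: 'a ^ 3. \<forall>g. bil split_form (u g) (u h) = (\<Sum>i\<in>UNIV. a $ i * (vector [1, g $ 1, (g $ 1)\<^sup>2] :: 'a ^ 3) $ i)"
        by (rule exI[of _ "vector [k * (h $ 1)\<^sup>2, - 2 * k * h $ 1, k]"])
          (simp add: k sum_3 algebra_simps power2_eq_square)
    qed
    then have "\<exists>a :: 'a ^ 3. \<forall>g. u g $ i = (\<Sum>k\<in>UNIV. a $ k * (vector [1, g $ 1, (g $ 1)\<^sup>2] :: 'a ^ 3) $ k)" for i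
      using coord'[of i] by metis
    then obtain a :: "4 \<Rightarrow> 'a ^ 3" where "\<And>i g. u g $ i = (\<Sum>k\<in>UNIV. a i $ k * (vector [1, g $ 1, (g $ 1)\<^sup>2] :: 'a ^ 3) $ k)"
      by metis
    then have "vec.span (range u) \<noteq> UNIV"
      by (rule span_three_columns_not_UNIV)
    then show ?thesis using span_u by blast
  qed
qed

section \<open>Rank three\<close>

text \<open>
  The matrix of \<open>2 (x\<^sub>1 x\<^sub>3 - x\<^sub>2\<^sup>2)\<close>; the vertex of the cone is the fourth basis vector.
\<close>

definition cone_form :: "'a::comm_ring_1 ^ 4 ^ 4" where
  "cone_form = vector [vector [0, 0, 1, 0], vector [0, -2, 0, 0], vector [1, 0, 0, 0], vector [0, 0, 0, 0]]"

text \<open>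
  The orbit of the point \<open>(1 : 0 : 0 : 0)\<close>. The parameter \<open>e\<close> distinguishes the two classes.
\<close>

definition cone_orbit :: "'a::comm_ring_1 \<Rightarrow> 'a ^ 2 \<Rightarrow> 'a ^ 4" where
  "cone_orbit e g = vector [1, g $ 1, (g $ 1)\<^sup>2, e * (g $ 1) ^ 3 + g $ 2]"

text \<open>
  The matrices that act on \<open>cone_orbit e\<close> by translations: the rows are the binomial expansions of
  the powers of the first group coordinate.
\<close>

definition cone_action :: "'a::comm_ring_1 \<Rightarrow> 'a ^ 2 \<Rightarrow> 'a ^ 4 ^ 4" where
  "cone_action e g = vector [vector [1, 0, 0, 0], vector [g $ 1, 1, 0, 0], vector [(g $ 1)\<^sup>2, 2 * g $ 1, 1, 0],
     vector [e * (g $ 1) ^ 3 + g $ 2, 3 * e * (g $ 1)\<^sup>2, 3 * e * g $ 1, 1]]"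

lemma bil_cone_form: "bil cone_form x y = x $ 1 * y $ 3 - 2 * x $ 2 * y $ 2 + x $ 3 * y $ 1"
  by (simp add: bil_def cone_form_def matrix_vector_mult_def sum_4 algebra_simps)

lemma cone_form_sym: "transpose cone_form = (cone_form :: 'a::comm_ring_1 ^ 4 ^ 4)"
  by (simp add: cone_form_def transpose_def vec_eq_iff forall_4)

lemma cone_action_cone_orbit: "cone_action e h *v cone_orbit e g = cone_orbit e (h + g)"
  by (simp add: cone_action_def cone_orbit_def vec_eq_iff forall_4 matrix_vector_mult_def sum_4
      algebra_simps power2_eq_square power3_eq_cube)

lemma bil_cone_orbit: "bil cone_form (cone_orbit e g) (cone_orbit e h) = (g $ 1 - h $ 1)\<^sup>2"
  by (simp add: bil_cone_form cone_orbit_def algebra_simps power2_eq_square)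

lemma span_cone_orbit: "vec.span (range (cone_orbit e)) = (UNIV :: ('a::field_char_0 ^ 4) set)"
proof (rule span_UNIV_if_no_annihilator)
  fix c :: "'a ^ 4"
  assume 0: "\<And>x. x \<in> range (cone_orbit e) \<Longrightarrow> (\<Sum>i\<in>UNIV. c $ i * x $ i) = 0"
  have c: "c $ 1 + c $ 2 * g $ 1 + c $ 3 * (g $ 1)\<^sup>2 + c $ 4 * (e * (g $ 1) ^ 3 + g $ 2) = 0" for g :: "'a ^ 2"
    using 0[OF rangeI, of g] by (simp add: cone_orbit_def sum_4)
  have 1: "c $ 1 = 0" using c[of 0] by simp
  have 4: "c $ 4 = 0" using c[of "vector [0, 1]"] 1 by simp
  have 3: "c $ 2 + c $ 3 = 0" using c[of "vector [1, 0]"] 1 4 by simp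
  have "c $ 3 = c $ 2" using c[of "vector [- 1, 0]"] 1 4 by simp
  then have 2: "c $ 2 = 0" "c $ 3 = 0" using 3 by (simp_all flip: mult_2)
  show "c = 0" using 1 2 4 by (simp add: vec_eq_iff forall_4)
qed

text \<open>
  The weighted projective plane with weights \<open>1, 1, 2\<close> is the quadratic cone.
\<close>

definition conic_cone :: "(nat \<Rightarrow> 'a::comm_ring_1) \<Rightarrow> 'a ^ 4" where
  "conic_cone z = vector [z 2 ^ 2, z 2 * z 3, z 3 ^ 2, z 4]"

lemma conic_cone_eq_0_iff: "conic_cone (z :: nat \<Rightarrow> 'a::field) = 0 \<longleftrightarrow> z 2 = 0 \<and> z 3 = 0 \<and> z 4 = 0"
  by (auto simp: conic_cone_def vec_eq_iff forall_4)

text \<open>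
  As for the Segre map, except that only the three coordinates \<open>2, 3, 4\<close> occur. The second scaling
  makes functions independent of coordinate \<open>5\<close>.
\<close>

interpretation vertex_cone: param_cone "conic_cone :: (nat \<Rightarrow> 'a::{alg_closed_field, field_char_0}) \<Rightarrow> _"
  "{(2, \<lambda>i. if i = 2 \<or> i = 3 then 1 else if i = 4 then 2 else 0), (0, \<lambda>i. if i = 5 then 1 else 0)}"
proof
  show "polyfun {2..<6} (\<lambda>z. conic_cone z $ i)" for i
    using exhaust_4[of i] by (auto simp: conic_cone_def intro!: polyfun_intros polyfun_power)
next
  fix h :: "(nat \<Rightarrow> 'a) \<Rightarrow> 'a"
  assume h: "polyfun {..<6} h" and nz: "\<And>z. conic_cone z \<noteq> 0 \<Longrightarrow> h z \<noteq> 0"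
  have move: "h (z(i := 1)) = h z" if "\<And>c. conic_cone (z(i := c)) \<noteq> 0" for z i
    by (rule polyfun_nonvanishing_const[OF h]) (use that nz in blast)
  have a: "h (z(2 := 1, 3 := 1, 4 := 1)) = h z" if z: "z 4 \<noteq> 0" for z
  proof -
    have "h (z(2 := 1)) = h z"
      by (rule move) (use z in \<open>auto simp: conic_cone_eq_0_iff\<close>)
    moreover have "h (z(2 := 1, 3 := 1)) = h (z(2 := 1))"
      by (rule move) (use z in \<open>auto simp: conic_cone_eq_0_iff\<close>)
    moreover have "h (z(2 := 1, 3 := 1, 4 := 1)) = h (z(2 := 1, 3 := 1))"
      by (rule move) (auto simp: conic_cone_eq_0_iff)
    ultimately show ?thesis by simp
  qed
  have b: "h (z(2 := 1, 3 := 1, 4 := 1)) = h z" if z: "conic_cone z \<noteq> 0" for z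
  proof (cases "z 4 = 0")
    case True
    have "h (z(4 := 1)) = h z"
      by (rule move) (use z True in \<open>auto simp: conic_cone_eq_0_iff\<close>)
    moreover have "z(4 := 1, 2 := 1, 3 := 1, 4 := 1) = z(2 := 1, 3 := 1, 4 := 1)" by auto
    ultimately show ?thesis using a[of "z(4 := 1)"] by simp
  qed (rule a)
  have "h z = h (\<lambda>_. 1)" if z: "conic_cone z \<noteq> 0" for z
  proof -
    have 0: "h (z(0 := 1)) = h z" "conic_cone (z(0 := 1)) \<noteq> 0"
      using z by (auto simp: conic_cone_eq_0_iff intro!: move)
    have 1: "h (z(0 := 1, 1 := 1)) = h z" "conic_cone (z(0 := 1, 1 := 1)) \<noteq> 0"
      using move[of "z(0 := 1)" 1] 0 z by (auto simp: conic_cone_eq_0_iff)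
    have 2: "h (z(0 := 1, 1 := 1, 2 := 1, 3 := 1, 4 := 1)) = h z"
      using b[OF 1(2)] 1 by simp
    have 3: "h (z(0 := 1, 1 := 1, 2 := 1, 3 := 1, 4 := 1, 5 := 1)) = h (z(0 := 1, 1 := 1, 2 := 1, 3 := 1, 4 := 1))"
      by (rule move) (auto simp: conic_cone_eq_0_iff)
    show ?thesis
      using 2 3 all_ones_cong[OF h, of z] by simp
  qed
  then show "\<exists>k. \<forall>z. conic_cone z \<noteq> 0 \<longrightarrow> h z = k" by blast
next
  fix d w
  assume "(d, w) \<in> {(2, \<lambda>i. if i = 2 \<or> i = 3 then 1 else if i = 4 then 2 else 0), (0::nat, \<lambda>i. if i = (5::nat) then 1 else (0::nat))}"
  then show "w 0 = 0 \<and> w 1 = 0 \<and> (\<forall>t z. conic_cone (\<lambda>i. t ^ w i * z i) = t ^ d *s (conic_cone z :: 'a ^ 4))"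
    by (auto simp: conic_cone_def vec_eq_iff forall_4 power2_eq_square)
next
  fix f :: "(nat \<Rightarrow> 'a) \<Rightarrow> 'a"
  assume f: "polyfun {..<6} f"
    and hom: "\<And>d w t z. (d, w) \<in> {(2, \<lambda>i. if i = 2 \<or> i = 3 then 1 else if i = 4 then 2 else 0), (0, \<lambda>i. if i = 5 then 1 else 0)}
       \<Longrightarrow> t \<noteq> 0 \<Longrightarrow> f (\<lambda>i. t ^ w i * z i) = t ^ d * f z"
  have h1: "f (\<lambda>i. t ^ (if i = 2 \<or> i = 3 then 1 else if i = 4 then 2 else 0) * z i) = t ^ 2 * f z" if "t \<noteq> 0" for t z
    using hom[of 2 "\<lambda>i. if i = 2 \<or> i = 3 then 1 else if i = 4 then 2 else 0" t z] that by simp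
  have h2: "f (z(5 := t)) = f (z(5 := 1))" if "t \<noteq> 0" for t z
  proof -
    have "(\<lambda>i. t ^ (if i = 5 then 1 else 0) * (z(5 := 1)) i) = z(5 := t)" by auto
    then show ?thesis using hom[of 0 "\<lambda>i. if i = 5 then 1 else 0" t "z(5 := 1)"] that by simp
  qed
  have h3: "f (z(5 := t)) = f (z(5 := 1))" for z t
  proof -
    have "\<exists>p. \<forall>t. (z(5 := t)) j = poly p t" for j
      by (cases "j = 5") (auto intro: exI[of _ "[:0, 1:]"] exI[of _ "[:z j:]"])
    then obtain p where p: "\<And>t. f (z(5 := t)) = poly p t"
      using polyfun_along_curve[OF f, of "\<lambda>t. z(5 := t)"] by blast
    have "p = [:f (z(5 := 1)):]"
      by (rule poly_eq_if_eq_nonzero) (use h2[of _ z] p in \<open>metis mult_zero_right add.right_neutral poly_0 poly_pCons\<close>)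
    then show ?thesis using p[of t] by simp
  qed
  define b where "b x y w z = f (z(2 := x, 3 := y, 4 := w, 5 := 0))" for x y w z
  have bp: "polyfun {0, 1} (b x y w)" for x y w
    unfolding b_def
    by (rule polyfun_subst[OF f], intro polyfun_upd)
      (auto simp: less_Suc_eq numeral_eq_Suc intro: polyfun_intros)
  define m where "m j = (if j = 1 then b 1 0 0 else if j = 2 then (\<lambda>z. b 1 1 0 z - b 1 0 0 z - b 0 1 0 z)
     else if j = 3 then b 0 1 0 else b 0 0 1)" for j :: 4
  have "f z = (\<Sum>j\<in>UNIV. m j z * conic_cone z $ j)" for z
  proof -
    have "\<exists>p q r d. \<forall>x y w. f ((z(5 := 0))(2 := x, 3 := y, 4 := w)) = p * x\<^sup>2 + q * x * y + r * y\<^sup>2 + d * w"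
    proof (rule weighted_homogeneous_degree_two[OF f])
      fix t x y w :: 'a assume "t \<noteq> 0"
      moreover have "(\<lambda>i. t ^ (if i = 2 \<or> i = 3 then 1 else if i = 4 then 2 else 0) * ((z(5 := 0))(2 := x, 3 := y, 4 := w)) i)
          = (z(5 := 0))(2 := t * x, 3 := t * y, 4 := t\<^sup>2 * w)"
        by auto
      ultimately show "f ((z(5 := 0))(2 := t * x, 3 := t * y, 4 := t\<^sup>2 * w)) = t\<^sup>2 * f ((z(5 := 0))(2 := x, 3 := y, 4 := w))"
        using h1[of t "(z(5 := 0))(2 := x, 3 := y, 4 := w)"] by simp
    qed auto
    then obtain p q r d where
      e: "\<And>x y w. f ((z(5 := 0))(2 := x, 3 := y, 4 := w)) = p * x\<^sup>2 + q * x * y + r * y\<^sup>2 + d * w"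
      by blast
    have "(z(5 := 0))(2 := x, 3 := y, 4 := w) = z(2 := x, 3 := y, 4 := w, 5 := 0)" for x y w by auto
    then have e': "b x y w z = p * x\<^sup>2 + q * x * y + r * y\<^sup>2 + d * w" for x y w
      using e by (simp add: b_def)
    have "z(2 := z 2, 3 := z 3, 4 := z 4, 5 := 0) = z(5 := 0)" by auto
    then have "f z = b (z 2) (z 3) (z 4) z"
      using h3[of z "z 5"] h3[of z 0] by (simp add: b_def)
    then show ?thesis
      by (simp add: sum_4 m_def e' conic_cone_def algebra_simps power2_eq_square)
  qed
  moreover have "polyfun {0, 1} (m j)" for j
    using bp by (auto simp: m_def intro!: polyfun_diff)
  ultimately show "\<exists>m. (\<forall>j. polyfun {0, 1} (m j)) \<and> (\<forall>z. f z = (\<Sum>j\<in>UNIV. m j z * conic_cone z $ j))"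
    by blast
next
  fix c :: "4 \<Rightarrow> 'a" and j
  assume c: "\<And>z. (\<Sum>j\<in>UNIV. c j * conic_cone z $ j) = 0"
  have s: "c 1 * (z 2)\<^sup>2 + c 2 * (z 2 * z 3) + c 3 * (z 3)\<^sup>2 + c 4 * z 4 = 0" for z :: "nat \<Rightarrow> 'a"
    using c[of z] by (simp add: sum_4 conic_cone_def)
  have "c 1 = 0" using s[of "\<lambda>i. if i = 2 then 1 else 0"] by simp
  moreover have "c 3 = 0" using s[of "\<lambda>i. if i = 3 then 1 else 0"] by simp
  moreover have "c 4 = 0" using s[of "\<lambda>i. if i = 4 then 1 else 0"] by simp
  moreover have "c 2 = 0" using s[of "\<lambda>i. if i = 2 \<or> i = 3 then 1 else 0"] calculation by simp
  ultimately show "c j = 0" using exhaust_4[of j] by auto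
next
  fix k :: 'a and z
  obtain r where r: "r ^ 2 = k" using nth_root_exists[of 2 k] by auto
  show "\<exists>z'. conic_cone z' = k *s conic_cone z"
    by (rule exI[of _ "z(2 := r * z 2, 3 := r * z 3, 4 := k * z 4)"])
      (simp add: conic_cone_def vec_eq_iff forall_4 r[symmetric] power2_eq_square)
qed

lemma sum_and_difference_zero:
  fixes a b :: "'a::field_char_0"
  assumes "a + b = 0" "a - b = 0"
  shows "a = 0" "b = 0"
proof -
  have "2 * a = (a + b) + (a - b)" by simp
  then show "a = 0" using assms by simp
  then show "b = 0" using assms by simp
qed

text \<open>
  As before, with test vectors that have entries \<open>0, 1, -1, 2\<close>.
\<close>

interpretation conic: param_quadric "conic_cone :: (nat \<Rightarrow> 'a::{alg_closed_field, field_char_0}) \<Rightarrow> _"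
  "{(2, \<lambda>i. if i = 2 \<or> i = 3 then 1 else if i = 4 then 2 else 0), (0, \<lambda>i. if i = 5 then 1 else 0)}" cone_form
proof
  show "transpose cone_form = (cone_form :: 'a ^ 4 ^ 4)" by (rule cone_form_sym)
  show "\<exists>i j. (cone_form :: 'a ^ 4 ^ 4) $ i $ j = 1"
    by (rule exI[of _ 1], rule exI[of _ 3]) (simp add: cone_form_def)
next
  fix x :: "'a ^ 4"
  have xx: "bil cone_form x x = 2 * (x $ 1 * x $ 3 - x $ 2 * x $ 2)"
    by (simp add: bil_cone_form algebra_simps)
  define zz where "zz a b c i = (if i = 2 then a else if i = 3 then b else c)"
    for a b c :: 'a and i :: nat
  have zz: "conic_cone (zz a b c) = vector [a\<^sup>2, a * b, b\<^sup>2, c]" for a b c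
    by (simp add: conic_cone_def zz_def)
  show "bil cone_form x x = 0 \<longleftrightarrow> (\<exists>z. x = conic_cone z)"
  proof
    assume "bil cone_form x x = 0"
    then have eq: "x $ 1 * x $ 3 = x $ 2 * x $ 2" by (simp add: xx)
    show "\<exists>z. x = conic_cone z"
    proof (cases "x $ 1 = 0")
      case False
      obtain r where r: "r\<^sup>2 = x $ 1" using nth_root_exists[of 2 "x $ 1"] by auto
      then have "r \<noteq> 0" using False by auto
      then have "x $ 3 = (x $ 2 / r)\<^sup>2"
        using eq by (simp add: power_divide power2_eq_square[of "x $ 2"] r False field_simps flip: eq)
      then have "x = conic_cone (zz r (x $ 2 / r) (x $ 4))"
        using \<open>r \<noteq> 0\<close> unfolding zz by (simp add: vec_eq_iff forall_4 r)
      then show ?thesis by (intro exI)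
    next
      case True
      obtain r where r: "r\<^sup>2 = x $ 3" using nth_root_exists[of 2 "x $ 3"] by auto
      have "x = conic_cone (zz 0 r (x $ 4))"
        using True eq unfolding zz by (simp add: vec_eq_iff forall_4 r)
      then show ?thesis by (intro exI)
    qed
  next
    assume "\<exists>z. x = conic_cone z"
    then show "bil cone_form x x = 0"
      by (auto simp: xx conic_cone_def power2_eq_square)
  qed
  fix C :: "'a ^ 4 ^ 4"
  assume C: "transpose C = C" and van: "\<And>z. bil C (conic_cone z) (conic_cone z) = 0"
  have s: "C $ i $ j = C $ j $ i" for i j
    using arg_cong[OF C, of "\<lambda>X. X $ j $ i"] by (simp add: transpose_def)
  note s' = s[of 2 1] s[of 3 1] s[of 4 1] s[of 3 2] s[of 4 2] s[of 4 3]
  have E: "bil C (vector [a\<^sup>2, a * b, b\<^sup>2, c]) (vector [a\<^sup>2, a * b, b\<^sup>2, c]) = 0" for a b c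
    using van[of "zz a b c"] by (simp add: zz)
  note E' = E[unfolded bil_def matrix_vector_mult_def sum_4 vec_lambda_beta vector_4]
  have 1: "C $ 1 $ 1 = 0" "C $ 3 $ 3 = 0" "C $ 4 $ 4 = 0"
    using E'[of 1 0 0] E'[of 0 1 0] E'[of 0 0 1] by simp_all
  have 2: "C $ 1 $ 4 = 0" "C $ 3 $ 4 = 0"
    using E'[of 1 0 1] E'[of 0 1 1] 1
    by (simp_all add: s' flip: mult_2)
  have p: "(C $ 2 $ 2 + 2 * C $ 1 $ 3) + 2 * (C $ 1 $ 2 + C $ 2 $ 3) = 0"
    using E'[of 1 1 0] 1 2 by (simp add: s' algebra_simps)
  have m: "(C $ 2 $ 2 + 2 * C $ 1 $ 3) - 2 * (C $ 1 $ 2 + C $ 2 $ 3) = 0"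
    using E'[of 1 "-1" 0] 1 2 by (simp add: s' algebra_simps)
  have A: "C $ 2 $ 2 + 2 * C $ 1 $ 3 = 0" and B: "2 * (C $ 1 $ 2 + C $ 2 $ 3) = 0"
    using sum_and_difference_zero[OF p m] by simp_all
  have 3: "C $ 2 $ 2 = - 2 * C $ 1 $ 3" using A by (simp add: add_eq_0_iff)
  have 4: "C $ 1 $ 2 = - C $ 2 $ 3" using B by (simp add: add_eq_0_iff)
  have 5: "C $ 2 $ 4 = 0"
    using E'[of 1 1 1] 1 2 3 4 by (simp add: s' algebra_simps)
  have "4 * (C $ 2 $ 2 + 2 * C $ 1 $ 3) + 4 * (C $ 1 $ 2 + 4 * C $ 2 $ 3) = 0"
    using E'[of 1 2 0] 1 2 by (simp add: s' algebra_simps)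
  then have 6: "C $ 2 $ 3 = 0" unfolding A 4 by simp
  have "bil C x y = C $ 1 $ 3 * bil cone_form x y" for x y
    unfolding bil_cone_form unfolding bil_def matrix_vector_mult_def sum_4 vec_lambda_beta
    by (simp add: 1 2 3 4 5 6 s' algebra_simps)
  then show "\<exists>k. \<forall>x y. bil C x y = k * bil cone_form x y" by blast
qed

lemma additive_poly_linear:
  fixes p :: "'a::field_char_0 poly"
  assumes "\<And>s t. poly p (s + t) = poly p s + poly p t"
  shows "poly p t = poly p 1 * t"
proof -
  have "poly p 0 = 0" using assms[of 0 0] by simp
  then have n: "poly p (of_nat n) = poly p 1 * of_nat n" for n
    by (induction n) (simp_all add: assms algebra_simps)
  let ?q = "p - [:0, poly p 1:]"
  have "range of_nat \<subseteq> {t. poly ?q t = 0}" by (auto simp: n mult.commute)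
  moreover have "infinite (range (of_nat :: nat \<Rightarrow> 'a))"
    by (simp add: range_inj_infinite inj_of_nat)
  ultimately have "?q = 0"
    using poly_roots_finite[of ?q] finite_subset by blast
  then have "poly ?q t = 0" by simp
  then show ?thesis by (simp add: mult.commute)
qed

lemma poly_degree_less_four:
  fixes p :: "'a::comm_ring_1 poly"
  assumes "degree p < 4"
  shows "poly p t = coeff p 0 + coeff p 1 * t + coeff p 2 * t\<^sup>2 + coeff p 3 * t ^ 3"
proof -
  have "poly p t = (\<Sum>i\<le>3. coeff p i * t ^ i)"
    unfolding poly_altdef
    by (rule sum.mono_neutral_left) (use assms in \<open>auto simp: coeff_eq_0\<close>)
  then show ?thesis by (simp add: numeral_3_eq_3 numeral_2_eq_2)
qed

text \<open>
  The values of \<open>u\<close> at the four points with coordinates \<open>0\<close> and \<open>1\<close> would have the invertible Gram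
  matrix \<open>split_form\<close>, but \<open>cone_form\<close> is degenerate.
\<close>

lemma cone_form_not_split:
  fixes u :: "'a::field ^ 2 \<Rightarrow> 'a ^ 4"
  assumes "\<And>g h. bil cone_form (u g) (u h) = (g $ 1 - h $ 1) * (g $ 2 - h $ 2)"
  shows False
proof -
  define h where "h j = (if j = 1 then vector [0, 0] else if j = 2 then vector [1, 0]
    else if j = 3 then vector [0, 1] else vector [1, 1] :: 'a ^ 2)" for j :: 4
  define U where "U = (\<chi> i j. u (h j) $ i)"
  have Ua: "U *v axis j 1 = u (h j)" for j
    by (simp add: vec_eq_iff matrix_vector_mult_def U_def axis_def if_distrib[of "\<lambda>x. _ * x"] cong: if_cong)
  have "bil (transpose U ** cone_form ** U) (axis i 1) (axis j 1) = split_form $ i $ j" for i j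
    unfolding bil_congruence Ua assms
    using exhaust_4[of i] exhaust_4[of j] by (elim disjE) (simp_all add: h_def split_form_def)
  then have G: "transpose U ** cone_form ** U = split_form"
    by (simp add: vec_eq_iff bil_axis)
  have "split_form ** split_form = (mat 1 :: 'a ^ 4 ^ 4)"
    by (simp add: split_form_def vec_eq_iff forall_4 matrix_matrix_mult_def sum_4 mat_def)
  then have "split_form ** transpose U ** cone_form ** U = mat 1"
    using G by (simp flip: matrix_mul_assoc)
  then have "U ** (split_form ** transpose U ** cone_form) = mat 1"
    by (rule matrix_left_right_inverse[THEN iffD1])
  moreover have "cone_form *v axis 4 1 = (0 :: 'a ^ 4)"
    by (simp add: cone_form_def vec_eq_iff forall_4 matrix_vector_mult_def sum_4 axis_def)
  ultimately have "axis 4 1 = (0 :: 'a ^ 4)"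
    using matrix_vector_mul_lid[of "axis 4 1 :: 'a ^ 4"]
    by (metis matrix_vector_mul_assoc matrix_vector_mult_0_right)
  then have "axis 4 1 $ 4 = (0 :: 'a ^ 4) $ 4" by simp
  then show False by (simp add: axis_def)
qed

lemma bil_cone_form_radical:
  assumes "\<And>y. bil cone_form x y = (0 :: 'a::field_char_0)"
  shows "x = x $ 4 *s axis 4 1"
  using assms[of "axis 1 1"] assms[of "axis 2 1"] assms[of "axis 3 1"]
  by (simp add: bil_cone_form axis_def vec_eq_iff forall_4)

text \<open>
  Isometries preserve the radical of the form, which is spanned by the vertex. The eigenvalue is a
  polynomial in \<open>g\<close> without zeros, and equals one at zero.
\<close>

lemma vertex_fixed:
  fixes M :: "'a::{alg_closed_field, field_char_0} ^ 2 \<Rightarrow> 'a ^ 4 ^ 4"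
  assumes M: "poly_matrix M" and M0: "M 0 = mat 1" and hom: "\<And>g h. M (g + h) = M g ** M h"
    and iso: "\<And>g x y. bil cone_form (M g *v x) (M g *v y) = bil cone_form x y"
  shows "M g *v axis 4 1 = axis 4 1"
proof -
  define k where "k g = (M g *v axis 4 1) $ 4" for g
  have k: "M g *v axis 4 1 = k g *s axis 4 1" for g
    unfolding k_def
  proof (rule bil_cone_form_radical)
    fix y
    have "M g ** M (- g) = mat 1" using hom[of g "- g"] M0 by simp
    then have "y = M g *v (M (- g) *v y)"
      by (simp add: matrix_vector_mul_assoc)
    then have "bil cone_form (M g *v axis 4 1) y = bil cone_form (axis 4 1) (M (- g) *v y)"
      by (metis iso)
    then show "bil cone_form (M g *v axis 4 1) y = 0" by (simp add: bil_cone_form axis_def)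
  qed
  have "M (g + h) *v axis 4 1 = (k g * k h) *s axis 4 1" for g h
    by (simp add: hom k vector_scalar_commute mult.commute flip: matrix_vector_mul_assoc)
  then have k_add: "k (g + h) = k g * k h" for g h
    by (simp add: k_def[of "g + h"] axis_def)
  have k0: "k 0 = 1" by (simp add: k_def M0 axis_def)
  define f where "f z = k (vector [z 0, z 1])" for z :: "nat \<Rightarrow> 'a"
  have "polyfun {0, 1} f"
    unfolding f_def k_def matrix_vector_mult_def vec_lambda_beta
    by (intro polyfun_sum polyfun_intros M[unfolded poly_matrix_def, rule_format])
  moreover have "f z \<noteq> 0" for z
    using k_add[of "vector [z 0, z 1]" "- vector [z 0, z 1]"] k0 by (auto simp: f_def)
  ultimately have "f (\<lambda>l. if l = 0 then g $ 1 else g $ 2) = f (\<lambda>_. 0)"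
    by (rule polyfun_nonvanishing_everywhere_const)
  moreover have "vector [0, 0] = (0 :: 'a ^ 2)"
    by (simp add: vec_eq_iff forall_2)
  ultimately have "k g = 1" by (simp add: f_def k0)
  then show ?thesis by (simp add: k)
qed

text \<open>
  The first three coordinates of the orbit are pairings and hence combinations of \<open>1, s, s\<^sup>2\<close>. The
  fourth is a cubic polynomial in \<open>s\<close> plus \<open>\<theta> t\<close>, because the \<open>t\<close>-direction preserves all pairings and
  so moves \<open>x\<^sub>0\<close> only by multiples of the vertex.
\<close>

lemma cone_normal_form:
  fixes M :: "'a::{alg_closed_field, field_char_0} ^ 2 \<Rightarrow> 'a ^ 4 ^ 4"
  assumes M: "poly_matrix M" "M 0 = mat 1" and hom: "\<And>g h. M (g + h) = M g ** M h"
    and iso: "\<And>g x y. bil cone_form (M g *v x) (M g *v y) = bil cone_form x y"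
    and x\<^sub>0: "bil cone_form x\<^sub>0 x\<^sub>0 = 0" and span: "vec.span (range (\<lambda>g. M g *v x\<^sub>0)) = UNIV"
    and open_direction: "\<forall>w. (\<forall>c. x\<^sub>0 + c *s w \<noteq> 0 \<and> bil cone_form (x\<^sub>0 + c *s w) (x\<^sub>0 + c *s w) = 0) \<longrightarrow>
       (\<exists>c g k. c \<noteq> 0 \<and> k \<noteq> 0 \<and> M g *v x\<^sub>0 = k *s (x\<^sub>0 + c *s w))"
  obtains e \<Phi> T k where "e \<in> {0, 1}" "invertible \<Phi>" "invertible T" "k \<noteq> 0"
    "\<And>x y. bil cone_form (\<Phi> *v x) (\<Phi> *v y) = k * bil cone_form x y"
    "\<And>h. \<Phi> ** cone_action e h = M (T *v h) ** \<Phi>"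
proof -
  obtain p q r where F0: "\<And>g h. bil cone_form (M g *v x\<^sub>0) (M h *v x\<^sub>0) =
    p * (g $ 1 - h $ 1)\<^sup>2 + q * (g $ 1 - h $ 1) * (g $ 2 - h $ 2) + r * (g $ 2 - h $ 2)\<^sup>2"
    by (rule orbit_form[OF M hom cone_form_sym iso x\<^sub>0]) blast
  obtain T :: "'a ^ 2 ^ 2" where T: "invertible T" and
    F: "(\<forall>g h. bil cone_form (M (T *v g) *v x\<^sub>0) (M (T *v h) *v x\<^sub>0) = (g $ 1 - h $ 1) * (g $ 2 - h $ 2)) \<or>
     (\<exists>k. \<forall>g h. bil cone_form (M (T *v g) *v x\<^sub>0) (M (T *v h) *v x\<^sub>0) = k * (g $ 1 - h $ 1)\<^sup>2)"
    by (rule transform_orbit_form[OF F0])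
  have surj: "surj ((*v) T)" if "invertible T" for T :: "'a ^ 2 ^ 2"
    using that by (auto simp: invertible_def matrix_right_invertible_surjective[symmetric])
  have range_u: "range (\<lambda>g. M (T *v g) *v x\<^sub>0) = range (\<lambda>g. M g *v x\<^sub>0)" if "invertible T" for T :: "'a ^ 2 ^ 2"
  proof -
    have "range (\<lambda>g. M g *v x\<^sub>0) = (\<lambda>g. M g *v x\<^sub>0) ` range ((*v) T)" using surj[OF that] by simp
    then show ?thesis by (simp add: image_image)
  qed
  define u where "u g = M (T *v g) *v x\<^sub>0" for g
  have span_u: "vec.span (range u) = UNIV"
    using span range_u[OF T] by (simp add: u_def[abs_def])
  have u_add: "u (g + h) = M (T *v g) *v u h" for g h
    by (simp add: u_def matrix_vector_right_distrib hom matrix_vector_mul_assoc)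
  have u0: "u 0 = x\<^sub>0" by (simp add: u_def M(2))
  obtain k where k: "\<And>g h. bil cone_form (u g) (u h) = k * (g $ 1 - h $ 1)\<^sup>2"
    using F cone_form_not_split[of u] unfolding u_def by blast
  have k0: "k \<noteq> 0"
  proof
    assume "k = 0"
    have "bil cone_form x y = 0 * bil cone_form x y" for x y :: "'a ^ 4"
      by (rule bil_proportional_on_span[OF span_u]) (auto simp: k \<open>k = 0\<close>)
    then have "bil cone_form (axis 1 1) (axis 3 1 :: 'a ^ 4) = 0" by simp
    then show False by (simp add: bil_cone_form axis_def)
  qed
  let ?e3 = "\<lambda>g :: 'a ^ 2. vector [1, g $ 1, (g $ 1)\<^sup>2] :: 'a ^ 3"
  have bu: "\<exists>a :: 'a ^ 3. \<forall>g. bil cone_form (u g) w = (\<Sum>i\<in>UNIV. a $ i * ?e3 g $ i)" for w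
  proof (rule orbit_coordinates[OF span_u])
    fix h
    show "\<exists>a :: 'a ^ 3. \<forall>g. bil cone_form (u g) (u h) = (\<Sum>i\<in>UNIV. a $ i * ?e3 g $ i)"
      by (rule exI[of _ "vector [k * (h $ 1)\<^sup>2, - 2 * k * h $ 1, k]"])
        (simp add: k sum_3 algebra_simps power2_eq_square)
  qed
  have "u g $ 1 = bil cone_form (u g) (axis 3 1)" "u g $ 2 = bil cone_form (u g) (axis 2 (- 1 / 2))"
    "u g $ 3 = bil cone_form (u g) (axis 1 1)" for g
    by (simp_all add: bil_cone_form axis_def)
  then have "\<exists>w. \<forall>g. u g $ i = bil cone_form (u g) w" if "i \<noteq> 4" for i
    using exhaust_4[of i] that by metis
  then have "\<exists>a :: 'a ^ 3. \<forall>g. u g $ i = (\<Sum>l\<in>UNIV. a $ l * ?e3 g $ l)" if "i \<noteq> 4" for i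
    using bu that by metis
  then obtain a :: "4 \<Rightarrow> 'a ^ 3" where a: "\<And>i g. i \<noteq> 4 \<Longrightarrow> u g $ i = (\<Sum>l\<in>UNIV. a i $ l * ?e3 g $ l)"
    by metis
  have vertex: "M g *v axis 4 1 = axis 4 1" for g
    by (rule vertex_fixed[OF M hom iso])
  have bv: "bil cone_form (axis 4 1) w = 0" and bv': "bil cone_form w (axis 4 1) = 0" for w :: "'a ^ 4"
    by (simp_all add: bil_cone_form axis_def)
  \<comment> \<open>Motion of the base point in the degenerate direction of the form: additive
    and polynomial, and therefore linear.\<close>
  define th where "th t = u (vector [0, t]) $ 4 - x\<^sub>0 $ 4" for t
  have u0t: "u (vector [0, t]) = x\<^sub>0 + th t *s axis 4 1" for t
  proof -
    have "bil cone_form (u (vector [0, t]) - x\<^sub>0) y = 0" for y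
    proof -
      have "y \<in> vec.span (range u)" using span_u by simp
      then show ?thesis
        by (rule vec.span_induct)
          (auto simp: vec.subspace_def bil_add_right bil_scale_right bil_diff_left k simp flip: u0)
    qed
    from bil_cone_form_radical[OF this] show ?thesis by (simp add: th_def algebra_simps)
  qed
  have th_add: "th (s + t) = th s + th t" for s t
  proof -
    have v: "vector [0, s + t] = (vector [0, s] + vector [0, t] :: 'a ^ 2)" by (simp add: vec_eq_iff forall_2)
    have "u (vector [0, s + t]) = M (T *v vector [0, s]) *v (x\<^sub>0 + th t *s axis 4 1)"
      unfolding v u_add u0t ..
    also have "\<dots> = u (vector [0, s]) + th t *s axis 4 1"
      by (simp add: matrix_vector_right_distrib vector_scalar_commute vertex u_def)
    finally show ?thesis by (simp add: th_def axis_def)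
  qed
  have th: "th t = th 1 * t" for t
  proof -
    obtain y where "\<And>i. degree (y i) < CARD(4)"
      and y: "\<And>t i. (M (t *s (T *v vector [0, 1])) *v x\<^sub>0) $ i = poly (y i) t"
      by (rule one_parameter_orbit_degree[OF M hom, of "T *v vector [0, 1]" x\<^sub>0]) (rule that)
    have "u (vector [0, t]) $ 4 = poly (y 4) t" for t
    proof -
      have "vector [0, t] = t *s (vector [0, 1] :: 'a ^ 2)" by (simp add: vec_eq_iff forall_2)
      then show ?thesis by (simp add: u_def y[symmetric] vector_scalar_commute)
    qed
    then have P: "th t = poly (y 4 - [:x\<^sub>0 $ 4:]) t" for t by (simp add: th_def)
    show ?thesis
      unfolding P by (rule additive_poly_linear) (simp only: th_add flip: P)
  qed
  \<comment> \<open>Openness of the orbit: it contains a point of the ruling through the base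
    point other than the base point itself, and the pairings show that only the degenerate
    direction leads there.\<close>
  have th1: "th 1 \<noteq> 0"
  proof -
    have bw: "bil cone_form (x\<^sub>0 + c *s axis 4 1) (u h) = k * (h $ 1)\<^sup>2" for c h
      using k[of 0 h] by (simp add: bil_add_left bil_scale_left bv u0)
    have "x\<^sub>0 + c *s axis 4 1 \<noteq> 0" for c
      using bw[of c "vector [1, 0]"] k0 by auto
    moreover have "bil cone_form (x\<^sub>0 + c *s axis 4 1) (x\<^sub>0 + c *s axis 4 1) = 0" for c :: 'a
      using x\<^sub>0 bv bv' by (simp add: bil_add_left bil_scale_left bil_add_right bil_scale_right)
    ultimately have "\<forall>c. x\<^sub>0 + c *s axis 4 1 \<noteq> 0 \<and> bil cone_form (x\<^sub>0 + c *s axis 4 1) (x\<^sub>0 + c *s axis 4 1) = 0"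
      by (intro allI conjI)
    with open_direction have "\<exists>c g l. c \<noteq> 0 \<and> l \<noteq> 0 \<and> M g *v x\<^sub>0 = l *s (x\<^sub>0 + c *s axis 4 1)"
      by (elim allE[of _ "axis 4 1"] impE)
    then obtain c g l where c: "c \<noteq> 0" and gl: "l \<noteq> 0" "M g *v x\<^sub>0 = l *s (x\<^sub>0 + c *s axis 4 1)"
      by (elim exE conjE)
    let ?w = "x\<^sub>0 + c *s axis 4 1"
    obtain g' where g': "g = T *v g'" using surjD[OF surj[OF T], of g] by (rule exE)
    then have ug: "u g' = l *s ?w" using gl by (simp add: u_def)
    have eq: "k * (g' $ 1 - h $ 1)\<^sup>2 = l * (k * (h $ 1)\<^sup>2)" for h :: "'a ^ 2"
      using k[of g' h, unfolded ug bil_scale_left bw] by (rule sym)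
    have g1: "g' $ 1 = 0" using eq[of 0] k0 by simp
    have "l = 1" using eq[of "vector [1, 0]"] g1 k0 by simp
    have "g' = vector [0, g' $ 2]" using g1 by (simp add: vec_eq_iff forall_2)
    then have "u g' = x\<^sub>0 + th (g' $ 2) *s axis 4 1" using u0t by metis
    then have "(u g') $ 4 = x\<^sub>0 $ 4 + th (g' $ 2)" by (simp add: axis_def)
    then have "th (g' $ 2) = c" using ug \<open>l = 1\<close> by (simp add: axis_def)
    then show ?thesis using th[of "g' $ 2"] c by auto
  qed
  obtain y where y: "\<And>i. degree (y i) < CARD(4)" "\<And>t i. (M (t *s (T *v vector [1, 0])) *v x\<^sub>0) $ i = poly (y i) t"
    by (rule one_parameter_orbit_degree[OF M hom, of "T *v vector [1, 0]" x\<^sub>0]) (rule that)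
  define c where "c = coeff (y 4)"
  have us0: "u (vector [s, 0]) $ 4 = c 0 + c 1 * s + c 2 * s\<^sup>2 + c 3 * s ^ 3" for s
  proof -
    have "vector [s, 0] = s *s (vector [1, 0] :: 'a ^ 2)" by (simp add: vec_eq_iff forall_2)
    then have "u (vector [s, 0]) $ 4 = poly (y 4) s"
      by (simp add: u_def y(2)[symmetric] vector_scalar_commute)
    then show ?thesis using poly_degree_less_four[of "y 4" s] y(1)[of 4] by (simp add: c_def)
  qed
  have u4: "u g $ 4 = c 0 + c 1 * g $ 1 + c 2 * (g $ 1)\<^sup>2 + c 3 * (g $ 1) ^ 3 + th 1 * g $ 2" for g
  proof -
    have v: "g = vector [g $ 1, 0] + vector [0, g $ 2]" by (simp add: vec_eq_iff forall_2)
    have "u g = M (T *v vector [g $ 1, 0]) *v (x\<^sub>0 + th (g $ 2) *s axis 4 1)"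
      by (subst v) (simp only: u_add u0t)
    also have "\<dots> = u (vector [g $ 1, 0]) + th (g $ 2) *s axis 4 1"
      by (simp add: matrix_vector_right_distrib vector_scalar_commute vertex u_def)
    finally show ?thesis using th[of "g $ 2"] by (simp add: us0 axis_def)
  qed
  \<comment> \<open>A cube root normalises the coefficient of the third power; the lower
    coefficients are absorbed in the intertwining matrix.\<close>
  obtain e l where e: "e \<in> {0, 1}" and l: "l \<noteq> 0" "c 3 * l ^ 3 = e"
  proof (cases "c 3 = 0")
    case True
    then show ?thesis using that[of 0 1] by simp
  next
    case False
    obtain l where l: "l ^ 3 = 1 / c 3" using nth_root_exists[of 3 "1 / c 3"] by auto
    have "l \<noteq> 0"
    proof
      assume "l = 0"
      then have "(0 :: 'a) = 1 / c 3" using l by simp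
      then show False using False by simp
    qed
    then show ?thesis using that[of 1 l] l False by simp
  qed
  define T' :: "'a ^ 2 ^ 2" where "T' = T ** vector [vector [l, 0], vector [0, 1 / th 1]]"
  have inv_T': "invertible T'"
    unfolding T'_def by (intro invertible_mult T mat2_invertible) (use l th1 in simp)
  have uT': "M (T' *v g) *v x\<^sub>0 = u (vector [l * g $ 1, g $ 2 / th 1])" for g
    by (simp add: T'_def u_def mat2_mult flip: matrix_vector_mul_assoc)
  define \<Phi> :: "'a ^ 4 ^ 4" where "\<Phi> = (\<chi> i. if i = 4 then vector [c 0, c 1 * l, c 2 * l\<^sup>2, 1]
    else vector [a i $ 1, a i $ 2 * l, a i $ 3 * l\<^sup>2, 0])"
  have \<Phi>: "M (T' *v g) *v x\<^sub>0 = \<Phi> *v cone_orbit e g" for g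
  proof -
    have "u (vector [l * g $ 1, g $ 2 / th 1]) $ i = (\<Phi> *v cone_orbit e g) $ i" for i
    proof (cases "i = 4")
      case True
      have "c 3 * (l * g $ 1) ^ 3 = e * g $ 1 ^ 3" by (simp add: power_mult_distrib l(2)[symmetric])
      then show ?thesis
        using True th1 by (simp add: u4 \<Phi>_def matrix_vector_mult_def sum_4 cone_orbit_def power_mult_distrib mult.assoc)
    next
      case False
      then show ?thesis
        by (simp add: a \<Phi>_def matrix_vector_mult_def sum_4 sum_3 cone_orbit_def power_mult_distrib mult.assoc)
    qed
    then show ?thesis by (simp add: uT' vec_eq_iff)
  qed
  have "vec.span (range (\<lambda>g. M (T' *v g) *v x\<^sub>0)) = UNIV"
    by (simp add: range_u[OF inv_T'] span)
  then have inv: "invertible \<Phi>" by (rule invertible_if_spanning) (rule \<Phi>)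
  have "bil (transpose \<Phi> ** cone_form ** \<Phi>) x y = (k * l\<^sup>2) * bil cone_form x y" for x y
  proof (rule bil_proportional_on_span[OF span_cone_orbit[of e]])
    fix x y assume "x \<in> range (cone_orbit e)" "y \<in> range (cone_orbit e)"
    then obtain g h where xy: "x = cone_orbit e g" "y = cone_orbit e h" by blast
    have "(l * g $ 1 - l * h $ 1)\<^sup>2 = l\<^sup>2 * (g $ 1 - h $ 1)\<^sup>2"
      by (simp add: power_mult_distrib flip: right_diff_distrib)
    then show "bil (transpose \<Phi> ** cone_form ** \<Phi>) x y = (k * l\<^sup>2) * bil cone_form x y"
      by (simp add: xy bil_congruence bil_cone_orbit uT' k flip: \<Phi>)
  qed
  then have form: "bil cone_form (\<Phi> *v x) (\<Phi> *v y) = (k * l\<^sup>2) * bil cone_form x y" for x y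
    by (simp add: bil_congruence)
  have "\<Phi> ** cone_action e h = M (T' *v h) ** \<Phi>" for h
    by (rule intertwining[OF span_cone_orbit cone_action_cone_orbit hom \<Phi>])
  then show ?thesis using that[OF e inv inv_T' _ form] k0 l by simp
qed

section \<open>Symmetric matrices up to congruence\<close>

definition orthonormal :: "'a::comm_ring_1 ^ 'n ^ 'n \<Rightarrow> (nat \<Rightarrow> 'a ^ 'n) \<Rightarrow> nat \<Rightarrow> bool" where
  "orthonormal A e r \<longleftrightarrow> (\<forall>i<r. \<forall>j<r. bil A (e i) (e j) = (if i = j then 1 else 0))"

lemma orthonormal_combination:
  fixes A :: "'a::field ^ 'n ^ 'n"
  assumes "orthonormal A e r" "j < r"
  shows "bil A (\<Sum>i<r. c i *s e i) (e j) = c j"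
proof -
  have "bil A (\<Sum>i<r. c i *s e i) (e j) = (\<Sum>i<r. if i = j then c i else 0)"
    unfolding bil_sum_left bil_scale_left
    by (rule sum.cong) (use assms in \<open>auto simp: orthonormal_def\<close>)
  then show ?thesis using assms(2) by simp
qed

lemma orthonormal_bound:
  fixes A :: "'a::field ^ 'n ^ 'n"
  assumes "orthonormal A e r"
  shows "r \<le> CARD('n)"
proof (rule ccontr)
  let ?n = "CARD('n)"
  assume r: "\<not> r \<le> ?n"
  obtain c where c: "\<exists>i\<le>?n. c i \<noteq> 0" and rel: "(\<Sum>i\<le>?n. c i *s e i) = 0"
    using linear_relation_exists[of ?n e] by auto
  have "orthonormal A e (Suc ?n)" using assms r by (auto simp: orthonormal_def)
  then have "c j = 0" if "j \<le> ?n" for j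
    using orthonormal_combination[of A e "Suc ?n" j c] rel that by (simp add: lessThan_Suc_atMost)
  then show False using c by blast
qed

text \<open>
  Take an orthonormal system of maximal length. A vector orthogonal to it is isotropic, as otherwise
  a multiple of it would extend the system; so the form vanishes on the orthogonal complement.
\<close>

lemma orthonormal_expansion_exists:
  fixes A :: "'a::{alg_closed_field, field_char_0} ^ 'n ^ 'n"
  assumes sym: "transpose A = A"
  obtains e r where "orthonormal A e r" "\<And>x y. bil A x y = (\<Sum>i<r. bil A x (e i) * bil A y (e i))"
proof -
  define has_system where "has_system r \<longleftrightarrow> (\<exists>e. orthonormal A e r)" for r
  have "has_system 0" by (simp add: has_system_def orthonormal_def)
  moreover have "\<forall>r. has_system r \<longrightarrow> r < Suc CARD('n)"
    using orthonormal_bound unfolding has_system_def less_Suc_eq_le by blast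
  ultimately have "\<exists>r. has_system r \<and> (\<forall>r'. has_system r' \<longrightarrow> r' \<le> r)"
    by (rule ex_has_greatest_nat)
  then obtain r where "has_system r" and max: "\<And>r'. has_system r' \<Longrightarrow> r' \<le> r" by blast
  then obtain e where e: "orthonormal A e r" unfolding has_system_def by (elim exE)
  define pr where "pr x = (\<Sum>i<r. bil A x (e i) *s e i)" for x
  have perp: "bil A (x - pr x) (e j) = 0" if "j < r" for x j
    using orthonormal_combination[OF e that] by (simp add: bil_diff_left pr_def)
  have iso: "bil A w w = 0" if w: "\<And>j. j < r \<Longrightarrow> bil A w (e j) = 0" for w
  proof (rule ccontr)
    assume nz: "bil A w w \<noteq> 0"
    obtain s where s: "s\<^sup>2 = bil A w w" using nth_root_exists[of 2 "bil A w w"] by auto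
    then have "s \<noteq> 0" using nz by auto
    let ?e = "e(r := (1 / s) *s w)"
    have ww: "bil A ((1 / s) *s w) ((1 / s) *s w) = 1"
      using \<open>s \<noteq> 0\<close> by (simp add: bil_scale_left bil_scale_right power2_eq_square flip: s)
    have we: "bil A ((1 / s) *s w) (e j) = 0" "bil A (e j) ((1 / s) *s w) = 0" if "j < r" for j
      using w[OF that] bil_sym[OF sym, of "e j" w] by (simp_all add: bil_scale_left bil_scale_right)
    have "orthonormal A ?e (Suc r)"
      using e ww we by (auto simp: orthonormal_def less_Suc_eq)
    then have "has_system (Suc r)" unfolding has_system_def by (intro exI)
    then show False using max[of "Suc r"] by simp
  qed
  have perp2: "bil A (x - pr x) (y - pr y) = 0" for x y
  proof -
    let ?x = "x - pr x" and ?y = "y - pr y"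
    have "bil A (?x + ?y) (?x + ?y) = 0"
      by (rule iso) (simp add: bil_add_left perp)
    then have "2 * bil A ?x ?y = 0"
      using iso[of ?x] iso[of ?y] perp bil_sym[OF sym, of ?y ?x]
      by (simp add: bil_add_left bil_add_right)
    then show ?thesis by simp
  qed
  show ?thesis
  proof (rule that[OF e])
    fix x y
    have prr: "bil A (pr x) y = (\<Sum>i<r. bil A x (e i) * bil A y (e i))" for x y
      unfolding pr_def bil_sum_left bil_scale_left by (simp add: bil_sym[OF sym, of _ y])
    have "bil A (x - pr x) (pr y) = 0"
      using perp prr[of y "x - pr x"] bil_sym[OF sym, of "x - pr x" "pr y"] by simp
    then have "bil A (x - pr x) y = 0"
      using perp2[of x y] bil_add_right[of A "x - pr x" "y - pr y" "pr y"] by simp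
    then show "bil A x y = (\<Sum>i<r. bil A x (e i) * bil A y (e i))"
      using prr[of x y] by (simp add: bil_diff_left)
  qed
qed

text \<open>
  The vectors \<open>A *v e j\<close> are a basis of the row space.
\<close>

lemma rank_orthonormal_expansion:
  fixes A :: "'a::field ^ 'n ^ 'n"
  assumes sym: "transpose A = A" and e: "orthonormal A e r"
    and exp: "\<And>x y. bil A x y = (\<Sum>i<r. bil A x (e i) * bil A y (e i))"
  shows "rank A = r"
proof -
  have bax: "bil A (axis i 1) y = (A *v y) $ i" for i y
    by (simp add: bil_def axis_def if_distrib[of "\<lambda>x. x * _"] cong: if_cong)
  have Ay: "A *v y = (\<Sum>j<r. bil A y (e j) *s (A *v e j))" for y
  proof -
    have "(A *v y) $ i = (\<Sum>j<r. bil A y (e j) *s (A *v e j)) $ i" for i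
      unfolding bax[symmetric] exp[of "axis i 1" y] by (simp add: bax mult.commute)
    then show ?thesis by (simp add: vec_eq_iff)
  qed
  let ?f = "\<lambda>j. A *v e j"
  have row: "row i A = A *v axis i 1" for i
  proof -
    have "A $ i $ j = A $ j $ i" for j
      using arg_cong[OF sym, of "\<lambda>X. X $ j $ i"] by (simp add: transpose_def)
    then show ?thesis
      by (simp add: vec_eq_iff row_def matrix_vector_mult_def axis_def if_distrib[of "\<lambda>x. _ * x"] cong: if_cong)
  qed
  have lin: "c k = 0" if "(\<Sum>j<r. c j *s ?f j) = 0" "k < r" for c k
  proof -
    have "A *v (\<Sum>j<r. c j *s e j) = (\<Sum>j<r. c j *s ?f j)"
      by (simp add: vec.sum vec.scale)
    then have "bil A (e k) (\<Sum>j<r. c j *s e j) = 0" using that by (simp add: bil_def)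
    then show ?thesis
      using orthonormal_combination[OF e that(2), of c] bil_sym[OF sym] by simp
  qed
  have inj: "inj_on ?f {..<r}"
  proof (rule inj_onI)
    fix i j assume ij: "i \<in> {..<r}" "j \<in> {..<r}" "?f i = ?f j"
    have "bil A (e i) (e i) = bil A (e i) (e j)" using ij by (simp add: bil_def)
    then show "i = j" using e ij by (auto simp: orthonormal_def split: if_splits)
  qed
  have ind: "vec.independent (?f ` {..<r})"
  proof
    assume "vec.dependent (?f ` {..<r})"
    then obtain u v where v: "v \<in> ?f ` {..<r}" "u v \<noteq> 0" and s: "(\<Sum>v\<in>?f ` {..<r}. u v *s v) = 0"
      using vec.dependent_finite[of "?f ` {..<r}"] by auto
    have "(\<Sum>j<r. u (?f j) *s ?f j) = 0"
      using s by (simp add: sum.reindex[OF inj])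
    from lin[of "\<lambda>j. u (?f j)", OF this] v show False by auto
  qed
  have "vec.span (rows A) = vec.span (?f ` {..<r})"
  proof
    have "row i A \<in> vec.span (?f ` {..<r})" for i
      unfolding row Ay[of "axis i 1"] by (intro vec.span_sum vec.span_scale vec.span_base) auto
    then show "vec.span (rows A) \<subseteq> vec.span (?f ` {..<r})"
      by (intro vec.span_minimal vec.subspace_span) (auto simp: rows_def)
    have "?f j \<in> vec.span (rows A)" for j
    proof -
      have "e j = (\<Sum>i\<in>UNIV. e j $ i *s axis i 1)"
        by (simp add: vec_eq_iff axis_def if_distrib[of "\<lambda>x. _ * x"] cong: if_cong)
      then have "?f j = (\<Sum>i\<in>UNIV. e j $ i *s (A *v axis i 1))"
        by (metis (no_types, lifting) vec.sum vec.scale sum.cong)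
      also have "\<dots> = (\<Sum>i\<in>UNIV. e j $ i *s row i A)" by (simp add: row)
      also have "\<dots> \<in> vec.span (rows A)"
        by (intro vec.span_sum vec.span_scale vec.span_base) (auto simp: rows_def)
      finally show ?thesis .
    qed
    then show "vec.span (?f ` {..<r}) \<subseteq> vec.span (rows A)"
      by (intro vec.span_minimal vec.subspace_span) auto
  qed
  then have "vec.dim (rows A) = card (?f ` {..<r})"
    using ind by (intro vec.dim_eq_card) auto
  then show ?thesis
    by (simp add: row_rank_def_gen card_image[OF inj])
qed

lemma invertible_if_trivial_kernel:
  fixes P :: "'a::field ^ 'n ^ 'n"
  assumes "\<And>x. P *v x = 0 \<Longrightarrow> x = 0"
  obtains P' where "P ** P' = mat 1" "P' ** P = mat 1"
proof -
  have "\<exists>B. B ** P = mat 1" using assms by (simp add: matrix_left_invertible_ker)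
  then obtain B where "B ** P = mat 1" by blast
  moreover then have "P ** B = mat 1" by (simp add: matrix_left_right_inverse)
  ultimately show ?thesis using that by blast
qed

lemma sum_lessThan_4: "(\<Sum>i<4. f i) = f 0 + f 1 + f 2 + f (3::nat)"
  and sum_lessThan_3: "(\<Sum>i<3. f i) = f 0 + f 1 + f (2::nat)"
  by (simp_all add: eval_nat_numeral)

text \<open>
  Two orthonormal vectors \<open>e, e'\<close> span a hyperbolic plane with isotropic basis \<open>e + i e'\<close>, \<open>e - i e'\<close>,
  where \<open>i\<^sup>2 = -1\<close>.
\<close>

lemma symmetric_rank_four:
  fixes A :: "'a::{alg_closed_field, field_char_0} ^ 4 ^ 4"
  assumes sym: "transpose A = A" and rank: "rank A = 4"
  obtains P P' where "P ** P' = mat 1" "P' ** P = mat 1"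
    "\<And>x y. bil A (P *v x) (P *v y) = 2 * bil split_form x y"
proof -
  obtain e r where e: "orthonormal A e r" and exp: "\<And>x y. bil A x y = (\<Sum>i<r. bil A x (e i) * bil A y (e i))"
    using orthonormal_expansion_exists[OF sym] by blast
  have r: "r = 4" using rank_orthonormal_expansion[OF sym e exp] rank by simp
  obtain i where i: "i\<^sup>2 = (- 1 :: 'a)" using nth_root_exists[of 2 "- 1 :: 'a"] by auto
  then have ii: "i * i = - 1" by (simp add: power2_eq_square)
  define P :: "'a ^ 4 ^ 4" where "P = (\<chi> k j. (if j = 1 then e 0 + i *s e 1 else if j = 2 then e 2 + i *s e 3
     else if j = 3 then i *s e 3 - e 2 else e 0 - i *s e 1) $ k)"
  have P: "P *v x = (x $ 1 + x $ 4) *s e 0 + (i * (x $ 1 - x $ 4)) *s e 1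
     + (x $ 2 - x $ 3) *s e 2 + (i * (x $ 2 + x $ 3)) *s e 3" for x
    by (simp add: P_def vec_eq_iff matrix_vector_mult_def sum_4 algebra_simps)
  have ee: "bil A (e k) (e l) = (if k = l then 1 else 0)" if "k < 4" "l < 4" for k l
    using e that by (simp add: orthonormal_def r)
  have Pe: "bil A (P *v x) (e 0) = x $ 1 + x $ 4" "bil A (P *v x) (e 1) = i * (x $ 1 - x $ 4)"
    "bil A (P *v x) (e 2) = x $ 2 - x $ 3" "bil A (P *v x) (e 3) = i * (x $ 2 + x $ 3)" for x
    unfolding P by (simp_all add: bil_add_left bil_diff_left bil_scale_left ee)
  have form: "bil A (P *v x) (P *v y) = 2 * bil split_form x y" for x y
  proof -
    have "bil A (P *v x) (P *v y) = (x $ 1 + x $ 4) * (y $ 1 + y $ 4)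
      + (i * i) * ((x $ 1 - x $ 4) * (y $ 1 - y $ 4))
      + (x $ 2 - x $ 3) * (y $ 2 - y $ 3) + (i * i) * ((x $ 2 + x $ 3) * (y $ 2 + y $ 3))"
      using exp[of "P *v x" "P *v y"] by (simp add: r sum_lessThan_4 Pe[unfolded One_nat_def] ac_simps)
    then show ?thesis unfolding ii bil_split_form by (simp add: algebra_simps)
  qed
  have ker: "x = 0" if "P *v x = 0" for x
  proof -
    have "bil split_form x y = 0" for y using form[of x y] that by simp
    from this[of "axis 1 1"] this[of "axis 2 1"] this[of "axis 3 1"] this[of "axis 4 1"]
    show ?thesis by (simp add: bil_split_form axis_def vec_eq_iff forall_4)
  qed
  obtain P' where "P ** P' = mat 1" "P' ** P = mat 1"
    by (rule invertible_if_trivial_kernel[of P]) (use ker in auto)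
  then show ?thesis by (rule that) (rule form)
qed

text \<open>
  A hyperbolic plane, a vector orthogonal to it, and a vector \<open>w\<close> of the radical.
\<close>

lemma symmetric_rank_three:
  fixes A :: "'a::{alg_closed_field, field_char_0} ^ 4 ^ 4"
  assumes sym: "transpose A = A" and rank: "rank A = 3"
  obtains P P' where "P ** P' = mat 1" "P' ** P = mat 1"
    "\<And>x y. bil A (P *v x) (P *v y) = 2 * bil cone_form x y"
proof -
  obtain e r where e: "orthonormal A e r" and exp: "\<And>x y. bil A x y = (\<Sum>i<r. bil A x (e i) * bil A y (e i))"
    using orthonormal_expansion_exists[OF sym] by blast
  have r: "r = 3" using rank_orthonormal_expansion[OF sym e exp] rank by simp
  obtain i where i: "i\<^sup>2 = (- 1 :: 'a)" using nth_root_exists[of 2 "- 1 :: 'a"] by auto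
  then have ii: "i * i = - 1" by (simp add: power2_eq_square)
  have ee: "bil A (e k) (e l) = (if k = l then 1 else 0)" if "k < 3" "l < 3" for k l
    using e that by (simp add: orthonormal_def r)
  have "vec.span (e ` {..<3}) \<noteq> UNIV"
  proof
    assume "vec.span (e ` {..<3}) = UNIV"
    then have "vec.dim (UNIV :: ('a ^ 4) set) \<le> card (e ` {..<3})"
      by (intro vec.dim_le_card) auto
    also have "\<dots> \<le> card {..<3::nat}" by (rule card_image_le) simp
    finally show False unfolding vec_dim_card by simp
  qed
  then obtain x0 where x0: "x0 \<notin> vec.span (e ` {..<3})" by blast
  define w where "w = x0 - (\<Sum>j<3. bil A x0 (e j) *s e j)"
  have "(\<Sum>j<3. bil A x0 (e j) *s e j) \<in> vec.span (e ` {..<3})"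
    by (intro vec.span_sum vec.span_scale vec.span_base) auto
  then have w0: "w \<noteq> 0" using x0 by (auto simp: w_def)
  have we: "bil A w (e j) = 0" if "j < 3" for j
    using orthonormal_combination[OF e, of j] that by (simp add: w_def bil_diff_left r)
  define P :: "'a ^ 4 ^ 4" where "P = (\<chi> k j. (if j = 1 then e 0 + i *s e 1 else if j = 2 then (2 * i) *s e 2
     else if j = 3 then e 0 - i *s e 1 else w) $ k)"
  have P: "P *v x = (x $ 1 + x $ 3) *s e 0 + (i * (x $ 1 - x $ 3)) *s e 1
     + (2 * i * x $ 2) *s e 2 + x $ 4 *s w" for x
    by (simp add: P_def vec_eq_iff matrix_vector_mult_def sum_4 algebra_simps)
  have Pe: "bil A (P *v x) (e 0) = x $ 1 + x $ 3" "bil A (P *v x) (e 1) = i * (x $ 1 - x $ 3)"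
    "bil A (P *v x) (e 2) = 2 * i * x $ 2" for x
    unfolding P by (simp_all add: bil_add_left bil_scale_left ee we)
  have form: "bil A (P *v x) (P *v y) = 2 * bil cone_form x y" for x y
  proof -
    have "bil A (P *v x) (P *v y) = (x $ 1 + x $ 3) * (y $ 1 + y $ 3)
      + (i * i) * ((x $ 1 - x $ 3) * (y $ 1 - y $ 3)) + (i * i) * (4 * x $ 2 * y $ 2)"
      using exp[of "P *v x" "P *v y"] by (simp add: r sum_lessThan_3 Pe[unfolded One_nat_def] ac_simps)
    then show ?thesis unfolding ii bil_cone_form by (simp add: algebra_simps)
  qed
  have ker: "x = 0" if Px: "P *v x = 0" for x
  proof -
    have "bil cone_form x y = 0" for y using form[of x y] Px by simp
    then have x: "x = x $ 4 *s axis 4 1" by (rule bil_cone_form_radical)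
    have xk: "x $ k = (x $ 4 *s axis 4 1) $ k" for k by (rule arg_cong[OF x])
    have c: "x $ 1 = 0" "x $ 2 = 0" "x $ 3 = 0"
      by (subst xk, simp add: axis_def)+
    then have "x $ 4 *s w = 0" using Px unfolding P by simp
    then have "x $ 4 = 0" using w0 by simp
    then show ?thesis using x by simp
  qed
  obtain P' where "P ** P' = mat 1" "P' ** P = mat 1"
    by (rule invertible_if_trivial_kernel[of P]) (use ker in auto)
  then show ?thesis by (rule that) (rule form)
qed

section \<open>Functions given by homogeneous polynomials\<close>

lemma mpoly_eval_superset:
  assumes "finite K" "Poly_Mapping.keys p \<subseteq> K"
  shows "mpoly_eval p x = (\<Sum>m\<in>K. Poly_Mapping.lookup p m * (\<Prod>i\<in>UNIV. x i ^ Poly_Mapping.lookup m i))"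
  unfolding mpoly_eval_def
  by (rule sum.mono_neutral_left) (use assms in \<open>auto simp: in_keys_iff\<close>)

lemma mpoly_eval_add: "mpoly_eval (p + q) x = mpoly_eval p x + mpoly_eval q x"
proof -
  let ?K = "Poly_Mapping.keys p \<union> Poly_Mapping.keys q"
  have "mpoly_eval r x = (\<Sum>m\<in>?K. Poly_Mapping.lookup r m * (\<Prod>i\<in>UNIV. x i ^ Poly_Mapping.lookup m i))"
    if "r \<in> {p, q, p + q}" for r
    by (rule mpoly_eval_superset) (use that Poly_Mapping.keys_add[of p q] in auto)
  then show ?thesis
    by (simp add: lookup_add algebra_simps sum.distrib)
qed

lemma mpoly_eval_zero [simp]: "mpoly_eval 0 x = 0"
  by (simp add: mpoly_eval_def)

lemma mpoly_eval_single: "mpoly_eval (Poly_Mapping.single m c) x = c * (\<Prod>i\<in>UNIV. x i ^ Poly_Mapping.lookup m i)"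
  by (cases "c = 0") (simp_all add: mpoly_eval_def)

lemma mpoly_eval_one [simp]: "mpoly_eval 1 x = 1"
  using mpoly_eval_single[of 0 1 x] by simp

lemma mpoly_induct [case_names zero add]:
  fixes p :: "('i, 'a::comm_ring_1) mpoly"
  assumes "P 0" and "\<And>m c p. P p \<Longrightarrow> P (Poly_Mapping.single m c + p)"
  shows "P p"
proof (induction p rule: update_induct)
  case const
  then show ?case using assms(1) by simp
next
  case (update f a b)
  have "Poly_Mapping.update a b f = Poly_Mapping.single a b + f"
    by (rule poly_mapping_eqI)
      (use update(1) in \<open>auto simp: lookup_update lookup_add lookup_single not_in_keys_iff_lookup_eq_zero when_def\<close>)
  then show ?case using assms(2) update by simp
qed

lemma mpoly_eval_mult: "mpoly_eval (p * q) x = mpoly_eval p x * mpoly_eval q x"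
proof (induction p rule: mpoly_induct)
  case (add m c p)
  have "mpoly_eval (Poly_Mapping.single m c * q) x = mpoly_eval (Poly_Mapping.single m c) x * mpoly_eval q x"
  proof (induction q rule: mpoly_induct)
    case (add m' c' q)
    then show ?case
      by (simp add: distrib_left mpoly_eval_add mult_single mpoly_eval_single lookup_add power_add prod.distrib ac_simps)
  qed simp
  then show ?case using add by (simp add: distrib_right mpoly_eval_add)
qed simp

text \<open>
  Regular maps are defined by polynomials as syntactic objects; this predicate provides them for
  functions built from sums and products.
\<close>

definition is_form :: "'i set \<Rightarrow> nat \<Rightarrow> (('i::finite \<Rightarrow> 'a::comm_ring_1) \<Rightarrow> 'a) \<Rightarrow> bool" where
  "is_form V d f \<longleftrightarrow> (\<exists>p. homogeneous V d p \<and> mpoly_eval p = f)"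

lemma is_form_const: "is_form V 0 (\<lambda>x. c)"
  unfolding is_form_def homogeneous_def
  by (rule exI[of _ "Poly_Mapping.single 0 c"]) (auto simp: mpoly_eval_single split: if_splits)

lemma is_form_var: "is_form V (if i \<in> V then 1 else 0) (\<lambda>x. x i)"
proof -
  have "(\<Prod>j\<in>UNIV. x j ^ (1 when i = j)) = (\<Prod>j\<in>UNIV. if j = i then x j else 1)" for x :: "'a \<Rightarrow> 'b"
    by (rule prod.cong) (auto simp: when_def)
  then show ?thesis
    unfolding is_form_def homogeneous_def
    by (intro exI[of _ "Poly_Mapping.single (Poly_Mapping.single i 1) 1"])
      (auto simp: mpoly_eval_single lookup_single when_def if_distrib[of "\<lambda>k. _ ^ k"] fun_eq_iff cong: if_cong)
qed

lemma is_form_var_in: "i \<in> V \<Longrightarrow> is_form V 1 (\<lambda>x. x i)"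
  and is_form_var_notin: "i \<notin> V \<Longrightarrow> is_form V 0 (\<lambda>x. x i)"
  using is_form_var[of V i] by simp_all

lemma is_form_add: "is_form V d f \<Longrightarrow> is_form V d g \<Longrightarrow> is_form V d (\<lambda>x. f x + g x)"
proof -
  assume "is_form V d f" "is_form V d g"
  then obtain p q where p: "homogeneous V d p" "mpoly_eval p = f" and q: "homogeneous V d q" "mpoly_eval q = g"
    unfolding is_form_def by blast
  have "homogeneous V d (p + q)"
    using p(1) q(1) Poly_Mapping.keys_add[of p q] unfolding homogeneous_def by blast
  moreover have "mpoly_eval (p + q) = (\<lambda>x. f x + g x)"
    using p q by (auto simp: mpoly_eval_add)
  ultimately show ?thesis unfolding is_form_def by blast
qed

lemma is_form_mult: "is_form V d f \<Longrightarrow> is_form V d' g \<Longrightarrow> is_form V (d + d') (\<lambda>x. f x * g x)"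
proof -
  assume "is_form V d f" "is_form V d' g"
  then obtain p q where p: "homogeneous V d p" "mpoly_eval p = f" and q: "homogeneous V d' q" "mpoly_eval q = g"
    unfolding is_form_def by blast
  have "homogeneous V (d + d') (p * q)"
    unfolding homogeneous_def
  proof
    fix m assume "m \<in> Poly_Mapping.keys (p * q)"
    then obtain a b where "m = a + b" "a \<in> Poly_Mapping.keys p" "b \<in> Poly_Mapping.keys q"
      using keys_mult[of p q] by blast
    then show "(\<Sum>i\<in>V. Poly_Mapping.lookup m i) = d + d'"
      using p(1) q(1) by (simp add: homogeneous_def lookup_add sum.distrib)
  qed
  moreover have "mpoly_eval (p * q) = (\<lambda>x. f x * g x)"
    using p q by (auto simp: mpoly_eval_mult)
  ultimately show ?thesis unfolding is_form_def by blast
qed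

lemma is_form_zero: "is_form V d (\<lambda>x. 0)"
  unfolding is_form_def homogeneous_def by (rule exI[of _ 0]) auto

lemma is_form_sum: "(\<And>i. i \<in> I \<Longrightarrow> is_form V d (f i)) \<Longrightarrow> is_form V d (\<lambda>x. \<Sum>i\<in>I. f i x)"
  by (induction I rule: infinite_finite_induct) (auto intro: is_form_zero is_form_add)

lemma is_form_scale: "is_form V d f \<Longrightarrow> is_form V d (\<lambda>x. c * f x)"
  using is_form_mult[OF is_form_const] by fastforce

lemma is_form_mult_0: "is_form V 0 f \<Longrightarrow> is_form V d g \<Longrightarrow> is_form V d (\<lambda>x. f x * g x)"
  using is_form_mult[of V 0 f d g] by simp

lemma is_form_matrix_vector:
  assumes "\<And>k. is_form V d (\<lambda>x. v x $ k)"
  shows "is_form V d (\<lambda>x. (B *v v x) $ i)"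
  unfolding matrix_vector_mult_def vec_lambda_beta by (intro is_form_sum is_form_scale assms)

lemma is_form_obtain:
  assumes "\<And>i. is_form V d (f i)"
  obtains F where "\<And>i. homogeneous V d (F i)" "\<And>i x. mpoly_eval (F i) x = f i x"
  using assms unfolding is_form_def by metis

section \<open>Linear equivalence of actions\<close>

lemma zariski_open_proj_space: "zariski_open (proj_space :: ('a::field ^ 'm) set set)"
  unfolding zariski_open_def
proof (intro exI conjI)
  let ?S = "{Poly_Mapping.single 0 1 :: ('m, 'a) mpoly}"
  show "\<forall>p\<in>?S. \<exists>d. homogeneous UNIV d p" by (auto simp: homogeneous_def)
  show "(proj_space :: ('a ^ 'm) set set) = proj_space - {L. \<forall>p\<in>?S. \<forall>v\<in>L. mpoly_eval p (($) v) = 0}"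
    by (auto simp: proj_space_def intro: line_self)
qed

lemma zariski_open_prod_proj_space: "zariski_open_prod (UNIV \<times> proj_space :: (('a::field ^ 'n) \<times> ('a ^ 'm) set) set)"
  unfolding zariski_open_prod_def
proof (intro exI conjI)
  let ?S = "{Poly_Mapping.single 0 1 :: ('n + 'm, 'a) mpoly}"
  show "\<forall>p\<in>?S. \<exists>d. homogeneous (range Inr) d p" by (auto simp: homogeneous_def)
  show "(UNIV \<times> proj_space :: (('a ^ 'n) \<times> ('a ^ 'm) set) set) = UNIV \<times> proj_space -
     {(g, L). \<forall>p\<in>?S. \<forall>v\<in>L. mpoly_eval p (case_sum (($) g) (($) v)) = 0}"
    by (auto simp: proj_space_def intro: line_self)
qed

lemma regular_map_linear:
  fixes B :: "'a::field ^ 'm ^ 'm"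
  assumes BB': "B' ** B = mat 1" and Q: "Q \<subseteq> proj_space"
    and f: "\<And>x. x \<in> Q \<Longrightarrow> f x = (*v) B ` x" and fQ: "f ` Q \<subseteq> Q"
  shows "regular_map Q Q f"
  unfolding regular_map_def
proof (intro conjI ballI)
  fix x assume x: "x \<in> Q"
  have "is_form UNIV 1 (\<lambda>x. (B *v (\<chi> k. x k)) $ i)" for i
    by (rule is_form_matrix_vector) (simp only: vec_lambda_beta, rule is_form_var_in, simp)
  then obtain F where F: "\<And>i. homogeneous UNIV 1 (F i)" "\<And>i x. mpoly_eval (F i) x = (B *v (\<chi> k. x k)) $ i"
    by (rule is_form_obtain[of UNIV 1 "\<lambda>i x. (B *v (\<chi> k. x k)) $ i"]) (rule that)
  have "(\<chi> i. mpoly_eval (F i) (($) v)) = B *v v" for v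
    by (simp add: vec_eq_iff F(2))
  then have "\<forall>v. v \<noteq> 0 \<and> line v \<in> Q \<inter> proj_space \<longrightarrow>
     (let w = (\<chi> i. mpoly_eval (F i) (($) v)) in w \<noteq> 0 \<and> f (line v) = line w)"
    using left_inverse_ker[OF BB'] f by (simp add: image_line)
  then show "\<exists>U. zariski_open U \<and> x \<in> U \<and>
       (\<exists>(F :: 'm \<Rightarrow> ('m, 'a) mpoly) d. (\<forall>i. homogeneous UNIV d (F i)) \<and>
         (\<forall>v. v \<noteq> 0 \<and> line v \<in> Q \<inter> U \<longrightarrow>
           (let w = (\<chi> i. mpoly_eval (F i) (($) v)) in w \<noteq> 0 \<and> f (line v) = line w)))"
    using zariski_open_proj_space Q x F(1) by (intro exI[of _ proj_space] conjI exI[of _ F] exI[of _ 1]) auto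
qed (rule fQ)

lemma image_eq_obtain: "f ` Q = Q \<Longrightarrow> x \<in> Q \<Longrightarrow> \<exists>y. y \<in> Q \<and> x = f y"
  and image_eq_mem: "f ` Q = Q \<Longrightarrow> x \<in> Q \<Longrightarrow> f x \<in> Q"
  by blast+

lemma image_inverse_matrix:
  fixes B B' :: "'a::field ^ 'n ^ 'n"
  assumes "B' ** B = mat 1"
  shows "(*v) B' ` (*v) B ` L = L"
  by (simp add: image_image matrix_vector_mul_assoc assms)

lemma regular_iso_linear:
  fixes B :: "'a::field ^ 'm ^ 'm"
  assumes B'B: "B' ** B = mat 1" and BB': "B ** B' = mat 1" and Q: "Q \<subseteq> proj_space"
    and BQ: "(\<lambda>L. (*v) B ` L) ` Q = Q"
  shows "regular_iso Q Q (\<lambda>L. (*v) B ` L)"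
proof -
  let ?f = "\<lambda>L. (*v) B ` L"
  have inj: "inj_on ?f Q"
    by (rule inj_on_inverseI[where g = "\<lambda>L. (*v) B' ` L"]) (rule image_inverse_matrix[OF B'B])
  have inv: "inv_into Q ?f x = (*v) B' ` x" if "x \<in> Q" for x
  proof -
    obtain y where y: "y \<in> Q" "x = (*v) B ` y"
      using image_eq_obtain[OF BQ \<open>x \<in> Q\<close>] by (elim exE conjE)
    then show ?thesis using inv_into_f_f[OF inj y(1)] image_inverse_matrix[OF B'B] by simp
  qed
  have "regular_map Q Q ?f"
    by (rule regular_map_linear[OF B'B Q]) (simp_all only: BQ subset_refl)
  moreover have "regular_map Q Q (inv_into Q ?f)"
  proof (rule regular_map_linear[OF BB' Q inv])
    show "inv_into Q ?f ` Q \<subseteq> Q"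
      using inv_into_into[of _ ?f Q] unfolding BQ by (rule image_subsetI)
  qed
  ultimately show ?thesis
    using inj by (simp only: regular_iso_def bij_betw_def BQ simp_thms)
qed

lemma vector_group_aut_linear:
  fixes T :: "'a::field ^ 'n ^ 'n"
  assumes T'T: "T' ** T = mat 1" and TT': "T ** T' = mat 1"
  shows "vector_group_aut ((*v) T)"
proof -
  have poly: "polynomial_map ((*v) S)" for S :: "'a ^ 'n ^ 'n"
  proof -
    have "is_form {} 0 (\<lambda>x. (S *v (\<chi> k. x k)) $ i)" for i
      by (rule is_form_matrix_vector) (simp only: vec_lambda_beta, rule is_form_var_notin, simp)
    then obtain F where "\<And>i. homogeneous {} 0 (F i)" "\<And>i x. mpoly_eval (F i) x = (S *v (\<chi> k. x k)) $ i"
      by (rule is_form_obtain[of "{}" 0 "\<lambda>i x. (S *v (\<chi> k. x k)) $ i"]) (rule that)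
    then show ?thesis
      unfolding polynomial_map_def by (intro exI[of _ F]) (simp add: vec_eq_iff)
  qed
  have "inv ((*v) T) = (*v) T'"
    by (rule inv_unique_comp) (auto simp: fun_eq_iff matrix_vector_mul_assoc T'T TT')
  moreover have "bij ((*v) T)"
    by (rule o_bij[of "(*v) T'"]) (auto simp: fun_eq_iff matrix_vector_mul_assoc T'T TT')
  ultimately show ?thesis
    by (simp add: vector_group_aut_def poly matrix_vector_right_distrib)
qed

text \<open>
  Equivalence by linear maps of the ambient space and of the group. All equivalences needed here are
  of this kind, and their composition is matrix multiplication.
\<close>

definition lin_equiv ::
  "('a::field ^ 'm) set set \<Rightarrow> ('a ^ 'n \<Rightarrow> ('a ^ 'm) set \<Rightarrow> ('a ^ 'm) set) \<Rightarrow>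
   ('a ^ 'n \<Rightarrow> ('a ^ 'm) set \<Rightarrow> ('a ^ 'm) set) \<Rightarrow> bool" where
  "lin_equiv Q \<alpha> \<beta> \<longleftrightarrow> (\<exists>B T. invertible B \<and> invertible T \<and> (\<lambda>L. (*v) B ` L) ` Q = Q \<and>
     (\<forall>g. \<forall>x\<in>Q. (*v) B ` \<alpha> g x = \<beta> (T *v g) ((*v) B ` x)))"

lemma lin_equiv_imp_equivalent:
  assumes "Q \<subseteq> proj_space" "lin_equiv Q \<alpha> \<beta>"
  shows "equivalent_actions Q \<alpha> Q \<beta>"
proof -
  obtain B T where B: "invertible B" and T: "invertible T" and BQ: "(\<lambda>L. (*v) B ` L) ` Q = Q"
    and eq: "\<forall>g. \<forall>x\<in>Q. (*v) B ` \<alpha> g x = \<beta> (T *v g) ((*v) B ` x)"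
    using assms(2) unfolding lin_equiv_def by (elim exE conjE)
  obtain B' where B': "B ** B' = mat 1" "B' ** B = mat 1" using B unfolding invertible_def by blast
  obtain T' where T': "T ** T' = mat 1" "T' ** T = mat 1" using T unfolding invertible_def by blast
  show ?thesis
    unfolding equivalent_actions_def
    by (intro exI conjI, rule regular_iso_linear[OF B'(2,1) assms(1) BQ],
        rule vector_group_aut_linear[OF T'(2,1)]) (rule eq)
qed

lemma lin_equiv_refl: "lin_equiv Q \<alpha> \<alpha>"
proof -
  have "invertible (mat 1 :: 'a::field ^ 'm ^ 'm)" "invertible (mat 1 :: 'a ^ 'n ^ 'n)"
    unfolding invertible_def by (auto intro: exI[of _ "mat 1"])
  then show ?thesis
    unfolding lin_equiv_def by (intro exI[of _ "mat 1"]) simp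
qed

lemma lin_equiv_sym:
  assumes "lin_equiv Q \<alpha> \<beta>" and pres: "\<And>g x. x \<in> Q \<Longrightarrow> \<alpha> g x \<in> Q"
  shows "lin_equiv Q \<beta> \<alpha>"
proof -
  obtain B T where B: "invertible B" and T: "invertible T" and BQ: "(\<lambda>L. (*v) B ` L) ` Q = Q"
    and eq0: "\<forall>g. \<forall>x\<in>Q. (*v) B ` \<alpha> g x = \<beta> (T *v g) ((*v) B ` x)"
    using assms(1) unfolding lin_equiv_def by (elim exE conjE)
  note eq = eq0[rule_format]
  obtain B' where B': "B ** B' = mat 1" "B' ** B = mat 1" using B unfolding invertible_def by blast
  obtain T' where T': "T ** T' = mat 1" "T' ** T = mat 1" using T unfolding invertible_def by blast
  have B'Q: "(\<lambda>L. (*v) B' ` L) ` Q = Q"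
  proof -
    have "(\<lambda>L. (*v) B' ` L) ` Q = (\<lambda>L. (*v) B' ` L) ` (\<lambda>L. (*v) B ` L) ` Q" using BQ by simp
    also have "\<dots> = Q" unfolding image_image[of "\<lambda>L. (*v) B' ` L"] image_inverse_matrix[OF B'(2)] by simp
    finally show ?thesis .
  qed
  have "(*v) B' ` \<beta> g x = \<alpha> (T' *v g) ((*v) B' ` x)" if x: "x \<in> Q" for g x
  proof -
    obtain y where y: "y \<in> Q" "x = (*v) B ` y"
      using image_eq_obtain[OF BQ x] by (elim exE conjE)
    have "\<beta> g x = (*v) B ` \<alpha> (T' *v g) y"
      using eq[OF y(1), of "T' *v g"] by (simp add: y matrix_vector_mul_assoc T')
    then show ?thesis by (simp only: y(2) image_inverse_matrix[OF B'(2)])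
  qed
  moreover have "invertible B'" "invertible T'" using B' T' unfolding invertible_def by blast+
  ultimately show ?thesis
    unfolding lin_equiv_def using B'Q by (intro exI[of _ B'] exI[of _ T'] conjI allI ballI)
qed

lemma lin_equiv_trans:
  assumes "lin_equiv Q \<alpha> \<beta>" "lin_equiv Q \<beta> \<gamma>"
  shows "lin_equiv Q \<alpha> \<gamma>"
proof -
  obtain B T where B: "invertible B" and T: "invertible T" and BQ: "(\<lambda>L. (*v) B ` L) ` Q = Q"
    and eq0: "\<forall>g. \<forall>x\<in>Q. (*v) B ` \<alpha> g x = \<beta> (T *v g) ((*v) B ` x)"
    using assms(1) unfolding lin_equiv_def by (elim exE conjE)
  obtain C S where C: "invertible C" and S: "invertible S" and CQ: "(\<lambda>L. (*v) C ` L) ` Q = Q"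
    and eq0': "\<forall>g. \<forall>x\<in>Q. (*v) C ` \<beta> g x = \<gamma> (S *v g) ((*v) C ` x)"
    using assms(2) unfolding lin_equiv_def by (elim exE conjE)
  note eq = eq0[rule_format] and eq' = eq0'[rule_format]
  have comp: "(*v) (C ** B) ` L = (*v) C ` (*v) B ` L" for L
    by (simp add: image_image matrix_vector_mul_assoc)
  have "(\<lambda>L. (*v) (C ** B) ` L) ` Q = (\<lambda>L. (*v) C ` L) ` (\<lambda>L. (*v) B ` L) ` Q"
    unfolding comp by (simp only: image_image)
  then have CBQ: "(\<lambda>L. (*v) (C ** B) ` L) ` Q = Q" by (simp only: BQ CQ)
  have "(*v) (C ** B) ` \<alpha> g x = \<gamma> ((S ** T) *v g) ((*v) (C ** B) ` x)" if x: "x \<in> Q" for g x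
  proof -
    have "(*v) B ` x \<in> Q" by (rule image_eq_mem[OF BQ x])
    then show ?thesis unfolding comp eq[OF x] by (simp add: eq' matrix_vector_mul_assoc)
  qed
  then show ?thesis
    unfolding lin_equiv_def using CBQ invertible_mult[OF C B] invertible_mult[OF S T]
    by (intro exI[of _ "C ** B"] exI[of _ "S ** T"] conjI allI ballI)
qed

lemma additive_action_preserves: "additive_action X \<alpha> \<Longrightarrow> x \<in> X \<Longrightarrow> \<alpha> g x \<in> X"
  by (auto simp: additive_action_def regular_map_prod_def)

lemma equivalent_if_lin_equiv_common:
  assumes Q: "Q \<subseteq> proj_space" and \<sigma>: "additive_action Q \<sigma>"
    and "lin_equiv Q \<sigma> \<alpha>" "lin_equiv Q \<sigma> \<beta>"
  shows "equivalent_actions Q \<alpha> Q \<beta>"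
proof -
  have "lin_equiv Q \<alpha> \<sigma>"
    by (rule lin_equiv_sym[OF assms(3)]) (rule additive_action_preserves[OF \<sigma>])
  then show ?thesis
    using lin_equiv_imp_equivalent[OF Q lin_equiv_trans] assms(4) by blast
qed

section \<open>The standard actions\<close>

text \<open>
  The quadric of \<open>A\<close>, in coordinates with respect to the columns of \<open>P\<close>.
\<close>

definition projective_quadric :: "'a::field ^ 'm ^ 'm \<Rightarrow> 'a ^ 'm ^ 'm \<Rightarrow> ('a ^ 'm) set set" where
  "projective_quadric P A = {line (P *v x) | x. x \<noteq> 0 \<and> bil A x x = 0}"

text \<open>
  The matrix \<open>P'\<close> is meant to be the inverse of \<open>P\<close>.
\<close>

definition matrix_action ::
  "'a::field ^ 'm ^ 'm \<Rightarrow> 'a ^ 'm ^ 'm \<Rightarrow> ('g \<Rightarrow> 'a ^ 'm ^ 'm) \<Rightarrow> 'g \<Rightarrow> ('a ^ 'm) set \<Rightarrow> ('a ^ 'm) set" where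
  "matrix_action P P' S g L = (*v) (P ** S g ** P') ` L"

lemma matrix_action_line:
  assumes "P' ** P = mat 1"
  shows "matrix_action P P' S g (line (P *v x)) = line (P *v (S g *v x))"
proof -
  have "P' *v (P *v x) = x" by (simp add: matrix_vector_mul_assoc assms)
  then show ?thesis
    unfolding matrix_action_def image_line by (simp flip: matrix_vector_mul_assoc)
qed

lemma projective_quadric_subset:
  assumes "P' ** P = mat 1"
  shows "projective_quadric P A \<subseteq> proj_space"
proof
  fix L assume "L \<in> projective_quadric P A"
  then obtain x where "x \<noteq> 0" "L = line (P *v x)" by (auto simp: projective_quadric_def)
  then show "L \<in> proj_space" using left_inverse_ker[OF assms, of x] by (auto simp: proj_space_def)
qed

text \<open>
  Matrices that translate a spanning orbit form a group action.
\<close>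

lemma hom_of_orbit:
  fixes S :: "'g::ab_group_add \<Rightarrow> 'a::field ^ 'n ^ 'n"
  assumes span: "vec.span (range orb) = UNIV" and orb: "\<And>h g. S h *v orb g = orb (h + g)"
  shows "S (g + h) = S g ** S h" "S 0 = mat 1"
proof -
  show "S (g + h) = S g ** S h"
    by (rule matrix_eq_on_span[OF span]) (auto simp: orb add.assoc simp flip: matrix_vector_mul_assoc)
  show "S 0 = mat 1"
    by (rule matrix_eq_on_span[OF span]) (auto simp: orb)
qed

text \<open>
  The orbit is the complement of the hyperplane where coordinate \<open>i0\<close> vanishes.
\<close>

lemma additive_action_matrix_action:
  fixes P P' :: "'a::field ^ 'm ^ 'm" and S :: "'a ^ 'n \<Rightarrow> 'a ^ 'm ^ 'm" and i0 :: 'm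
  assumes PP': "P ** P' = mat 1" and P'P: "P' ** P = mat 1"
    and S_form: "\<And>i j. is_form (range Inr) 0 (\<lambda>z :: 'n + 'm \<Rightarrow> 'a. S (\<chi> k. z (Inl k)) $ i $ j)"
    and span: "vec.span (range orb) = UNIV" and orb: "\<And>h g. S h *v orb g = orb (h + g)"
    and iso: "\<And>g h. bil A (orb g) (orb h) = f (g - h)" and f0: "f 0 = 0"
    and orb_1: "\<And>g. orb g $ i0 = 1"
    and dense: "\<And>x. bil A x x = 0 \<Longrightarrow> x $ i0 = 1 \<Longrightarrow> \<exists>g. x = orb g"
  shows "additive_action (projective_quadric P A) (matrix_action P P' S)"
proof -
  let ?Q = "projective_quadric P A" and ?\<beta> = "matrix_action P P' S"
  note hom = hom_of_orbit[OF span orb]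
  have isoS: "bil A (S g *v x) (S g *v y) = bil A x y" for g x y
  proof -
    have "bil (transpose (S g) ** A ** S g) x y = 1 * bil A x y"
      by (rule bil_proportional_on_span[OF span]) (auto simp: bil_congruence orb iso)
    then show ?thesis by (simp add: bil_congruence)
  qed
  have S_inv: "S (- g) ** S g = mat 1" for g
    using hom(1)[of "- g" g] hom(2) by simp
  have S0: "S g *v x \<noteq> 0" if "x \<noteq> 0" for g x
    using that left_inverse_ker[OF S_inv, of g x] by simp
  have P0: "P *v x = 0 \<longleftrightarrow> x = 0" and P'0: "P' *v x = 0 \<longleftrightarrow> x = 0" for x
    by (rule left_inverse_ker[OF P'P], rule left_inverse_ker[OF PP'])
  have act: "?\<beta> g (line (P *v x)) = line (P *v (S g *v x))" for g x
    by (rule matrix_action_line[OF P'P])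
  have QI: "line (P *v x) \<in> ?Q" if "x \<noteq> 0" "bil A x x = 0" for x
    using that by (auto simp: projective_quadric_def)
  have QE: "\<exists>x. x \<noteq> 0 \<and> bil A x x = 0 \<and> L = line (P *v x)" if "L \<in> ?Q" for L
    using that by (auto simp: projective_quadric_def)
  have pres: "?\<beta> g L \<in> ?Q" if L: "L \<in> ?Q" for g L
  proof -
    obtain x where "x \<noteq> 0" "bil A x x = 0" "L = line (P *v x)" using QE[OF L] by blast
    then show ?thesis using S0 isoS by (auto simp: act intro!: QI)
  qed
  have "regular_map_prod ?Q ?Q ?\<beta>"
    unfolding regular_map_prod_def
  proof (intro conjI allI ballI)
    show "?\<beta> g ` ?Q \<subseteq> ?Q" for g using pres by blast
    fix g0 x assume x: "x \<in> ?Q"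
    let ?v = "\<lambda>z :: 'n + 'm \<Rightarrow> 'a. \<chi> k. z (Inr k)" and ?g = "\<lambda>z :: 'n + 'm \<Rightarrow> 'a. \<chi> k. z (Inl k)"
    have v: "is_form (range Inr) 1 (\<lambda>z. (P' *v ?v z) $ k)" for k
      by (rule is_form_matrix_vector) (simp only: vec_lambda_beta, rule is_form_var_in, simp)
    have "is_form (range Inr) 1 (\<lambda>z. (S (?g z) *v (P' *v ?v z)) $ k)" for k
      unfolding matrix_vector_mult_def[of "S _"] vec_lambda_beta[of "\<lambda>i. \<Sum>j\<in>UNIV. S _ $ i $ j * _ j"]
      by (intro is_form_sum is_form_mult_0 S_form v)
    then have "is_form (range Inr) 1 (\<lambda>z. (P *v (S (?g z) *v (P' *v ?v z))) $ k)" for k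
      by (rule is_form_matrix_vector)
    then obtain F where F: "\<And>i. homogeneous (range Inr) 1 (F i)"
      "\<And>i z. mpoly_eval (F i) z = (P *v (S (?g z) *v (P' *v ?v z))) $ i"
      by (rule is_form_obtain[of "range Inr" 1 "\<lambda>k z. (P *v (S (?g z) *v (P' *v ?v z))) $ k"]) (rule that)
    have "(\<chi> i. mpoly_eval (F i) (case_sum (($) g) (($) v))) = (P ** S g ** P') *v v" for g v
      by (simp add: vec_eq_iff F(2) flip: matrix_vector_mul_assoc)
    moreover have "(P ** S g ** P') *v v \<noteq> 0" if "v \<noteq> 0" for g v
      using that S0 by (simp add: P0 P'0 flip: matrix_vector_mul_assoc)
    ultimately have rep: "\<forall>g v. v \<noteq> 0 \<and> line v \<in> ?Q \<and> (g, line v) \<in> UNIV \<times> proj_space \<longrightarrow>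
           (let w = (\<chi> i. mpoly_eval (F i) (case_sum (($) g) (($) v)))
            in w \<noteq> 0 \<and> ?\<beta> g (line v) = line w)"
      by (simp add: matrix_action_def image_line)
    show "\<exists>U. zariski_open_prod U \<and> (g0, x) \<in> U \<and>
       (\<exists>(F :: 'm \<Rightarrow> ('n + 'm, 'a) mpoly) d. (\<forall>i. homogeneous (range Inr) d (F i)) \<and>
         (\<forall>g v. v \<noteq> 0 \<and> line v \<in> ?Q \<and> (g, line v) \<in> U \<longrightarrow>
           (let w = (\<chi> i. mpoly_eval (F i) (case_sum (($) g) (($) v)))
            in w \<noteq> 0 \<and> ?\<beta> g (line v) = line w)))"
      using zariski_open_prod_proj_space projective_quadric_subset[OF P'P, of A] x F(1) rep
      by (intro exI[of _ "UNIV \<times> proj_space"] conjI exI[of _ F] exI[of _ 1]) auto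
  qed
  moreover have "?\<beta> 0 x = x" for x
    by (simp add: matrix_action_def hom PP')
  moreover have "?\<beta> (g + h) x = ?\<beta> g (?\<beta> h x)" for g h x
  proof -
    have "P' *v (P *v v) = v" for v by (simp add: matrix_vector_mul_assoc P'P)
    then show ?thesis
      by (simp add: matrix_action_def hom image_image flip: matrix_vector_mul_assoc)
  qed
  moreover have "\<exists>x\<in>?Q. \<exists>U. zariski_open U \<and> range (\<lambda>g. ?\<beta> g x) = ?Q \<inter> U"
  proof -
    have orb0: "orb g \<noteq> 0" for g using orb_1[of g] by auto
    have Qorb: "line (P *v orb g) \<in> ?Q" for g
      by (rule QI[OF orb0]) (simp add: iso f0)
    have "is_form UNIV 1 (\<lambda>x. (P' *v (\<chi> k. x k)) $ i0)"
      by (rule is_form_matrix_vector) (simp only: vec_lambda_beta, rule is_form_var_in, simp)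
    then obtain p where p: "homogeneous UNIV 1 p" "\<And>x. mpoly_eval p x = (P' *v (\<chi> k. x k)) $ i0"
      unfolding is_form_def by metis
    define U where "U = proj_space - {L. \<forall>p\<in>{p}. \<forall>v\<in>L. mpoly_eval p (($) v) = 0}"
    have "zariski_open U" unfolding zariski_open_def U_def using p(1) by blast
    moreover have U: "line (P *v x) \<in> U \<longleftrightarrow> x $ i0 \<noteq> 0" if "x \<noteq> 0" for x
    proof -
      have pe: "mpoly_eval p (($) (k *s (P *v x))) = k * x $ i0" for k
        by (simp add: p(2) vector_scalar_commute[symmetric] matrix_vector_mul_assoc P'P)
      have "line (P *v x) \<in> proj_space" using that by (auto simp: proj_space_def P0)
      moreover have "(\<forall>v\<in>line (P *v x). mpoly_eval p (($) v) = 0) \<longleftrightarrow> x $ i0 = 0"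
      proof
        assume "\<forall>v\<in>line (P *v x). mpoly_eval p (($) v) = 0"
        then have "mpoly_eval p (($) (P *v x)) = 0" by (rule bspec) (rule line_self)
        then show "x $ i0 = 0" using pe[of 1] by simp
      qed (auto simp: mem_line pe)
      ultimately show ?thesis by (simp add: U_def)
    qed
    moreover have "range (\<lambda>g. ?\<beta> g (line (P *v orb 0))) = ?Q \<inter> U"
    proof
      show "range (\<lambda>g. ?\<beta> g (line (P *v orb 0))) \<subseteq> ?Q \<inter> U"
        using Qorb U[OF orb0] orb_1 by (auto simp: act orb)
      show "?Q \<inter> U \<subseteq> range (\<lambda>g. ?\<beta> g (line (P *v orb 0)))"
      proof
        fix L assume L: "L \<in> ?Q \<inter> U"
        then obtain x where x: "x \<noteq> 0" "bil A x x = 0" "L = line (P *v x)" using QE by blast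
        then have x1: "x $ i0 \<noteq> 0" using L U by simp
        obtain g where g: "(1 / x $ i0) *s x = orb g"
          using dense[of "(1 / x $ i0) *s x"] x x1 by (auto simp: bil_scale_left bil_scale_right)
        have "L = line ((1 / x $ i0) *s (P *v x))"
          unfolding x(3) using x1 by (intro line_scale[symmetric]) simp
        also have "\<dots> = line (P *v orb g)" by (simp add: vector_scalar_commute flip: g)
        also have "\<dots> = ?\<beta> g (line (P *v orb 0))" by (simp add: act orb)
        finally show "L \<in> range (\<lambda>g. ?\<beta> g (line (P *v orb 0)))" by (rule range_eqI)
      qed
    qed
    ultimately show ?thesis using Qorb[of 0] by (intro bexI exI conjI)
  qed
  ultimately show ?thesis unfolding additive_action_def by (intro conjI allI ballI)
qed

text \<open>
  A matrix that intertwines two actions in coordinates, and preserves the form up to a factor,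
  defines an equivalence.
\<close>

lemma lin_equiv_standard:
  fixes P P' :: "'a::field ^ 'm ^ 'm" and S :: "'a ^ 'n \<Rightarrow> 'a ^ 'm ^ 'm"
  assumes PP': "P ** P' = mat 1" and P'P: "P' ** P = mat 1"
    and \<Phi>: "invertible \<Phi>" and T: "invertible T"
    and form: "\<And>x y. bil A (\<Phi> *v x) (\<Phi> *v y) = k * bil A x y" and k: "k \<noteq> 0"
    and intertwine: "\<And>h. \<Phi> ** S h = M (T *v h) ** \<Phi>"
    and \<alpha>: "\<And>g x. bil A x x = 0 \<Longrightarrow> x \<noteq> 0 \<Longrightarrow> \<alpha> g (line (P *v x)) = line (P *v (M g *v x))"
  shows "lin_equiv (projective_quadric P A) (matrix_action P P' S) \<alpha>"
proof -
  let ?Q = "projective_quadric P A"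
  define B where "B = P ** \<Phi> ** P'"
  have P'Pv: "P' *v (P *v v) = v" for v by (simp add: matrix_vector_mul_assoc P'P)
  have BP: "(*v) B ` line (P *v x) = line (P *v (\<Phi> *v x))" for x
    unfolding B_def image_line by (simp add: P'Pv flip: matrix_vector_mul_assoc)
  obtain \<Phi>' where \<Phi>': "\<Phi> ** \<Phi>' = mat 1" "\<Phi>' ** \<Phi> = mat 1" using \<Phi> unfolding invertible_def by blast
  have \<Phi>0: "\<Phi> *v x = 0 \<longleftrightarrow> x = 0" and \<Phi>'0: "\<Phi>' *v x = 0 \<longleftrightarrow> x = 0" for x
    by (rule left_inverse_ker[OF \<Phi>'(2)], rule left_inverse_ker[OF \<Phi>'(1)])
  have \<Phi>\<Phi>': "\<Phi> *v (\<Phi>' *v x) = x" for x by (simp add: matrix_vector_mul_assoc \<Phi>')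
  have "invertible P" "invertible P'" using PP' P'P unfolding invertible_def by blast+
  then have "invertible B" unfolding B_def by (intro invertible_mult \<Phi>)
  moreover have "(\<lambda>L. (*v) B ` L) ` ?Q = ?Q"
  proof
    show "(\<lambda>L. (*v) B ` L) ` ?Q \<subseteq> ?Q"
    proof (rule image_subsetI)
      fix L assume "L \<in> ?Q"
      then obtain x where x: "x \<noteq> 0" "bil A x x = 0" "L = line (P *v x)" by (auto simp: projective_quadric_def)
      then have "\<Phi> *v x \<noteq> 0" "bil A (\<Phi> *v x) (\<Phi> *v x) = 0" by (simp_all add: \<Phi>0 form)
      then show "(*v) B ` L \<in> ?Q" unfolding x(3) BP projective_quadric_def by blast
    qed
    show "?Q \<subseteq> (\<lambda>L. (*v) B ` L) ` ?Q"
    proof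
      fix L assume "L \<in> ?Q"
      then obtain x where x: "x \<noteq> 0" "bil A x x = 0" "L = line (P *v x)" by (auto simp: projective_quadric_def)
      have "bil A (\<Phi>' *v x) (\<Phi>' *v x) = 0"
        using form[of "\<Phi>' *v x" "\<Phi>' *v x"] k x by (simp add: \<Phi>\<Phi>')
      then have "line (P *v (\<Phi>' *v x)) \<in> ?Q" using x \<Phi>'0 unfolding projective_quadric_def by blast
      moreover have "L = (*v) B ` line (P *v (\<Phi>' *v x))" by (simp add: BP \<Phi>\<Phi>' x)
      ultimately show "L \<in> (\<lambda>L. (*v) B ` L) ` ?Q" by blast
    qed
  qed
  moreover have "(*v) B ` matrix_action P P' S g L = \<alpha> (T *v g) ((*v) B ` L)" if L: "L \<in> ?Q" for g L
  proof -
    obtain x where x: "x \<noteq> 0" "bil A x x = 0" "L = line (P *v x)" using L by (auto simp: projective_quadric_def)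
    have "(*v) B ` matrix_action P P' S g L = line (P *v ((\<Phi> ** S g) *v x))"
      by (simp add: x matrix_action_line[OF P'P] BP flip: matrix_vector_mul_assoc)
    also have "\<dots> = line (P *v (M (T *v g) *v (\<Phi> *v x)))"
      unfolding intertwine by (simp add: matrix_vector_mul_assoc)
    also have "\<dots> = \<alpha> (T *v g) ((*v) B ` L)"
      using x form \<Phi>0 by (simp add: BP \<alpha>)
    finally show ?thesis .
  qed
  ultimately show ?thesis
    unfolding lin_equiv_def using T by (intro exI[of _ B] exI[of _ T] conjI allI ballI)
qed

lemma split_action_polynomial: "is_form (range Inr) 0 (\<lambda>z :: 2 + 'm::finite \<Rightarrow> 'a::field. split_action (\<chi> k. z (Inl k)) $ i $ j)"
proof -
  have v: "is_form (range Inr) 0 (\<lambda>z :: 2 + 'm \<Rightarrow> 'a. z (Inl k))" for k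
    by (rule is_form_var_notin) auto
  show ?thesis
    using exhaust_4[of i] exhaust_4[of j]
    by (elim disjE) (simp_all add: split_action_def is_form_const v is_form_mult_0)
qed

lemma cone_action_polynomial: "is_form (range Inr) 0 (\<lambda>z :: 2 + 'm::finite \<Rightarrow> 'a::field. cone_action e (\<chi> k. z (Inl k)) $ i $ j)"
proof -
  have v: "is_form (range Inr) 0 (\<lambda>z :: 2 + 'm \<Rightarrow> 'a. z (Inl k))" for k
    by (rule is_form_var_notin) auto
  note intros = is_form_const v is_form_mult_0 is_form_add
  show ?thesis
    using exhaust_4[of i] exhaust_4[of j]
    by (elim disjE) (simp_all add: cone_action_def power2_eq_square power3_eq_cube intros)
qed

lemma additive_split_action:
  fixes P P' :: "'a::field_char_0 ^ 4 ^ 4"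
  assumes "P ** P' = mat 1" "P' ** P = mat 1"
  shows "additive_action (projective_quadric P split_form) (matrix_action P P' split_action)"
proof (rule additive_action_matrix_action[OF assms split_action_polynomial span_split_orbit split_action_split_orbit])
  show "bil split_form (split_orbit g) (split_orbit h) = (g - h) $ 1 * (g - h) $ 2" for g h :: "'a ^ 2"
    by (simp add: bil_split_orbit)
  show "split_orbit g $ 1 = (1 :: 'a)" for g by (simp add: split_orbit_def)
  show "\<exists>g. x = split_orbit g" if x: "bil split_form x x = 0" "x $ 1 = 1" for x :: "'a ^ 4"
  proof -
    have "2 * (x $ 4 - x $ 2 * x $ 3) = 0"
      using x by (simp add: bil_split_form algebra_simps)
    then have "x $ 4 = x $ 2 * x $ 3" by simp
    then have "x = split_orbit (vector [x $ 2, x $ 3])"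
      using x(2) by (simp add: split_orbit_def vec_eq_iff forall_4)
    then show ?thesis by (intro exI)
  qed
qed auto

lemma additive_cone_action:
  fixes P P' :: "'a::field_char_0 ^ 4 ^ 4"
  assumes "P ** P' = mat 1" "P' ** P = mat 1"
  shows "additive_action (projective_quadric P cone_form) (matrix_action P P' (cone_action e))"
proof (rule additive_action_matrix_action[OF assms cone_action_polynomial span_cone_orbit cone_action_cone_orbit])
  show "bil cone_form (cone_orbit e g) (cone_orbit e h) = ((g - h) $ 1)\<^sup>2" for g h :: "'a ^ 2"
    by (simp add: bil_cone_orbit)
  show "cone_orbit e g $ 1 = (1 :: 'a)" for g by (simp add: cone_orbit_def)
  show "\<exists>g. x = cone_orbit e g" if x: "bil cone_form x x = 0" "x $ 1 = 1" for x :: "'a ^ 4"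
  proof -
    have "2 * (x $ 3 - (x $ 2)\<^sup>2) = 0"
      using x by (simp add: bil_cone_form power2_eq_square algebra_simps)
    then have "x $ 3 = (x $ 2)\<^sup>2" by simp
    then have "x = cone_orbit e (vector [x $ 2, x $ 4 - e * (x $ 2) ^ 3])"
      using x(2) by (simp add: cone_orbit_def vec_eq_iff forall_4)
    then show ?thesis by (intro exI)
  qed
qed auto

section \<open>Fixed points\<close>

definition fixed_points :: "'x set \<Rightarrow> ('g \<Rightarrow> 'x \<Rightarrow> 'x) \<Rightarrow> 'x set" where
  "fixed_points X \<alpha> = {x \<in> X. \<forall>g. \<alpha> g x = x}"

text \<open>
  An equivariant bijection maps fixed points onto fixed points, as automorphisms of the group are
  surjective. This separates classes with respect to arbitrary isomorphisms of the quadric.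
\<close>

lemma equivalent_actions_fixed_points:
  assumes eq: "equivalent_actions X \<alpha> Y \<beta>" and pres: "\<And>g x. x \<in> X \<Longrightarrow> \<alpha> g x \<in> X"
  obtains \<phi> where "bij_betw \<phi> (fixed_points X \<alpha>) (fixed_points Y \<beta>)"
proof -
  obtain \<phi> \<psi> where iso: "regular_iso X Y \<phi>" and aut: "vector_group_aut \<psi>"
    and eqv: "\<And>g x. x \<in> X \<Longrightarrow> \<phi> (\<alpha> g x) = \<beta> (\<psi> g) (\<phi> x)"
    using eq unfolding equivalent_actions_def by blast
  have bij: "bij_betw \<phi> X Y" using iso by (simp add: regular_iso_def)
  have surj: "surj \<psi>" using aut by (simp add: vector_group_aut_def bij_def)
  have "x \<in> fixed_points X \<alpha> \<longleftrightarrow> \<phi> x \<in> fixed_points Y \<beta>" if x: "x \<in> X" for x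
  proof -
    have "(\<forall>g. \<alpha> g x = x) \<longleftrightarrow> (\<forall>g. \<phi> (\<alpha> g x) = \<phi> x)"
      using x pres bij by (metis bij_betw_def inj_onD)
    also have "\<dots> \<longleftrightarrow> (\<forall>g. \<beta> g (\<phi> x) = \<phi> x)"
      unfolding eqv[OF x] using surj by (metis surjD)
    finally show ?thesis
      using x bij by (auto simp: fixed_points_def bij_betw_def)
  qed
  then have "\<phi> ` fixed_points X \<alpha> = fixed_points Y \<beta>"
    using bij by (auto simp: fixed_points_def bij_betw_def image_iff) blast
  moreover have "inj_on \<phi> (fixed_points X \<alpha>)"
    using bij by (auto simp: fixed_points_def bij_betw_def intro: inj_on_subset)
  ultimately show ?thesis using that by (simp add: bij_betw_def)
qed

definition many_fixed_points :: "'x set \<Rightarrow> ('g \<Rightarrow> 'x \<Rightarrow> 'x) \<Rightarrow> bool" where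
  "many_fixed_points X \<alpha> \<longleftrightarrow> (\<exists>x y. x \<noteq> y \<and> {x, y} \<subseteq> fixed_points X \<alpha>)"

lemma many_fixed_points_equivalent:
  assumes "equivalent_actions X \<alpha> Y \<beta>" "additive_action X \<alpha>"
  shows "many_fixed_points X \<alpha> \<longleftrightarrow> many_fixed_points Y \<beta>"
proof -
  obtain \<phi> where \<phi>: "bij_betw \<phi> (fixed_points X \<alpha>) (fixed_points Y \<beta>)"
    by (rule equivalent_actions_fixed_points[OF assms(1) additive_action_preserves[OF assms(2)]]) auto
  show ?thesis
  proof
    assume "many_fixed_points X \<alpha>"
    then obtain x y where "x \<noteq> y" "x \<in> fixed_points X \<alpha>" "y \<in> fixed_points X \<alpha>"
      by (auto simp: many_fixed_points_def)
    then have "\<phi> x \<noteq> \<phi> y" "{\<phi> x, \<phi> y} \<subseteq> fixed_points Y \<beta>"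
      using \<phi> by (auto simp: bij_betw_def inj_on_def)
    then show "many_fixed_points Y \<beta>" unfolding many_fixed_points_def by blast
  next
    assume "many_fixed_points Y \<beta>"
    then obtain x' y' where xy': "x' \<noteq> y'" "x' \<in> fixed_points Y \<beta>" "y' \<in> fixed_points Y \<beta>"
      by (auto simp: many_fixed_points_def)
    have onto: "\<exists>x. x \<in> fixed_points X \<alpha> \<and> \<phi> x = z" if "z \<in> fixed_points Y \<beta>" for z
      using that unfolding bij_betw_imp_surj_on[OF \<phi>, symmetric] by blast
    obtain x where x: "x \<in> fixed_points X \<alpha>" "\<phi> x = x'" using onto[OF xy'(2)] by blast
    obtain y where y: "y \<in> fixed_points X \<alpha>" "\<phi> y = y'" using onto[OF xy'(3)] by blast
    have "x \<noteq> y" using x(2) y(2) xy'(1) by blast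
    then show "many_fixed_points X \<alpha>"
      unfolding many_fixed_points_def using x(1) y(1) by (intro exI[of _ x] exI[of _ y]) simp
  qed
qed

text \<open>
  All points of the line spanned by the third and the fourth basis vector are fixed.
\<close>

lemma cone_action_0_two_fixed_points:
  fixes P P' :: "'a::field ^ 4 ^ 4"
  assumes P'P: "P' ** P = mat 1"
  shows "\<exists>L1 L2. L1 \<noteq> L2 \<and> {L1, L2} \<subseteq> fixed_points (projective_quadric P cone_form) (matrix_action P P' (cone_action 0))"
proof -
  have fixed: "line (P *v axis i 1) \<in> fixed_points (projective_quadric P cone_form) (matrix_action P P' (cone_action 0))"
    if "i = 3 \<or> i = 4" for i
  proof -
    have "axis i 1 \<noteq> (0 :: 'a ^ 4)" by (simp add: axis_eq_0_iff)
    moreover have "bil cone_form (axis i 1) (axis i 1 :: 'a ^ 4) = 0" using that by (auto simp: bil_cone_form axis_def)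
    moreover have "cone_action 0 g *v axis i 1 = axis i (1 :: 'a)" for g
      using that by (auto simp: cone_action_def vec_eq_iff forall_4 matrix_vector_mult_def sum_4 axis_def)
    ultimately show ?thesis
      unfolding fixed_points_def projective_quadric_def
      by (auto simp: matrix_action_line[OF P'P])
  qed
  have "line (P *v axis 3 1) \<noteq> line (P *v axis 4 (1 :: 'a))"
  proof
    assume "line (P *v axis 3 1) = line (P *v axis 4 (1 :: 'a))"
    then have "(*v) P' ` line (P *v axis 3 1) = (*v) P' ` line (P *v axis 4 (1 :: 'a))" by simp
    then have "line (axis 3 1 :: 'a ^ 4) = line (axis 4 1)"
      by (simp add: image_line matrix_vector_mul_assoc P'P)
    then have "(axis 3 1 :: 'a ^ 4) $ 3 * (axis 4 1 :: 'a ^ 4) $ 4 = (axis 3 1 :: 'a ^ 4) $ 4 * (axis 4 1 :: 'a ^ 4) $ 3"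
      by (rule line_eq_imp_parallel) (simp add: axis_eq_0_iff)
    then show False by (simp add: axis_def)
  qed
  then show ?thesis using fixed by blast
qed

text \<open>
  The translation by \<open>t\<close> forces the first coordinate of a fixed point to be zero, the equation of the
  cone the second, and the translation by \<open>s\<close> the third.
\<close>

lemma cone_action_1_fixed_point_unique:
  fixes P P' :: "'a::field_char_0 ^ 4 ^ 4"
  assumes P'P: "P' ** P = mat 1"
    and L: "L \<in> fixed_points (projective_quadric P cone_form) (matrix_action P P' (cone_action 1))"
  shows "L = line (P *v axis 4 1)"
proof -
  obtain x where x: "x \<noteq> 0" "bil cone_form x x = 0" "L = line (P *v x)"
    and fixed: "\<And>g. matrix_action P P' (cone_action 1) g L = L"
    using L unfolding fixed_points_def projective_quadric_def by blast
  have par: "(cone_action 1 g *v x) $ i * x $ j = (cone_action 1 g *v x) $ j * x $ i" for g i j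
  proof -
    have "line (P *v (cone_action 1 g *v x)) = line (P *v x)"
      using fixed[of g] unfolding x(3) matrix_action_line[OF P'P] .
    then have "(*v) P' ` line (P *v (cone_action 1 g *v x)) = (*v) P' ` line (P *v x)" by simp
    then have "line (cone_action 1 g *v x) = line x"
      by (simp only: image_line matrix_vector_mul_assoc P'P matrix_mul_lid matrix_vector_mul_lid matrix_mul_assoc)
    then show ?thesis using x(1) by (rule line_eq_imp_parallel)
  qed
  have 1: "x $ 1 = 0"
    using par[of "vector [0, 1]" 4 1] by (simp add: cone_action_def matrix_vector_mult_def sum_4 algebra_simps)
  then have 2: "x $ 2 = 0" using x(2) by (simp add: bil_cone_form)
  have "3 * (x $ 3 * x $ 3) = 0"
    using par[of "vector [1, 0]" 4 3] 1 2 by (simp add: cone_action_def matrix_vector_mult_def sum_4 algebra_simps)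
  then have 3: "x $ 3 = 0" by simp
  have "P *v x = x $ 4 *s (P *v axis 4 1)"
  proof -
    have "x = x $ 4 *s axis 4 1" using 1 2 3 by (simp add: vec_eq_iff forall_4 axis_def)
    then show ?thesis by (metis vector_scalar_commute)
  qed
  moreover have "x $ 4 \<noteq> 0" using x(1) 1 2 3 by (auto simp: vec_eq_iff forall_4)
  ultimately show ?thesis by (simp add: x(3) line_scale)
qed

section \<open>The classes of additive actions\<close>

lemma quadric_eq_projective_quadric:
  fixes A :: "'a::field ^ 'm ^ 'm"
  assumes PP': "P ** P' = mat 1" and P'P: "P' ** P = mat 1"
    and form: "\<And>x y. bil A (P *v x) (P *v y) = c * bil D x y" and c: "c \<noteq> 0"
  shows "{L \<in> proj_space. \<forall>v\<in>L. quadratic_form A v = 0} = projective_quadric P D"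
proof -
  have zero: "(\<forall>w\<in>line (P *v x). quadratic_form A w = 0) \<longleftrightarrow> bil D x x = 0" for x
  proof -
    have "quadratic_form A (k *s (P *v x)) = k * (k * (c * bil D x x))" for k
      by (simp add: quadratic_form_bil bil_scale_left bil_scale_right form)
    then have q: "quadratic_form A (k *s (P *v x)) = 0" if "bil D x x = 0" for k
      using that by simp
    have "quadratic_form A (P *v x) = c * bil D x x"
      by (simp add: quadratic_form_bil form)
    then have "bil D x x = 0" if "\<forall>w\<in>line (P *v x). quadratic_form A w = 0"
      using that c line_self[of "P *v x"] by auto
    with q show ?thesis by (auto simp: mem_line)
  qed
  have PP'v: "P *v (P' *v v) = v" for v by (simp add: matrix_vector_mul_assoc PP')
  have P0: "P *v x = 0 \<longleftrightarrow> x = 0" for x by (rule left_inverse_ker[OF P'P])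
  show ?thesis
  proof
    show "{L \<in> proj_space. \<forall>v\<in>L. quadratic_form A v = 0} \<subseteq> projective_quadric P D"
    proof
      fix L assume L: "L \<in> {L \<in> proj_space. \<forall>v\<in>L. quadratic_form A v = 0}"
      then obtain v where v: "v \<noteq> 0" "L = line (P *v (P' *v v))" by (auto simp: proj_space_def PP'v)
      then have "P' *v v \<noteq> 0" using PP'v[of v] by auto
      then show "L \<in> projective_quadric P D"
        using L zero v(2) unfolding projective_quadric_def by blast
    qed
    show "projective_quadric P D \<subseteq> {L \<in> proj_space. \<forall>v\<in>L. quadratic_form A v = 0}"
    proof
      fix L assume L: "L \<in> projective_quadric P D"
      then obtain x where x: "bil D x x = 0" "L = line (P *v x)" by (auto simp: projective_quadric_def)
      have "\<forall>v\<in>L. quadratic_form A v = 0" unfolding x(2) zero by (rule x(1))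
      then show "L \<in> {L \<in> proj_space. \<forall>v\<in>L. quadratic_form A v = 0}"
        using subsetD[OF projective_quadric_subset[OF P'P] L] by simp
    qed
  qed
qed

theorem proposition4:
  shows "(\<forall>Q \<in> (quadrics 3 :: ('a::{alg_closed_field, field_char_0} ^ 4) set set set).
            card (additive_action_classes Q ::
              ('a ^ 2 \<Rightarrow> ('a ^ 4) set \<Rightarrow> ('a ^ 4) set) set set) = 2) \<and>
         (\<forall>Q \<in> (quadrics 4 :: ('a ^ 4) set set set).
            card (additive_action_classes Q ::
              ('a ^ 2 \<Rightarrow> ('a ^ 4) set \<Rightarrow> ('a ^ 4) set) set set) = 1)"
proof (intro conjI ballI)
  fix Q :: "('a ^ 4) set set"
  assume "Q \<in> quadrics 3"
  then obtain A :: "'a ^ 4 ^ 4" where A: "transpose A = A" "rank A = 3"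
    and QA: "Q = {L \<in> proj_space. \<forall>v\<in>L. quadratic_form A v = 0}"
    unfolding quadrics_def by auto
  obtain P P' where P: "P ** P' = mat 1" "P' ** P = mat 1"
    and form: "\<And>x y. bil A (P *v x) (P *v y) = 2 * bil cone_form x y"
    by (rule symmetric_rank_three[OF A]) (rule that)
  have Q: "Q = projective_quadric P cone_form"
    unfolding QA by (rule quadric_eq_projective_quadric[OF P form]) simp
  have Q': "Q = {line (P *v x) | x. x \<noteq> 0 \<and> bil cone_form x x = 0}"
    unfolding Q projective_quadric_def ..
  have Qp: "Q \<subseteq> proj_space" unfolding Q by (rule projective_quadric_subset[OF P(2)])
  define std :: "'a \<Rightarrow> 'a ^ 2 \<Rightarrow> ('a ^ 4) set \<Rightarrow> ('a ^ 4) set"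
    where "std e = matrix_action P P' (cone_action e)" for e
  have std: "additive_action Q (std e)" for e
    unfolding Q std_def by (rule additive_cone_action[OF P])
  define X where "X = {\<alpha> :: 'a ^ 2 \<Rightarrow> ('a ^ 4) set \<Rightarrow> ('a ^ 4) set. additive_action Q \<alpha>}"
  define C where "C e = {\<alpha> \<in> X. lin_equiv Q (std e) \<alpha>}" for e
  define R where "R = {(\<alpha>, \<beta>). additive_action Q \<alpha> \<and> additive_action Q \<beta> \<and>
    equivalent_actions Q \<alpha> Q (\<beta> :: 'a ^ 2 \<Rightarrow> ('a ^ 4) set \<Rightarrow> ('a ^ 4) set)}"
  have CX: "C e \<subseteq> X" for e by (auto simp: C_def)
  have cover: "\<alpha> \<in> C 0 \<union> C 1" if "\<alpha> \<in> X" for \<alpha>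
  proof -
    have \<alpha>: "additive_action Q \<alpha>" using that by (simp add: X_def)
    show ?thesis
    proof (rule conic.action_data[OF P Q' \<alpha>], goal_cases)
      case (1 M x\<^sub>0)
      obtain e \<Phi> T k where e: "e \<in> {0, 1}" and \<Phi>: "invertible \<Phi>" and T: "invertible T"
        and k: "k \<noteq> 0" and form: "\<And>x y. bil cone_form (\<Phi> *v x) (\<Phi> *v y) = k * bil cone_form x y"
        and tw: "\<And>h. \<Phi> ** cone_action e h = M (T *v h) ** \<Phi>"
        by (rule cone_normal_form[where M = M and x\<^sub>0 = x\<^sub>0, OF 1(1,2,3,4,6,7,8)]) (rule that)
      have "lin_equiv Q (std e) \<alpha>"
        unfolding Q std_def by (rule lin_equiv_standard[where A = cone_form and S = "cone_action e" and M = M and \<alpha> = \<alpha>, OF P \<Phi> T form k tw 1(5)])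
      then show ?case using e that by (auto simp: C_def)
    qed
  qed
  have std_C: "std e \<in> C e" for e
    using std lin_equiv_refl by (simp add: C_def X_def)
  have within: "equivalent_actions Q \<alpha> Q \<beta>" if "\<alpha> \<in> C e" "\<beta> \<in> C e" for \<alpha> \<beta> e
    using that by (intro equivalent_if_lin_equiv_common[OF Qp std[of e]]) (simp_all add: C_def)
  have C_fix: "many_fixed_points Q \<alpha> \<longleftrightarrow> many_fixed_points Q (std e)" if "\<alpha> \<in> C e" for \<alpha> e
    using many_fixed_points_equivalent[OF within[OF std_C that] std] by simp
  \<comment> \<open>Fixed points separate the two families even for equivalences that are not
    known to be linear.\<close>
  have fix0: "many_fixed_points Q \<alpha>" if "\<alpha> \<in> C 0" for \<alpha>
    using C_fix[OF that] cone_action_0_two_fixed_points[OF P(2)] by (simp add: many_fixed_points_def std_def Q)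
  have fix1: "\<not> many_fixed_points Q \<alpha>" if \<alpha>: "\<alpha> \<in> C 1" for \<alpha>
  proof
    assume "many_fixed_points Q \<alpha>"
    then have "many_fixed_points Q (std 1)" using C_fix[OF \<alpha>] by simp
    then obtain x y where "x \<noteq> y" "x \<in> fixed_points Q (std 1)" "y \<in> fixed_points Q (std 1)"
      unfolding many_fixed_points_def insert_subset by (elim exE conjE)
    then show False
      using cone_action_1_fixed_point_unique[OF P(2), of x] cone_action_1_fixed_point_unique[OF P(2), of y]
      unfolding Q std_def by simp
  qed
  have R_iff: "(\<alpha>, \<beta>) \<in> R \<longleftrightarrow> \<alpha> \<in> X \<and> \<beta> \<in> X \<and> equivalent_actions Q \<alpha> Q \<beta>" for \<alpha> \<beta>
    by (simp add: R_def X_def)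
  have class0: "R `` {\<alpha>} = C 0" if "\<alpha> \<in> C 0" for \<alpha>
  proof (rule set_eqI)
    fix \<beta>
    have "\<beta> \<notin> C 1" if "equivalent_actions Q \<alpha> Q \<beta>"
      using many_fixed_points_equivalent[OF that] fix0[OF \<open>\<alpha> \<in> C 0\<close>] fix1[of \<beta>] CX[of 0] \<open>\<alpha> \<in> C 0\<close>
      by (auto simp: X_def)
    then show "\<beta> \<in> R `` {\<alpha>} \<longleftrightarrow> \<beta> \<in> C 0"
      using within[OF that] cover[of \<beta>] CX[of 0] that by (auto simp: R_iff)
  qed
  have class1: "R `` {\<alpha>} = C 1" if "\<alpha> \<in> C 1" for \<alpha>
  proof (rule set_eqI)
    fix \<beta>
    have "\<beta> \<notin> C 0" if "equivalent_actions Q \<alpha> Q \<beta>"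
      using many_fixed_points_equivalent[OF that] fix1[OF \<open>\<alpha> \<in> C 1\<close>] fix0[of \<beta>] CX[of 1] \<open>\<alpha> \<in> C 1\<close>
      by (auto simp: X_def)
    then show "\<beta> \<in> R `` {\<alpha>} \<longleftrightarrow> \<beta> \<in> C 1"
      using within[OF that] cover[of \<beta>] CX[of 1] that by (auto simp: R_iff)
  qed
  have "X // R = {C 0, C 1}"
  proof
    show "X // R \<subseteq> {C 0, C 1}"
      using cover class0 class1 unfolding quotient_def by fast
    have "C 0 \<in> X // R" "C 1 \<in> X // R"
      using quotientI[of "std 0" X R] quotientI[of "std 1" X R] class0[OF std_C] class1[OF std_C] std
      by (simp_all add: X_def)
    then show "{C 0, C 1} \<subseteq> X // R" by simp
  qed
  moreover have "C 0 \<noteq> C 1" using std_C[of 0] fix0[of "std 0"] fix1[of "std 0"] by metis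
  ultimately show "card (additive_action_classes Q :: ('a ^ 2 \<Rightarrow> ('a ^ 4) set \<Rightarrow> ('a ^ 4) set) set set) = 2"
    unfolding additive_action_classes_def X_def R_def by simp
next
  fix Q :: "('a ^ 4) set set"
  assume "Q \<in> quadrics 4"
  then obtain A :: "'a ^ 4 ^ 4" where A: "transpose A = A" "rank A = 4"
    and QA: "Q = {L \<in> proj_space. \<forall>v\<in>L. quadratic_form A v = 0}"
    unfolding quadrics_def by auto
  obtain P P' where P: "P ** P' = mat 1" "P' ** P = mat 1"
    and form: "\<And>x y. bil A (P *v x) (P *v y) = 2 * bil split_form x y"
    by (rule symmetric_rank_four[OF A]) (rule that)
  have Q: "Q = projective_quadric P split_form"
    unfolding QA by (rule quadric_eq_projective_quadric[OF P form]) simp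
  have Q': "Q = {line (P *v x) | x. x \<noteq> 0 \<and> bil split_form x x = 0}"
    unfolding Q projective_quadric_def ..
  have Qp: "Q \<subseteq> proj_space" unfolding Q by (rule projective_quadric_subset[OF P(2)])
  define std :: "'a ^ 2 \<Rightarrow> ('a ^ 4) set \<Rightarrow> ('a ^ 4) set"
    where "std = matrix_action P P' split_action"
  have std: "additive_action Q std"
    unfolding Q std_def by (rule additive_split_action[OF P])
  define X where "X = {\<alpha> :: 'a ^ 2 \<Rightarrow> ('a ^ 4) set \<Rightarrow> ('a ^ 4) set. additive_action Q \<alpha>}"
  define R where "R = {(\<alpha>, \<beta>). additive_action Q \<alpha> \<and> additive_action Q \<beta> \<and>
    equivalent_actions Q \<alpha> Q (\<beta> :: 'a ^ 2 \<Rightarrow> ('a ^ 4) set \<Rightarrow> ('a ^ 4) set)}"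
  have lin: "lin_equiv Q std \<alpha>" if "\<alpha> \<in> X" for \<alpha>
  proof -
    have \<alpha>: "additive_action Q \<alpha>" using that by (simp add: X_def)
    show ?thesis
    proof (rule segre.action_data[OF P Q' \<alpha>], goal_cases)
      case (1 M x\<^sub>0)
      obtain \<Phi> T where \<Phi>: "invertible \<Phi>" and T: "invertible T"
        and form: "\<And>x y. bil split_form (\<Phi> *v x) (\<Phi> *v y) = bil split_form x y"
        and tw: "\<And>h. \<Phi> ** split_action h = M (T *v h) ** \<Phi>"
        by (rule split_normal_form[where M = M and x\<^sub>0 = x\<^sub>0, OF 1(1,2,3,4,6,7)]) (rule that)
      have form': "bil split_form (\<Phi> *v x) (\<Phi> *v y) = 1 * bil split_form x y" for x y
        by (simp add: form)
      show ?case
        unfolding Q std_def by (rule lin_equiv_standard[where A = split_form and S = split_action and M = M and \<alpha> = \<alpha>, OF P \<Phi> T form' _ tw 1(5)]) simp_all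
    qed
  qed
  have R: "R `` {\<alpha>} = X" if "\<alpha> \<in> X" for \<alpha>
    using that equivalent_if_lin_equiv_common[OF Qp std lin[OF that] lin]
    by (auto simp: R_def X_def)
  have "std \<in> X" using std by (simp add: X_def)
  then have "X // R = {X}"
    using R unfolding quotient_def by auto
  then show "card (additive_action_classes Q :: ('a ^ 2 \<Rightarrow> ('a ^ 4) set \<Rightarrow> ('a ^ 4) set) set set) = 1"
    unfolding additive_action_classes_def X_def R_def by simp
qed

end
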